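(* Let $XYZ$ be a triangle, $F$ a point in $XYZ$, and $A$ a finite set of points inside $XYZ$ such that $\{X,Y,Z,F\}\cup A$ is in general position. Set $P_1=X$, $P_2=Y$, $P_3=Z$ (indices mod 3), and let $c_i$ be the number of points of $A$ in the triangle $FP_iP_{i+1}$; assume all $c_i$ are positive. Then there exists an ordering of the points of $A$ as $(A_{1,1},\dots,A_{1,c_1},A_{2,1},\dots,A_{2,c_2},A_{3,1},\dots,A_{3,c_3})$ such that, letting $L_i$ be the polyline $P_iA_{i,1}\dots A_{i,c_i}P_{i+1}$ for $1\le i\le 3$: each $L_i$ lies inside the triangle $FP_iP_{i+1}$; the concatenation $L_1L_2L_3$ is a closed non-self-intersecting polyline (a simple polygon); and the region inside $L_1L_2L_3$ can be triangulated so that no diagonal that is not an edge of the polygon has both endpoints on the same polyline $L_i$.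
   Context: General position means no three points collinear. *)

theory Defs
  imports "HOL-Analysis.Analysis"
begin

definition general_position :: "(real^2) set \<Rightarrow> bool" where
  "general_position S \<longleftrightarrow>
     (\<forall>a\<in>S. \<forall>b\<in>S. \<forall>c\<in>S. a \<noteq> b \<and> b \<noteq> c \<and> a \<noteq> c \<longrightarrow> \<not> collinear {a, b, c})"

(* The path running through the listed vertices along straight segments.
   The values on lists with fewer than two vertices are conventional. *)
fun polyline :: "(real^2) list \<Rightarrow> real \<Rightarrow> real^2" where
  "polyline [] = linepath 0 0"
| "polyline [a] = linepath a a"
| "polyline [a, b] = linepath a b"
| "polyline (a # b # c # vs) = linepath a b +++ polyline (b # c # vs)"

definition polyline_edges :: "(real^2) list \<Rightarrow> (real^2) set set" where
  "polyline_edges vs = {closed_segment (vs ! k) (vs ! Suc k) | k. Suc k < length vs}"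

(* A closed polyline is given by a vertex list whose first and last entries agree;
   simple_path permits only this coincidence of the two ends. *)
definition simple_polygon :: "(real^2) list \<Rightarrow> bool" where
  "simple_polygon vs \<longleftrightarrow>
     simple_path (polyline vs) \<and> pathfinish (polyline vs) = pathstart (polyline vs)"

(* The bounded region enclosed by a polygon, together with its boundary. *)
definition polygon_region :: "(real^2) list \<Rightarrow> (real^2) set" where
  "polygon_region vs = path_image (polyline vs) \<union> inside (path_image (polyline vs))"

(* Triangulation by diagonals: the triangles meet face to face and fill the region, and no
   vertices other than those of the polygon are used. *)
definition polygon_triangulation :: "(real^2) list \<Rightarrow> (real^2) set set \<Rightarrow> bool" where
  "polygon_triangulation vs \<T> \<longleftrightarrow>
     triangulation \<T> \<and>
     (\<forall>T\<in>\<T>. 2 simplex T \<and> {x. x extreme_point_of T} \<subseteq> set vs) \<and>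
     \<Union>\<T> = polygon_region vs"

(* The segment uv is a side of a triangle of the triangulation. *)
definition triangulation_edge :: "(real^2) set set \<Rightarrow> real^2 \<Rightarrow> real^2 \<Rightarrow> bool" where
  "triangulation_edge \<T> u v \<longleftrightarrow>
     u \<noteq> v \<and> (\<exists>T\<in>\<T>. closed_segment u v face_of T)"

end

(* Let A_i be the set of the points of A in the i-th triangle F P_i P_(i+1).

   Call a point a of A_1 a spoke if, seen from the opposite corner Z, it lies after all points of
   A_3 and before all points of A_2 (and cyclically). If there is a spoke a, use the diagonal Za;
   each of its sides is a strip between two chains separated by the line FX or FY. Otherwise there
   is a triangle abc with one vertex in each A_i to which the three corners can be attached by
   such strips. To find it, call a pair (b,c) in A_2 x A_3 good if it turns counterclockwise around
   F, or if all points of A_1 lie on the far side of bc from F. Without spokes a triple of pairwise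
   good points exists; one whose triangle is inclusion-minimal contains no other point of A, and
   no other point of A_1 lies in the cone at a spanned by b and c (and cyclically).

   A strip between finite sets P, Q on the two sides of a line through a corner V is triangulated
   by peeling off vertices of the edge of the convex hull of P and Q that crosses the line farthest
   from V: of its two endpoints at least one can be removed while keeping the other one. *)
theory Submission
  imports Defs
begin

section \<open>Orientation\<close>

text \<open>The order of the points is not chosen beforehand. The polygon grows by gluing a triangle
  along one edge at a time, so that the order, simplicity and the triangulation result from the same
  induction. That \<open>L_i\<close> stays in its triangle is then automatic, since this triangle is
  convex and contains the vertices of \<open>L_i\<close>. The condition on diagonals is enforced by
  gluing only along edges whose ends share none of the three triangles at \<open>F\<close>.

  The obstacle is that a new triangle may meet the region built so far only in the edge it is glued
  to. So the hulls of different strips have to be separated by lines. Lines through \<open>F\<close>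
  do this as long as \<open>a\<close>, \<open>b\<close>, \<open>c\<close> surround \<open>F\<close>.
  If \<open>F\<close> lies beyond \<open>bc\<close>, the line \<open>bc\<close> itself has to
  separate the strip at \<open>Z\<close> from the other two, and then all points of the sector
  opposite to \<open>Z\<close> must lie on its other side: this is the second clause of a good pair.

  Angles and areas are expressed by signs of orientation determinants and polynomial identities
  between them. The hypotheses are preserved by cyclic renaming and by reflection, so one case of
  each symmetry class is treated.\<close>

text \<open>The factor \<open>s\<close> allows us to assume that \<open>XYZ\<close> is positively oriented, and replacing
  \<open>s\<close> by \<open>- s\<close> turns a statement into its mirror image.\<close>

definition ori :: "real \<Rightarrow> real^2 \<Rightarrow> real^2 \<Rightarrow> real^2 \<Rightarrow> real" where
  "ori s a b c = s * ((b$1 - a$1) * (c$2 - a$2) - (b$2 - a$2) * (c$1 - a$1))"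

lemma collinear_iff_det:
  fixes a b c :: "real^2"
  shows "collinear {a, b, c} \<longleftrightarrow> (b$1 - a$1) * (c$2 - a$2) = (b$2 - a$2) * (c$1 - a$1)"
proof -
  have cross: "collinear {0, x, y} \<longleftrightarrow> x$1 * y$2 = x$2 * y$1" for x y :: "real^2"
  proof
    assume "collinear {0, x, y}"
    then show "x$1 * y$2 = x$2 * y$1" by (auto simp: collinear_lemma)
  next
    assume e: "x$1 * y$2 = x$2 * y$1"
    show "collinear {0, x, y}"
    proof (cases "x$1 = 0")
      case x1: True
      show ?thesis
      proof (cases "x$2 = 0")
        case True
        then have "x = 0" using x1 by (simp add: vec_eq_iff forall_2)
        then show ?thesis by (simp add: collinear_lemma)
      next
        case False
        then have "y = (y$2 / x$2) *\<^sub>R x" using x1 e by (simp add: vec_eq_iff forall_2)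
        then show ?thesis unfolding collinear_lemma by blast
      qed
    next
      case False
      then have "y = (y$1 / x$1) *\<^sub>R x" using e by (simp add: vec_eq_iff forall_2 field_simps)
      then show ?thesis unfolding collinear_lemma by blast
    qed
  qed
  have "collinear {b, a, c} \<longleftrightarrow> collinear {0, b - a, c - a}" by (rule collinear_3) simp
  then show ?thesis using cross[of "b - a" "c - a"] by (simp add: insert_commute)
qed

lemma ori_eq_0_iff: "s \<noteq> 0 \<Longrightarrow> ori s a b c = 0 \<longleftrightarrow> collinear {a, b, c}"
  by (simp add: ori_def collinear_iff_det)

section \<open>Polylines and the Jordan curve theorem in the real plane\<close>

lemma polyline_Cons:
  "vs \<noteq> [] \<Longrightarrow> polyline (a # b # vs) = linepath a b +++ polyline (b # vs)"
  by (cases vs) auto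

lemma pathstart_polyline [simp]: "vs \<noteq> [] \<Longrightarrow> pathstart (polyline vs) = hd vs"
  by (induction vs rule: polyline.induct) auto

lemma pathfinish_polyline [simp]: "vs \<noteq> [] \<Longrightarrow> pathfinish (polyline vs) = last vs"
  by (induction vs rule: polyline.induct) auto

text \<open>The two paths run through the same segments and differ only in how the joins are nested.
  The claim about arcs has to be carried along, since the simplicity of a closed join is a statement
  about its two parts being arcs.\<close>

lemma polyline_append_equiv:
  assumes "xs \<noteq> []" "ys \<noteq> []"
  shows "path_image (polyline (xs @ [y] @ ys)) = path_image (polyline (xs @ [y])) \<union> path_image (polyline (y # ys))
    \<and> (simple_path (polyline (xs @ [y] @ ys)) \<longleftrightarrow> simple_path (polyline (xs @ [y]) +++ polyline (y # ys)))
    \<and> (arc (polyline (xs @ [y] @ ys)) \<longleftrightarrow> arc (polyline (xs @ [y]) +++ polyline (y # ys)))"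
  using assms
proof (induction xs)
  case (Cons a xs)
  show ?case
  proof (cases xs)
    case Nil
    then show ?thesis using Cons.prems by (simp add: polyline_Cons path_image_join)
  next
    case (Cons b zs)
    have IH: "path_image (polyline (xs @ [y] @ ys)) = path_image (polyline (xs @ [y])) \<union> path_image (polyline (y # ys))"
      "arc (polyline (xs @ [y] @ ys)) \<longleftrightarrow> arc (polyline (xs @ [y]) +++ polyline (y # ys))"
      using Cons.IH Cons Cons.prems by auto
    have pfs: "pathfinish (polyline (xs @ [y])) = y" "pathstart (polyline (xs @ [y])) = b"
      "pathstart (polyline (xs @ [y] @ ys)) = b"
      using Cons by auto
    have pff: "pathfinish (polyline (xs @ [y] @ ys)) = pathfinish (polyline (y # ys))"
      using \<open>ys \<noteq> []\<close> by simp
    have s: "polyline ((a # xs) @ [y]) = linepath a b +++ polyline (xs @ [y])"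
      "polyline ((a # xs) @ [y] @ ys) = linepath a b +++ polyline (xs @ [y] @ ys)"
      using Cons by (auto simp: polyline_Cons)
    have 1: "simple_path (linepath a b +++ polyline (xs @ [y] @ ys)) \<longleftrightarrow>
          simple_path (linepath a b +++ (polyline (xs @ [y]) +++ polyline (y # ys)))"
    \<comment> \<open>A join that closes up is simple iff its parts are arcs meeting only in their
      ends, and one that does not close up is simple iff it is an arc; either way the induction
      hypothesis on arcs suffices.\<close>
    proof (cases "pathfinish (polyline (y # ys)) = a")
      case True
      then show ?thesis
        using IH pfs pff by (simp add: simple_path_join_loop_eq path_image_join)
    next
      case False
      then show ?thesis
        using IH pfs pff by (simp add: simple_path_eq_arc arc_join_eq path_image_join)
    qed
    have 2: "arc (linepath a b +++ polyline (xs @ [y] @ ys)) \<longleftrightarrow>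
          arc (linepath a b +++ (polyline (xs @ [y]) +++ polyline (y # ys)))"
      using IH pfs pff by (simp add: arc_join_eq path_image_join)
    have 3: "path_image (linepath a b +++ polyline (xs @ [y] @ ys)) =
       path_image (linepath a b +++ polyline (xs @ [y])) \<union> path_image (polyline (y # ys))"
      using IH pfs by (simp add: path_image_join Un_assoc)
    have 4: "simple_path (linepath a b +++ (polyline (xs @ [y]) +++ polyline (y # ys))) \<longleftrightarrow>
       simple_path ((linepath a b +++ polyline (xs @ [y])) +++ polyline (y # ys))"
      by (rule simple_path_assoc) (use pfs in auto)
    have 5: "arc (linepath a b +++ (polyline (xs @ [y]) +++ polyline (y # ys))) \<longleftrightarrow>
       arc ((linepath a b +++ polyline (xs @ [y])) +++ polyline (y # ys))"
      by (rule arc_assoc) (use pfs in auto)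
    show ?thesis unfolding s using 1 2 3 4 5 by blast
  qed
qed simp

lemmas path_image_polyline_append = polyline_append_equiv [THEN conjunct1]
lemmas simple_path_polyline_append = polyline_append_equiv [THEN conjunct2, THEN conjunct1]

lemma path_image_polyline_subset_hull: "vs \<noteq> [] \<Longrightarrow> path_image (polyline vs) \<subseteq> convex hull (set vs)"
proof (induction vs rule: polyline.induct)
  case (4 a b c vs)
  have "path_image (polyline (a # b # c # vs)) = closed_segment a b \<union> path_image (polyline (b # c # vs))"
    by (simp add: path_image_join)
  moreover have "closed_segment a b \<subseteq> convex hull (set (a # b # c # vs))"
    by (simp add: segment_convex_hull hull_mono)
  moreover have "convex hull (set (b # c # vs)) \<subseteq> convex hull (set (a # b # c # vs))"
    by (rule hull_mono) auto
  ultimately show ?case using 4 by blast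
qed (auto simp: segment_convex_hull)

text \<open>Polygons are handled as cyclic lists without the repeated vertex, since these can be
  rotated; \<open>close\<close> turns them into vertex lists of closed polylines.\<close>

definition close :: "(real^2) list \<Rightarrow> (real^2) list" where
  "close vs = vs @ [hd vs]"

lemma close_polygon_ends: "vs \<noteq> [] \<Longrightarrow> pathfinish (polyline (close vs)) = pathstart (polyline (close vs))"
  by (simp add: close_def)

text \<open>Cut at the first vertices of \<open>xs\<close> and \<open>ys\<close>, the loop is a join
  of two polylines; rotation exchanges them, and simplicity of a closed join is symmetric in its
  parts.\<close>

lemma close_rotate:
  assumes "xs \<noteq> []" "ys \<noteq> []"
  shows "path_image (polyline (close (xs @ ys))) = path_image (polyline (close (ys @ xs)))"
    and "simple_path (polyline (close (xs @ ys))) \<longleftrightarrow> simple_path (polyline (close (ys @ xs)))"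
proof -
  obtain x xs' y ys' where xy: "xs = x # xs'" "ys = y # ys'"
    using assms by (meson neq_Nil_conv)
  have a: "close (xs @ ys) = xs @ [y] @ (ys' @ [x])" "close (ys @ xs) = ys @ [x] @ (xs' @ [y])"
    using xy by (auto simp: close_def)
  have b: "x # xs' @ [y] = xs @ [y]" "y # ys' @ [x] = ys @ [x]" using xy by auto
  show "path_image (polyline (close (xs @ ys))) = path_image (polyline (close (ys @ xs)))"
    unfolding a using assms by (subst (1 2) path_image_polyline_append) (auto simp: b)
  have "simple_path (polyline (close (xs @ ys))) \<longleftrightarrow> simple_path (polyline (xs @ [y]) +++ polyline (ys @ [x]))"
    unfolding a using assms by (subst simple_path_polyline_append) (auto simp: b)
  also have "\<dots> \<longleftrightarrow> simple_path (polyline (ys @ [x]) +++ polyline (xs @ [y]))"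
    using xy by (auto simp: simple_path_join_loop_eq)
  also have "\<dots> \<longleftrightarrow> simple_path (polyline (close (ys @ xs)))"
    unfolding a using assms by (subst simple_path_polyline_append) (auto simp: b)
  finally show "simple_path (polyline (close (xs @ ys))) \<longleftrightarrow> simple_path (polyline (close (ys @ xs)))" .
qed

lemma polyline_edges_Cons:
  "polyline_edges (a # b # vs) = insert (closed_segment a b) (polyline_edges (b # vs))"
proof -
  have "{closed_segment ((a # b # vs) ! k) ((a # b # vs) ! Suc k) |k. Suc k < length (a # b # vs)}
    = (\<lambda>k. closed_segment ((a # b # vs) ! k) ((a # b # vs) ! Suc k)) ` {..<Suc (length vs)}"
    by auto
  also have "{..<Suc (length vs)} = insert 0 (Suc ` {..<length vs})"
    by (auto simp: lessThan_Suc_eq_insert_0)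
  finally show ?thesis by (auto simp: polyline_edges_def image_image)
qed

lemma polyline_edges_single [simp]: "polyline_edges [a] = {}"
  by (auto simp: polyline_edges_def)

lemma polyline_edges_append:
  "polyline_edges (xs @ [y] @ ys) = polyline_edges (xs @ [y]) \<union> polyline_edges (y # ys)"
proof (induction xs)
  case (Cons a xs) then show ?case by (cases xs) (auto simp: polyline_edges_Cons)
qed simp

lemma polyline_edges_rotate:
  assumes "xs \<noteq> []" "ys \<noteq> []"
  shows "polyline_edges (close (xs @ ys)) = polyline_edges (close (ys @ xs))"
proof -
  obtain x xs' y ys' where xy: "xs = x # xs'" "ys = y # ys'"
    using assms by (meson neq_Nil_conv)
  have a: "close (xs @ ys) = xs @ [y] @ (ys' @ [x])" "close (ys @ xs) = ys @ [x] @ (xs' @ [y])"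
    using xy by (auto simp: close_def)
  show ?thesis unfolding a polyline_edges_append using xy by auto
qed

section \<open>The Jordan curve theorem, transported from the complex plane along a linear
  bijection\<close>

definition cplx :: "real^2 \<Rightarrow> complex" where "cplx x = Complex (x$1) (x$2)"
definition uncplx :: "complex \<Rightarrow> real^2" where "uncplx z = vector [Re z, Im z]"

lemma cplx_uncplx [simp]: "cplx (uncplx z) = z" by (simp add: cplx_def uncplx_def)
lemma uncplx_cplx [simp]: "uncplx (cplx z) = z"
  by (simp add: cplx_def uncplx_def vec_eq_iff forall_2)
lemma linear_cplx: "linear cplx" 
  by (rule linearI) (auto simp: cplx_def complex_eq_iff)
lemma linear_uncplx: "linear uncplx" 
  by (rule linearI) (auto simp: uncplx_def vec_eq_iff forall_2)

lemma inside_linear_image: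
  fixes f :: "'a::euclidean_space \<Rightarrow> 'b::euclidean_space"
  assumes "linear f" "linear g" "\<And>x. g (f x) = x" "\<And>x. f (g x) = x"
  shows "inside (f ` S) = f ` inside S"
proof -
  \<comment> \<open>One inclusion for an arbitrary pair of inverse maps is enough: applied to
    \<open>g\<close> it gives the converse.\<close>
  have *: "f' ` inside S \<subseteq> inside (f' ` S)"
    if f': "linear f'" "linear g'" "\<And>x. g' (f' x) = x" "\<And>x. f' (g' x) = x"
    for f' :: "'c::euclidean_space \<Rightarrow> 'd::euclidean_space" and g' S
  proof clarify
    fix x assume x: "x \<in> inside S"
    have sub: "connected_component_set (- f' ` S) (f' x) \<subseteq> f' ` connected_component_set (- S) x"
    proof
      fix y assume "y \<in> connected_component_set (- f' ` S) (f' x)"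
      then obtain T where T: "connected T" "T \<subseteq> - f' ` S" "f' x \<in> T" "y \<in> T"
        by (auto simp: connected_component_def)
      have "connected (g' ` T)"
        using T(1) f'(2) by (intro connected_continuous_image linear_continuous_on) (auto simp: linear_conv_bounded_linear)
      moreover have "g' ` T \<subseteq> - S"
        using T(2) f'(4) by (auto simp: subset_iff) (metis image_eqI)
      moreover have "x \<in> g' ` T" using T(3) f'(3) by (metis image_eqI)
      ultimately have "g' y \<in> connected_component_set (- S) x"
        using T(4) by (auto simp: connected_component_def)
      then show "y \<in> f' ` connected_component_set (- S) x" using f'(4) by (metis image_eqI)
    qed
    have "bounded (connected_component_set (- f' ` S) (f' x))"
    proof (rule bounded_subset[OF _ sub])
      show "bounded (f' ` connected_component_set (- S) x)"
        using x f'(1) by (intro bounded_linear_image) (auto simp: inside_def linear_conv_bounded_linear)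
    qed
    moreover have "f' x \<notin> f' ` S" using x f'(3) by (metis (no_types, lifting) IntI empty_iff image_iff inside_no_overlap)
    ultimately show "f' x \<in> inside (f' ` S)" by (simp add: inside_def)
  qed
  show ?thesis
  proof
    show "f ` inside S \<subseteq> inside (f ` S)" by (rule *[OF assms])
    have "g ` inside (f ` S) \<subseteq> inside (g ` f ` S)" by (rule *[OF assms(2,1,4,3)])
    then have "g ` inside (f ` S) \<subseteq> inside S" using assms(3) by (simp add: image_image)
    then show "inside (f ` S) \<subseteq> f ` inside S"
      using assms(4) by (metis image_eqI image_subset_iff subsetI)
  qed
qed

lemma Jordan_inside_real2:
  fixes c :: "real \<Rightarrow> real^2"
  assumes "simple_path c" "pathfinish c = pathstart c"
  shows "connected (inside (path_image c))" "open (inside (path_image c))"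
    "bounded (inside (path_image c))"
    "frontier (inside (path_image c)) = path_image c"
    "outside (path_image c) = - (path_image c \<union> inside (path_image c))"
proof -
  have inj: "inj cplx" by (metis injI uncplx_cplx)
  have sp: "simple_path (cplx \<circ> c)" using assms(1) by (simp add: simple_path_linear_image_eq linear_cplx inj)
  have loop: "pathfinish (cplx \<circ> c) = pathstart (cplx \<circ> c)"
    using assms(2) by (simp add: pathfinish_def pathstart_def)
  note J = Jordan_inside_outside[OF sp loop]
  have pi: "path_image (cplx \<circ> c) = cplx ` path_image c" by (simp add: path_image_compose)
  have ins: "inside (path_image c) = uncplx ` inside (path_image (cplx \<circ> c))"
    unfolding pi inside_linear_image[OF linear_cplx linear_uncplx uncplx_cplx cplx_uncplx]
    by (simp add: image_image)
  show "connected (inside (path_image c))"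
    unfolding ins using J linear_uncplx
    by (intro connected_continuous_image linear_continuous_on) (auto simp: linear_conv_bounded_linear)
  show "bounded (inside (path_image c))"
    unfolding ins using J linear_uncplx by (intro bounded_linear_image) (auto simp: linear_conv_bounded_linear)
  show "open (inside (path_image c))"
    by (rule open_inside) (simp add: assms closed_simple_path_image)
  have "frontier (uncplx ` inside (path_image (cplx \<circ> c))) = uncplx ` frontier (inside (path_image (cplx \<circ> c)))"
  proof -
    have bij: "bij uncplx" by (metis bijI' cplx_uncplx uncplx_cplx)
    show ?thesis
    unfolding frontier_def using linear_uncplx bij
    by (simp add: closure_injective_linear_image[OF linear_uncplx] 
       interior_bijective_linear_image image_set_diff bij_is_inj)
  qed
  then show "frontier (inside (path_image c)) = path_image c"
    unfolding ins using J pi by (simp add: image_image)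
  show "outside (path_image c) = - (path_image c \<union> inside (path_image c))"
    by (simp add: outside_inside)
qed

text \<open>Recognises the enclosed region by its boundary. Off the curve, \<open>K\<close> and its
  complement are both open, so no component of the complement of the curve meets both. Components
  within \<open>K\<close> are bounded, hence inside; since the inside is connected, one such
  component fills it. \<open>K \<noteq> path_image c\<close> excludes the bare curve.\<close>

lemma compact_region_eq_inside:
  fixes c :: "real \<Rightarrow> real^2"
  assumes c: "simple_path c" "pathfinish c = pathstart c"
    and K: "compact K" "path_image c \<subseteq> K" "frontier K \<subseteq> path_image c" "K \<noteq> path_image c"
  shows "K = path_image c \<union> inside (path_image c)"
proof -
  let ?C = "path_image c"
  note J = Jordan_inside_real2[OF c]
  define U where "U = K - ?C"
  have closedK: "closed K" using K(1) by (rule compact_imp_closed)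
  have "U = interior K - ?C"
    using K(3) closedK interior_subset[of K] by (auto simp: U_def frontier_def closure_closed)
  then have openU: "open U" using c(1) by (auto simp: closed_simple_path_image)
  have openV: "open (- K)" using closedK by auto
  have U_inside: "U \<subseteq> inside ?C"
  proof
    fix x assume x: "x \<in> U"
    let ?S = "connected_component_set (- ?C) x"
    have "?S \<subseteq> U \<union> - K" using connected_component_subset[of "- ?C" x] by (auto simp: U_def)
    moreover have "connected ?S" by simp
    moreover have "x \<in> ?S" using x by (auto simp: U_def connected_component_refl)
    moreover have "U \<inter> - K \<inter> ?S = {}" by (auto simp: U_def)
    ultimately have "?S \<inter> - K = {}"
      using connectedD[OF _ openU openV, of ?S] x by blast
    then have "?S \<subseteq> K" by auto
    then have "bounded ?S" using K(1) bounded_subset compact_imp_bounded by blast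
    then show "x \<in> inside ?C" using x by (auto simp: inside_def U_def)
  qed
  have "U \<noteq> {}" using K by (auto simp: U_def)
  then have "inside ?C \<inter> - K = {}"
  proof -
    have "U \<inter> inside ?C \<noteq> {}" using \<open>U \<noteq> {}\<close> U_inside by blast
    moreover have "inside ?C \<subseteq> U \<union> - K" "U \<inter> - K \<inter> inside ?C = {}"
      using inside_no_overlap[of ?C] unfolding U_def by blast+
    ultimately show ?thesis using connectedD[OF J(1) openU openV] by blast
  qed
  then show ?thesis using U_inside K(2) by (auto simp: U_def)
qed

section \<open>Local geometry at an edge along which a triangle is attached\<close>

lemma closed_segment_Int_triangle_sides:
  fixes u v w :: "real^2"
  assumes "\<not> collinear {u, w, v}"
  shows "closed_segment u w \<inter> closed_segment w v = {w}"
    "(closed_segment u w \<union> closed_segment w v) \<inter> closed_segment u v = {u, v}"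
proof -
  show "closed_segment u w \<inter> closed_segment w v = {w}"
    by (rule Int_closed_segment) (use assms in auto)
  have "closed_segment w u \<inter> closed_segment u v = {u}"
    by (rule Int_closed_segment) (use assms in \<open>auto simp: insert_commute\<close>)
  moreover have "closed_segment w v \<inter> closed_segment v u = {v}"
    by (rule Int_closed_segment) (use assms in \<open>auto simp: insert_commute\<close>)
  ultimately show "(closed_segment u w \<union> closed_segment w v) \<inter> closed_segment u v = {u, v}"
    by (auto simp: closed_segment_commute)
qed

lemma frontier_triangle_real2:
  fixes a b c :: "real^2"
  shows "frontier (convex hull {a, b, c}) \<subseteq> closed_segment a b \<union> closed_segment b c \<union> closed_segment c a"
    using frontier_of_triangle[of a b c] by (simp)

text \<open>A small disc around \<open>x\<close> is cut by \<open>uv\<close> into two halves. One is contained in the triangle; as \<open>x\<close> is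
  a boundary point of the inside of \<open>C\<close>, the other one is contained in that inside.\<close>

lemma open_segment_interior_glued:
  fixes u v w :: "real^2" and C :: "(real^2) set"
  assumes ncol: "\<not> collinear {u, w, v}"
    and C: "closed C" "frontier (inside C) = C" 
    and G: "closed G" "C = G \<union> closed_segment u v" "G \<inter> closed_segment u v \<subseteq> {u, v}"
    and int: "(C \<union> inside C) \<inter> convex hull {u, w, v} \<subseteq> closed_segment u v"
    and x: "x \<in> open_segment u v"
  shows "x \<in> interior (C \<union> inside C \<union> convex hull {u, w, v})"
proof -
  let ?D = "convex hull {u, w, v}" and ?E = "closed_segment u w \<union> closed_segment w v"
  \<comment> \<open>A normal vector of the line \<open>uv\<close>: \<open>u - v\<close> turned by a
    right angle.\<close>
  define n :: "real^2" where "n = vector [u$2 - v$2, v$1 - u$1]"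
  define k where "k = n \<bullet> u"
  have nip: "n \<bullet> y = (u$2 - v$2) * y$1 + (v$1 - u$1) * y$2" for y
    by (simp add: n_def inner_vec_def sum_2)
  have uv: "u \<noteq> v" using x by auto
  have n0: "n \<noteq> 0"
    using uv by (auto simp: n_def vec_eq_iff forall_2)
  have nv: "n \<bullet> v = k" by (simp add: nip k_def algebra_simps)
  have line: "n \<bullet> y = k" if y: "y \<in> closed_segment u v" for y
  proof -
    obtain t where "y = (1 - t) *\<^sub>R u + t *\<^sub>R v" using y unfolding closed_segment_def by blast
    then have "n \<bullet> y = (1 - t) * (n \<bullet> u) + t * (n \<bullet> v)" by (simp only: inner_add_right inner_scaleR_right)
    then show ?thesis using nv k_def by (simp add: algebra_simps)
  qed
  have nw: "n \<bullet> w \<noteq> k"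
  proof
    assume "n \<bullet> w = k"
    then have e: "(u$2 - v$2) * (w$1 - u$1) + (v$1 - u$1) * (w$2 - u$2) = 0"
      by (simp add: nip k_def algebra_simps)
    then have "collinear {u, v, w}" by (simp add: collinear_iff_det algebra_simps)
    then show False using ncol by (metis insert_commute)
  qed
  have xseg: "x \<in> closed_segment u v" "x \<noteq> u" "x \<noteq> v" using x by (auto simp: open_segment_def)
  have "x \<notin> G \<union> ?E"
    using G(3) xseg closed_segment_Int_triangle_sides(2)[OF ncol] by blast
  moreover have "closed (G \<union> ?E)" using G(1) by (intro closed_Un) auto
  ultimately obtain e where "e > 0" "ball x e \<subseteq> - (G \<union> ?E)"
    by (meson ComplI open_Compl open_contains_ball)
  then have e: "e > 0" "ball x e \<inter> (G \<union> ?E) = {}" by auto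
  define B where "B = ball x e"
  \<comment> \<open>Normalises the sign so that \<open>Bp\<close> is the half disc on the side of
    \<open>w\<close>.\<close>
  define s where "s = sgn (n \<bullet> w - k)"
  have s: "s * (n \<bullet> w - k) > 0" "s \<noteq> 0" using nw by (auto simp: s_def sgn_if)
  define Bp where "Bp = {y \<in> B. s * (n \<bullet> y - k) > 0}"
  define Bm where "Bm = {y \<in> B. s * (n \<bullet> y - k) < 0}"
  have conv: "convex Bp" "convex Bm"
  proof -
    have "Bp = B \<inter> {y. (s *\<^sub>R n) \<bullet> y > s * k}" "Bm = B \<inter> {y. (s *\<^sub>R n) \<bullet> y < s * k}"
      by (auto simp: Bp_def Bm_def algebra_simps)
    then show "convex Bp" "convex Bm"
      unfolding B_def by (metis convex_Int convex_ball convex_halfspace_gt, metis convex_Int convex_ball convex_halfspace_lt)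
  qed
  have offline: "y \<notin> closed_segment u v" if "y \<in> Bp \<union> Bm" for y
    using that line[of y] by (auto simp: Bp_def Bm_def)
  have offC: "(Bp \<union> Bm) \<inter> C = {}"
  proof -
    have "Bp \<union> Bm \<subseteq> B" by (auto simp: Bp_def Bm_def)
    then show ?thesis using e(2) offline G(2) unfolding B_def by blast
  qed
  obtain t where t: "t > 0" "t \<le> 1" "x + t *\<^sub>R (w - x) \<in> B"
  proof
    \<comment> \<open>The summand 1 keeps the denominator positive; the step from \<open>x\<close>
      towards \<open>w\<close> has length at most \<open>e / 2\<close>.\<close>
    let ?t = "min 1 (e / (2 * (norm (w - x) + 1)))"
    show "?t > 0" "?t \<le> 1" using e(1) by (auto intro!: divide_pos_pos add_nonneg_pos)
    have "?t * norm (w - x) \<le> (e / (2 * (norm (w - x) + 1))) * norm (w - x)"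
      by (intro mult_right_mono) auto
    also have "\<dots> = (e / 2) * (norm (w - x) / (norm (w - x) + 1))" by simp
    also have "\<dots> \<le> (e / 2) * 1"
      using e(1) by (intro mult_left_mono) (auto simp: divide_simps add_nonneg_pos)
    also have "\<dots> < e" using e(1) by simp
    finally show "x + ?t *\<^sub>R (w - x) \<in> B"
      using \<open>?t > 0\<close> by (simp add: B_def dist_norm abs_mult)
  qed
  define z where "z = x + t *\<^sub>R (w - x)"
  have "z = (1 - t) *\<^sub>R x + t *\<^sub>R w" by (simp add: z_def algebra_simps)
  moreover have "closed_segment u v \<subseteq> ?D"
    by (simp add: segment_convex_hull hull_mono)
  then have "x \<in> ?D" using xseg by blast
  moreover have "w \<in> ?D" by (simp add: hull_inc)
  ultimately have zD: "z \<in> ?D"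
    using t convexD_alt[of ?D x w t] by simp
  have "n \<bullet> z - k = t * (n \<bullet> w - k)"
    using line[OF xseg(1)] by (simp add: z_def inner_add_right inner_diff_right algebra_simps)
  then have "s * (n \<bullet> z - k) = t * (s * (n \<bullet> w - k))" by (metis mult.left_commute)
  then have "s * (n \<bullet> z - k) > 0" using s(1) t(1) by (metis mult_pos_pos)
  then have zBp: "z \<in> Bp" using t(3) by (simp add: Bp_def z_def)
  \<comment> \<open>To leave the triangle, the connected set \<open>Bp\<close> would have to cross a
    side; the ball avoids two of them, and the strict sign excludes \<open>uv\<close>.\<close>
  have BpD: "Bp \<subseteq> ?D"
  proof (rule ccontr)
    assume "\<not> Bp \<subseteq> ?D"
    then have "Bp \<inter> frontier ?D \<noteq> {}"
      using connected_Int_frontier[OF convex_connected[OF conv(1)], of ?D] zBp zD by blast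
    then obtain y where y: "y \<in> Bp" "y \<in> frontier ?D" by blast
    have "y \<in> closed_segment u w \<union> closed_segment w v \<union> closed_segment v u"
      using y(2) frontier_triangle_real2[of u w v] by blast
    moreover have "y \<in> ball x e" "y \<notin> closed_segment u v"
      using y(1) offline[of y] by (auto simp: Bp_def B_def)
    ultimately show False using e(2) closed_segment_commute[of u v] by blast
  qed
  have openI: "open (inside C)" by (rule open_inside[OF C(1)])
  have "x \<in> closure (inside C)" using C(2) G(2) xseg(1) by (auto simp: frontier_def)
  then have "inside C \<inter> B \<noteq> {}"
    using e(1) unfolding B_def by (metis Int_commute centre_in_ball open_ball open_Int_closure_eq_empty disjoint_iff)
  moreover have "open (inside C \<inter> B)" using openI by (auto simp: B_def)
  \<comment> \<open>No nonempty open set is contained in a line, so the inside has points of the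
    disc off the line \<open>uv\<close>.\<close>
  ultimately have "\<not> inside C \<inter> B \<subseteq> {y. n \<bullet> y = k}"
    using n0 interior_hyperplane[of n k] interior_maximal by blast
  then obtain y where y: "y \<in> inside C" "y \<in> B" "n \<bullet> y \<noteq> k" by blast
  have comp: "S \<subseteq> inside C" if "convex S" "S \<inter> C = {}" "p \<in> S" "p \<in> inside C" for S p
  proof -
    have "S \<inter> frontier (inside C) = {}" using that(2) C(2) by simp
    then show ?thesis
      using connected_Int_frontier[OF convex_connected[OF that(1)], of "inside C"] that by blast
  qed
  \<comment> \<open>Otherwise all of \<open>Bp\<close>, and with it the point \<open>z\<close> of
    the triangle, would be inside \<open>C\<close>; but there the triangle meets the region only in
    \<open>uv\<close>.\<close>
  have "y \<notin> Bp"
  proof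
    assume "y \<in> Bp"
    then have "Bp \<subseteq> inside C" using comp[OF conv(1)] offC y(1) by blast
    then have "z \<in> closed_segment u v" using zBp zD int by blast
    then show False using offline zBp by blast
  qed
  moreover have "s * (n \<bullet> y - k) \<noteq> 0" using y(3) s(2) by simp
  then have "s * (n \<bullet> y - k) > 0 \<or> s * (n \<bullet> y - k) < 0" by linarith
  ultimately have "y \<in> Bm" using y(2) unfolding Bp_def Bm_def by blast
  then have BmI: "Bm \<subseteq> inside C" using comp[OF conv(2)] offC y(1) by blast
  let ?K = "C \<union> inside C \<union> ?D"
  have closedK: "closed ?K"
  proof -
    have "closure (inside C) \<subseteq> C \<union> inside C"
      using C(2) openI by (auto simp: frontier_def interior_open)
    then have "C \<union> inside C = C \<union> closure (inside C)" using closure_subset[of "inside C"] by blast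
    moreover have "closed ?D" by (simp add: compact_imp_closed finite_imp_compact_convex_hull)
    ultimately show ?thesis using C(1) by (metis closed_Un closed_closure)
  qed
  \<comment> \<open>The points of the disc on the line itself are limits of points of the two half
    discs, and \<open>?K\<close> is closed.\<close>
  have "B \<subseteq> closure (B - {y. n \<bullet> y = k})"
  proof -
    have "B - interior {y. n \<bullet> y = k} \<subseteq> closure (B - {y. n \<bullet> y = k})"
      using open_Int_closure_subset[of B "- {y. n \<bullet> y = k}"]
      by (auto simp: B_def closure_complement Diff_eq)
    then show ?thesis using n0 by (simp add: interior_hyperplane)
  qed
  also have "B - {y. n \<bullet> y = k} \<subseteq> ?K"
  proof
    fix y assume "y \<in> B - {y. n \<bullet> y = k}"
    moreover from this have "s * (n \<bullet> y - k) \<noteq> 0" using s(2) by simp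
    then have "s * (n \<bullet> y - k) > 0 \<or> s * (n \<bullet> y - k) < 0" by linarith
    ultimately have "y \<in> Bp \<union> Bm" unfolding Bp_def Bm_def by blast
    then show "y \<in> ?K" using BpD BmI by blast
  qed
  then have "closure (B - {y. n \<bullet> y = k}) \<subseteq> ?K"
    using closedK by (rule closure_minimal)
  finally have "B \<subseteq> ?K" .
  then show ?thesis using e(1) by (auto simp: B_def mem_interior)
qed

section \<open>Gluing triangles to a polygon\<close>

text \<open>A polygon is given by the cyclic list of its vertices, and the triangle is attached along the
  edge from the last vertex to the first. The relation \<open>D\<close> lists the admissible diagonals. The
  degenerate polygon \<open>edge\<close> allows us to start on both sides of a diagonal.\<close>

inductive glued :: "(real^2 \<Rightarrow> real^2 \<Rightarrow> bool) \<Rightarrow> (real^2) list \<Rightarrow> (real^2) set \<Rightarrow> (real^2) set set \<Rightarrow> bool"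
  for D where
  edge: "p \<noteq> q \<Longrightarrow> glued D [p, q] (closed_segment p q) {}"
| rotate: "glued D (xs @ ys) R \<T> \<Longrightarrow> glued D (ys @ xs) R \<T>"
| glue: "\<lbrakk>glued D (v # vs @ [u]) R \<T>; \<not> collinear {u, w, v};
    R \<inter> convex hull {u, w, v} \<subseteq> closed_segment u v; D u v; D v u\<rbrakk>
    \<Longrightarrow> glued D (v # vs @ [u, w]) (R \<union> convex hull {u, w, v}) (insert (convex hull {u, w, v}) \<T>)"

text \<open>The last conjunct is an invariant for the induction: the edge to which the next triangle
  is glued is a side of a triangle already present, so the new triangle fits face to face.\<close>

definition triangulated_polygon ::
  "(real^2 \<Rightarrow> real^2 \<Rightarrow> bool) \<Rightarrow> (real^2) list \<Rightarrow> (real^2) set \<Rightarrow> (real^2) set set \<Rightarrow> bool" where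
  "triangulated_polygon D vs R \<T> \<longleftrightarrow>
     3 \<le> length vs \<and> simple_path (polyline (close vs)) \<and> R = polygon_region (close vs) \<and>
     polygon_triangulation (close vs) \<T> \<and>
     (\<forall>x y. triangulation_edge \<T> x y \<longrightarrow> closed_segment x y \<in> polyline_edges (close vs) \<or> D x y) \<and>
     (\<forall>e\<in>polyline_edges (close vs). \<exists>T\<in>\<T>. e face_of T)"

lemma triangle_faces:
  fixes u v w :: "real^2"
  assumes "\<not> collinear {u, w, v}"
  shows "2 simplex (convex hull {u, w, v})"
    and "S \<subseteq> {u, w, v} \<Longrightarrow> (convex hull S) face_of (convex hull {u, w, v})"
    and "x extreme_point_of (convex hull {u, w, v}) \<longleftrightarrow> x \<in> {u, w, v}"
    and "closed_segment x y face_of (convex hull {u, w, v}) \<Longrightarrow> {x, y} \<subseteq> {u, w, v}"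
proof -
  have d: "u \<noteq> w" "u \<noteq> v" "w \<noteq> v" and ai: "\<not> affine_dependent {u, w, v}"
    using assms by (auto simp: collinear_3_eq_affine_dependent)
  show "2 simplex (convex hull {u, w, v})"
    unfolding simplex_def using ai d by (intro exI[of _ "{u, w, v}"]) auto
  show "(convex hull S) face_of (convex hull {u, w, v})" if "S \<subseteq> {u, w, v}"
    using that by (auto simp: face_of_convex_hull_affine_independent[OF ai])
  show ex: "x extreme_point_of (convex hull {u, w, v}) \<longleftrightarrow> x \<in> {u, w, v}" for x
    by (rule extreme_point_of_convex_hull_affine_independent[OF ai])
  show "{x, y} \<subseteq> {u, w, v}" if "closed_segment x y face_of (convex hull {u, w, v})"
    using extreme_point_of_face[OF that, of x] extreme_point_of_face[OF that, of y] ex[of x] ex[of y]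
    by (auto simp: extreme_point_of_segment)
qed

lemma close_snoc:
  "close (v # vs @ [u]) = (v # vs) @ [u] @ [v]" "close (v # vs @ [u, w]) = (v # vs) @ [u] @ [w, v]"
  by (auto simp: close_def)

lemma edges_glue:
  "polyline_edges (close (v # vs @ [u])) = insert (closed_segment u v) (polyline_edges (v # vs @ [u]))"
  "polyline_edges (close (v # vs @ [u, w])) =
     {closed_segment u w, closed_segment w v} \<union> polyline_edges (v # vs @ [u])"
  unfolding close_snoc polyline_edges_append by (auto simp: polyline_edges_Cons)

lemma two_sides_arc:
  assumes "\<not> collinear {u, w, v}"
  shows "arc (polyline [u, w, v])" "path_image (polyline [u, w, v]) = closed_segment u w \<union> closed_segment w v"
proof -
  have d: "u \<noteq> w" "u \<noteq> v" "w \<noteq> v"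
    using assms by (auto simp: collinear_3_eq_affine_dependent)
  show "arc (polyline [u, w, v])"
    using d closed_segment_Int_triangle_sides(1)[OF assms] by (auto simp: arc_join_eq)
  show "path_image (polyline [u, w, v]) = closed_segment u w \<union> closed_segment w v"
    by (simp add: path_image_join)
qed

text \<open>Both loops consist of the chain from \<open>v\<close> to \<open>u\<close> and a way
  back, which is the segment \<open>uv\<close> before gluing and the two other sides of the triangle
  afterwards.\<close>

lemma polyline_glue_iff:
  assumes "vs \<noteq> []"
  shows "path_image (polyline (close (v # vs @ [u]))) = path_image (polyline (v # vs @ [u])) \<union> closed_segment u v"
    and "path_image (polyline (close (v # vs @ [u, w]))) =
      path_image (polyline (v # vs @ [u])) \<union> path_image (polyline [u, w, v])"
    and "simple_path (polyline (close (v # vs @ [u]))) \<longleftrightarrow> arc (polyline (v # vs @ [u])) \<and> u \<noteq> v \<and>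
      path_image (polyline (v # vs @ [u])) \<inter> closed_segment u v \<subseteq> {u, v}"
    and "simple_path (polyline (close (v # vs @ [u, w]))) \<longleftrightarrow> arc (polyline (v # vs @ [u])) \<and>
      arc (polyline [u, w, v]) \<and>
      path_image (polyline (v # vs @ [u])) \<inter> path_image (polyline [u, w, v]) \<subseteq> {u, v}"
proof -
  have l: "arc (linepath u v) \<longleftrightarrow> u \<noteq> v" using arc_distinct_ends[of "linepath u v"] by auto
  show "path_image (polyline (close (v # vs @ [u]))) = path_image (polyline (v # vs @ [u])) \<union> closed_segment u v"
    and "path_image (polyline (close (v # vs @ [u, w]))) =
      path_image (polyline (v # vs @ [u])) \<union> path_image (polyline [u, w, v])"
    unfolding close_snoc by (subst path_image_polyline_append; simp)+
  show "simple_path (polyline (close (v # vs @ [u]))) \<longleftrightarrow> arc (polyline (v # vs @ [u])) \<and> u \<noteq> v \<and>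
      path_image (polyline (v # vs @ [u])) \<inter> closed_segment u v \<subseteq> {u, v}"
    unfolding close_snoc
    by (subst simple_path_polyline_append) (auto simp: simple_path_join_loop_eq l)
  show "simple_path (polyline (close (v # vs @ [u, w]))) \<longleftrightarrow> arc (polyline (v # vs @ [u])) \<and>
      arc (polyline [u, w, v]) \<and>
      path_image (polyline (v # vs @ [u])) \<inter> path_image (polyline [u, w, v]) \<subseteq> {u, v}"
    unfolding close_snoc
    by (subst simple_path_polyline_append) (auto simp: simple_path_join_loop_eq simp del: polyline.simps)
qed

lemma triangulated_polygon_triangle:
  assumes ncol: "\<not> collinear {u, w, v}"
  shows "triangulated_polygon D [v, u, w] (convex hull {u, w, v}) {convex hull {u, w, v}}"
proof -
  let ?C = "path_image (polyline (close [v, u, w]))"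
  have d: "u \<noteq> v" using ncol by (auto simp: collinear_3_eq_affine_dependent)
  have cl: "close [v, u, w] = [v, u, w, v]" by (simp add: close_def)
  have im: "?C = closed_segment v u \<union> closed_segment u w \<union> closed_segment w v"
    by (auto simp: cl path_image_join)
  have sp: "simple_path (polyline (close [v, u, w]))"
  proof -
    have "simple_path (linepath v u +++ polyline [u, w, v])"
      using d two_sides_arc[OF ncol] closed_segment_Int_triangle_sides(2)[OF ncol]
      by (simp add: simple_path_join_loop_eq closed_segment_commute[of v u] Int_commute del: polyline.simps)
    then show ?thesis by (simp add: cl)
  qed
  have "frontier (convex hull {v, u, w}) = ?C"
    using frontier_of_triangle[of v u w] im by simp
  moreover have "inside ?C = interior (convex hull {v, u, w})"
    using inside_of_triangle[of v u w] im by simp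
  moreover have "closed (convex hull {v, u, w})"
    by (simp add: compact_imp_closed finite_imp_compact_convex_hull)
  ultimately have "polygon_region (close [v, u, w]) = convex hull {v, u, w}"
    using interior_subset[of "convex hull {v, u, w}"] 
    by (auto simp: polygon_region_def frontier_def)
  then have reg: "polygon_region (close [v, u, w]) = convex hull {u, w, v}"
    by (simp add: insert_commute)
  have edges: "polyline_edges (close [v, u, w]) = {closed_segment v u, closed_segment u w, closed_segment w v}"
    by (simp add: cl polyline_edges_Cons)
  have tri: "polygon_triangulation (close [v, u, w]) {convex hull {u, w, v}}"
    unfolding polygon_triangulation_def triangulation_def reg
    using triangle_faces[OF ncol] by (auto simp: cl face_of_refl)
  have "closed_segment x y \<in> polyline_edges (close [v, u, w])"
    if "triangulation_edge {convex hull {u, w, v}} x y" for x y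
    using that triangle_faces(4)[OF ncol, of x y] unfolding triangulation_edge_def edges
    by (auto simp: closed_segment_commute)
  moreover have "e face_of convex hull {u, w, v}" if "e \<in> polyline_edges (close [v, u, w])" for e
    using that triangle_faces(2)[OF ncol] by (auto simp: edges segment_convex_hull)
  ultimately show ?thesis
    unfolding triangulated_polygon_def using sp reg tri by auto
qed

text \<open>The new region is identified through its boundary: interior points of the edge
  \<open>uv\<close> become interior points of the union, so its frontier lies on the old chain and
  the two new sides.\<close>

lemma triangulated_polygon_glue:
  assumes P: "triangulated_polygon D (v # vs @ [u]) R \<T>" and ncol: "\<not> collinear {u, w, v}"
    and int: "R \<inter> convex hull {u, w, v} \<subseteq> closed_segment u v" and D: "D u v" "D v u"
  shows "triangulated_polygon D (v # vs @ [u, w]) (R \<union> convex hull {u, w, v}) (insert (convex hull {u, w, v}) \<T>)"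
proof -
  let ?C = "path_image (polyline (close (v # vs @ [u])))" and ?G = "path_image (polyline (v # vs @ [u]))"
  let ?C' = "path_image (polyline (close (v # vs @ [u, w])))" and ?E = "closed_segment u w \<union> closed_segment w v"
  let ?T = "convex hull {u, w, v}"
  have vs: "vs \<noteq> []" using P by (auto simp: triangulated_polygon_def)
  have sp: "simple_path (polyline (close (v # vs @ [u])))" and R: "R = ?C \<union> inside ?C"
    and tri: "triangulation \<T>" "\<And>T. T \<in> \<T> \<Longrightarrow> 2 simplex T \<and> {x. x extreme_point_of T} \<subseteq> set (v # vs @ [u])"
      "\<Union>\<T> = R"
    and ed: "\<And>x y. triangulation_edge \<T> x y \<Longrightarrow> closed_segment x y \<in> polyline_edges (close (v # vs @ [u])) \<or> D x y"
    and fc: "\<And>e. e\<in>polyline_edges (close (v # vs @ [u])) \<Longrightarrow> \<exists>T\<in>\<T>. e face_of T"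
    using P by (auto simp: triangulated_polygon_def polygon_region_def polygon_triangulation_def close_def)
  note g = polyline_glue_iff[OF vs]
  note sides = closed_segment_Int_triangle_sides[OF ncol]
  have arcG: "arc (polyline (v # vs @ [u]))" and GE: "?G \<inter> closed_segment u v \<subseteq> {u, v}" using sp g(3) by auto
  have C: "?C = ?G \<union> closed_segment u v" by (rule g(1))
  have C': "?C' = ?G \<union> ?E" using g(2) two_sides_arc(2)[OF ncol] by simp
  have segT: "closed_segment x y \<subseteq> ?T" if "x \<in> {u, w, v}" "y \<in> {u, w, v}" for x y
    using that by (simp add: segment_convex_hull hull_mono)
  have ET: "?E \<subseteq> ?T" using segT by auto
  have uvT: "closed_segment u v \<subseteq> ?T" using segT by auto
  have "?G \<inter> ?E \<subseteq> R \<inter> ?T \<inter> ?E \<inter> ?G" using ET R C by blast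
  also have "\<dots> \<subseteq> closed_segment u v \<inter> ?E" using int by blast
  also have "\<dots> \<subseteq> {u, v}" using sides(2) by blast
  finally have G_E: "?G \<inter> ?E \<subseteq> {u, v}" .
  have sp': "simple_path (polyline (close (v # vs @ [u, w])))"
    unfolding g(4) two_sides_arc(2)[OF ncol] using arcG G_E two_sides_arc(1)[OF ncol] by blast
  have loop: "pathfinish (polyline (close (v # vs @ [u]))) = pathstart (polyline (close (v # vs @ [u])))"
    "pathfinish (polyline (close (v # vs @ [u, w]))) = pathstart (polyline (close (v # vs @ [u, w])))"
    by (rule close_polygon_ends; simp)+
  note J = Jordan_inside_real2[OF sp loop(1)]
  have closedC: "closed ?C" using sp closed_simple_path_image by blast
  have closedG: "closed ?G" using arcG closed_arc_image by blast
  have closedR: "closed R"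
  proof -
    have "R = closure (inside ?C) \<union> ?C" using J(4) J(2) closure_subset[of "inside ?C"] interior_subset
      unfolding R frontier_def by (auto simp: interior_open)
    then show ?thesis using closedC by auto
  qed
  have compT: "compact ?T" by (simp add: finite_imp_compact_convex_hull)
  have uvG: "u \<in> ?G" "v \<in> ?G"
    using pathstart_in_path_image[of "polyline (v # vs @ [u])"] pathfinish_in_path_image[of "polyline (v # vs @ [u])"]
    by simp_all
  have inner: "x \<in> interior (R \<union> ?T)" if "x \<in> open_segment u v" for x
    using open_segment_interior_glued[OF ncol closedC J(4) closedG C GE _ that] int unfolding R by blast
  have int_inside: "interior R \<supseteq> inside ?C" using J(2) R by (simp add: interior_maximal)
  have "R \<union> ?T = ?C' \<union> inside ?C'"
  proof (rule compact_region_eq_inside[OF sp' loop(2)])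
    have "bounded ?C" using sp bounded_simple_path_image by blast
    then have "bounded R" using J(3) R by auto
    then show "compact (R \<union> ?T)" using closedR compT by (auto simp: compact_eq_bounded_closed)
    show "?C' \<subseteq> R \<union> ?T" using C' R C ET by blast
    have uv: "x \<in> {u, v} \<or> x \<in> interior (R \<union> ?T)" if "x \<in> closed_segment u v" for x
      using inner[of x] that by (auto simp: open_segment_def)
    \<comment> \<open>A frontier point lies on the chain or on a side of the triangle. On
      \<open>uv\<close> only the ends remain, and they belong to the chain.\<close>
    show "frontier (R \<union> ?T) \<subseteq> ?C'"
    proof
      fix x assume x: "x \<in> frontier (R \<union> ?T)"
      have "closed (R \<union> ?T)" using closedR compT by (auto simp: compact_imp_closed)
      then have xin: "x \<in> R \<union> ?T" "x \<notin> interior (R \<union> ?T)" using x closedR compT by (auto simp: frontier_def closure_Un compact_imp_closed)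
      have "interior R \<subseteq> interior (R \<union> ?T)" "interior ?T \<subseteq> interior (R \<union> ?T)"
        by (auto intro!: interior_mono)
      then have n: "x \<notin> inside ?C" "x \<notin> interior ?T" using xin(2) int_inside by auto
      have "x \<in> ?G \<union> ?E \<union> closed_segment u v"
      proof (cases "x \<in> R")
        case True then show ?thesis using n(1) R C by blast
      next
        case False
        then have "x \<in> frontier ?T" using n(2) xin(1) closure_subset[of ?T] by (auto simp: frontier_def)
        then show ?thesis using frontier_triangle_real2[of u w v] by (auto simp: closed_segment_commute)
      qed
      then show "x \<in> ?C'" using uv[of x] xin(2) C' uvG by blast
    qed
    have "u \<noteq> v" using ncol by (auto simp: collinear_3_eq_affine_dependent)
    \<comment> \<open>This midpoint belongs to the union but not to its new boundary curve.\<close>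
    then have m: "midpoint u v \<in> closed_segment u v" "midpoint u v \<notin> {u, v}"
      by auto
    then have "midpoint u v \<notin> ?C'" using GE sides(2) C' by blast
    moreover have "midpoint u v \<in> R \<union> ?T" using m(1) uvT by blast
    ultimately show "R \<union> ?T \<noteq> ?C'" by metis
  qed
  then have reg: "R \<union> ?T = polygon_region (close (v # vs @ [u, w]))" by (simp add: polygon_region_def)
  obtain T0 where T0: "T0 \<in> \<T>" "closed_segment u v face_of T0"
    using fc[of "closed_segment u v"] by (auto simp: edges_glue(1))
  have uvT_face: "closed_segment u v face_of ?T"
    using triangle_faces(2)[OF ncol, of "{u, v}"] by (simp add: segment_convex_hull)
  \<comment> \<open>Contact with the new triangle takes place within \<open>uv\<close>, a common
    side of it and \<open>T0\<close>. Hence the intersection is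
    \<open>(T \<inter> T0) \<inter> closed_segment u v\<close>, a face of \<open>T0\<close>, and
    being a face passes from there to \<open>T\<close>, to \<open>uv\<close> and to the new
    triangle.\<close>
  have cap: "T \<inter> ?T face_of T \<and> T \<inter> ?T face_of ?T" if T: "T \<in> \<T>" for T
  proof -
    have "T \<subseteq> R" using T tri(3) by blast
    then have e: "T \<inter> ?T = T \<inter> closed_segment u v" using int uvT by blast
    have "T0 \<inter> T face_of T0" "T \<inter> T0 face_of T"
      using tri(1) T T0(1) by (auto simp: triangulation_def)
    then have f: "(T \<inter> T0) face_of T0" "(T \<inter> T0) face_of T" by (auto simp: Int_commute)
    have "(T \<inter> T0) \<inter> closed_segment u v face_of T0" using f(1) T0(2) by (rule face_of_Int)
    moreover have uv0: "closed_segment u v \<subseteq> T0" using T0(2) by (rule face_of_imp_subset)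
    then have e2: "(T \<inter> T0) \<inter> closed_segment u v = T \<inter> closed_segment u v" by blast
    ultimately have f0: "T \<inter> closed_segment u v face_of T0" by simp
    have "T \<inter> closed_segment u v face_of (T \<inter> T0)"
      by (rule face_of_subset[OF f0]) (use uv0 in auto)
    then have 1: "T \<inter> closed_segment u v face_of T" using f(2) by (rule face_of_trans)
    have "T \<inter> closed_segment u v face_of closed_segment u v"
      by (rule face_of_subset[OF f0]) (use uv0 in auto)
    then have 2: "T \<inter> closed_segment u v face_of ?T" using uvT_face by (rule face_of_trans)
    show ?thesis using 1 2 e by simp
  qed
  have tri': "polygon_triangulation (close (v # vs @ [u, w])) (insert ?T \<T>)"
    unfolding polygon_triangulation_def
  proof (intro conjI ballI)
    have "?T face_of ?T" by (simp add: face_of_refl)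
    moreover have "\<exists>n. n simplex ?T" using triangle_faces(1)[OF ncol] by blast
    ultimately show "triangulation (insert ?T \<T>)"
      using tri(1) cap unfolding triangulation_def by (auto simp: Int_commute)
    fix T assume T: "T \<in> insert ?T \<T>"
    then show "2 simplex T" using tri(2) triangle_faces(1)[OF ncol] by blast
    show "{x. x extreme_point_of T} \<subseteq> set (close (v # vs @ [u, w]))"
      using T tri(2)[of T] triangle_faces(3)[OF ncol] by (auto simp: close_def)
  next
    show "\<Union> (insert ?T \<T>) = polygon_region (close (v # vs @ [u, w]))"
      using reg tri(3) by auto
  qed
  have eq: "closed_segment x y = closed_segment u v \<Longrightarrow> D x y" for x y
    using D by (auto simp: closed_segment_eq doubleton_eq_iff)
  have ed': "closed_segment x y \<in> polyline_edges (close (v # vs @ [u, w])) \<or> D x y"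
    if xy: "triangulation_edge (insert ?T \<T>) x y" for x y
  proof -
    obtain T where T: "x \<noteq> y" "T \<in> insert ?T \<T>" "closed_segment x y face_of T"
      using xy by (auto simp: triangulation_edge_def)
    consider "T \<in> \<T>" | "T = ?T" using T(2) by blast
    then show ?thesis
    proof cases
      case 1
      then have "triangulation_edge \<T> x y" using T by (auto simp: triangulation_edge_def)
      then show ?thesis using ed[of x y] eq[of x y] by (auto simp: edges_glue)
    next
      case 2
      then have "{x, y} \<subseteq> {u, w, v}" using T(3) triangle_faces(4)[OF ncol] by blast
      then have "closed_segment x y \<in> {closed_segment u w, closed_segment w v, closed_segment u v}"
        using T(1) by (auto simp: closed_segment_commute)
      then show ?thesis using eq[of x y] by (auto simp: edges_glue)
    qed
  qed
  have fc': "\<exists>T\<in>insert ?T \<T>. e face_of T" if "e \<in> polyline_edges (close (v # vs @ [u, w]))" for e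
  proof (cases "e \<in> polyline_edges (v # vs @ [u])")
    case True then show ?thesis using fc[of e] by (auto simp: edges_glue)
  next
    case False
    then have "e = closed_segment u w \<or> e = closed_segment w v" using that by (auto simp: edges_glue)
    then show ?thesis using triangle_faces(2)[OF ncol, of "{u, w}"] triangle_faces(2)[OF ncol, of "{w, v}"]
      by (auto simp: segment_convex_hull)
  qed
  show ?thesis unfolding triangulated_polygon_def
    using sp' reg tri' ed' fc' by simp
qed

lemma triangulated_polygon_rotate:
  assumes "triangulated_polygon D (xs @ ys) R \<T>"
  shows "triangulated_polygon D (ys @ xs) R \<T>"
proof (cases "xs = [] \<or> ys = []")
  case False
  then have "set (close (xs @ ys)) = set (close (ys @ xs))"
    by (cases xs; cases ys) (auto simp: close_def)
  then show ?thesis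
    using assms False close_rotate[of xs ys] polyline_edges_rotate[of xs ys]
    by (simp add: triangulated_polygon_def polygon_triangulation_def polygon_region_def)
qed (use assms in auto)

text \<open>A bare edge bounds no region and so remains a separate alternative until the first
  triangle, which contains it, is glued on.\<close>

lemma glued_triangulated_polygon:
  assumes "glued D vs R \<T>"
  shows "(\<exists>p q. vs = [p, q] \<and> R = closed_segment p q \<and> \<T> = {}) \<or> triangulated_polygon D vs R \<T>"
  using assms
proof induction
  case (rotate xs ys R \<T>)
  then show ?case
  proof (elim disjE exE conjE)
    fix p q assume "xs @ ys = [p, q]" "R = closed_segment p q" "\<T> = {}"
    then show ?thesis by (auto simp: append_eq_Cons_conv closed_segment_commute)
  qed (use triangulated_polygon_rotate in blast)
next
  case (glue v vs u R \<T> w)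
  show ?case
  proof (cases "vs = []")
    case True
    then have "R = closed_segment v u" "\<T> = {}" using glue.IH by (auto simp: triangulated_polygon_def)
    moreover have "closed_segment v u \<subseteq> convex hull {u, w, v}" by (simp add: segment_convex_hull hull_mono)
    ultimately show ?thesis
      using triangulated_polygon_triangle[OF glue.hyps(2), of D] True by (simp add: sup_absorb2)
  next
    case False
    then have "triangulated_polygon D (v # vs @ [u]) R \<T>" using glue.IH by auto
    then show ?thesis using triangulated_polygon_glue glue.hyps by blast
  qed
qed auto

section \<open>Strips between separated point sets\<close>

lemma ori_rot: "ori s b c a = ori s a b c" "ori s c a b = ori s a b c"
  and ori_swap: "ori s b a c = - ori s a b c" "ori s a c b = - ori s a b c" "ori s c b a = - ori s a b c"
  by (simp_all add: ori_def algebra_simps)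

lemma ori_degenerate [simp]: "ori s a a b = 0" "ori s a b a = 0" "ori s b a a = 0"
  by (simp_all add: ori_def)

lemma ori_minus: "ori (- s) a b c = ori s a c b"
  by (simp add: ori_def algebra_simps)

text \<open>The three-term Grassmann-Pluecker relation for the directions from \<open>p\<close> to
  four points; comparisons of angles around \<open>p\<close> are read off from its signs.\<close>

lemma ori_plucker:
  "ori s p a b * ori s p c d - ori s p a c * ori s p b d + ori s p a d * ori s p b c = 0"
  unfolding ori_def by algebra

lemma ori_triangle: "ori s a b c = ori s p a b + ori s p b c + ori s p c a"
  unfolding ori_def by algebra

text \<open>By the Pluecker relation the product of the two compared orientations is positive, so
  they have the same sign. For suitable arguments this is transitivity of the angular order in a
  half-plane.\<close>

lemma ori_cone:
  assumes "ori s p x y > 0" "ori s p z w \<ge> 0" "ori s p x w > 0" "ori s p y z > 0"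
  shows "ori s p x z > 0 \<longleftrightarrow> ori s p y w > 0"
proof -
  have "ori s p x z * ori s p y w = ori s p x y * ori s p z w + ori s p x w * ori s p y z"
    using ori_plucker[of s p x y z w] by simp
  also have "\<dots> > 0" using assms by (intro add_nonneg_pos mult_nonneg_nonneg mult_pos_pos) auto
  finally show ?thesis by (auto simp: zero_less_mult_iff)
qed

lemma ori_affine:
  "ori s a b ((1 - t) *\<^sub>R x + t *\<^sub>R y) = (1 - t) * ori s a b x + t * ori s a b y"
  unfolding ori_def by (simp add: algebra_simps)

lemma ori_convex:
  "u + v = 1 \<Longrightarrow> ori s a b (u *\<^sub>R x + v *\<^sub>R y) = u * ori s a b x + v * ori s a b y"
  using ori_affine[of s a b v x y] by (metis add_diff_cancel_right')

lemma hull_ori_nonneg: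
  assumes "\<And>r. r \<in> S \<Longrightarrow> ori s a b r \<ge> 0" "x \<in> convex hull S"
  shows "ori s a b x \<ge> 0"
proof -
  have "convex {r. ori s a b r \<ge> 0}" by (rule convexI) (auto simp: ori_convex)
  then have "convex hull S \<subseteq> {r. ori s a b r \<ge> 0}" using assms(1) by (intro hull_minimal) auto
  then show ?thesis using assms(2) by blast
qed

text \<open>The open half-plane together with the hull of \<open>E\<close> is convex, because a
  positive weight on a point of the open half-plane keeps a combination in it; so this set contains
  the hull of \<open>S\<close>.\<close>

lemma hull_ori_face:
  assumes S: "\<And>r. r \<in> S \<Longrightarrow> r \<in> E \<or> ori s a b r < 0" and E: "\<And>r. r \<in> E \<Longrightarrow> ori s a b r \<le> 0"
    and x: "x \<in> convex hull S" "ori s a b x \<ge> 0"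
  shows "x \<in> convex hull E"
proof -
  let ?M = "{r. ori s a b r < 0} \<union> convex hull E"
  have le: "ori s a b r \<le> 0" if "r \<in> convex hull E" for r
    using hull_ori_nonneg[of E s b a r] E that by (auto simp: ori_swap(1)[of s a b])
  have "convex ?M"
  proof (rule convexI)
    fix p q u v assume pq: "p \<in> ?M" "q \<in> ?M" and uv: "0 \<le> u" "0 \<le> v" "u + v = (1::real)"
    have neg: "ori s a b p \<le> 0" "ori s a b q \<le> 0" using pq le by force+
    have c: "ori s a b (u *\<^sub>R p + v *\<^sub>R q) = u * ori s a b p + v * ori s a b q"
      by (rule ori_convex[OF uv(3)])
    show "u *\<^sub>R p + v *\<^sub>R q \<in> ?M"
    proof (cases "u = 0 \<or> v = 0 \<or> (p \<in> convex hull E \<and> q \<in> convex hull E)")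
      case True
      then show ?thesis using pq uv by (auto intro: convexD)
    next
      case False
      then have "ori s a b p < 0 \<or> ori s a b q < 0" using pq by blast
      then have "u * ori s a b p < 0 \<or> v * ori s a b q < 0"
        using False uv by (auto simp: mult_less_0_iff)
      moreover have "u * ori s a b p \<le> 0" "v * ori s a b q \<le> 0"
        using neg uv by (auto simp: mult_le_0_iff)
      ultimately show ?thesis using c by auto
    qed
  qed
  moreover have "S \<subseteq> ?M" using S by (auto intro: hull_inc)
  ultimately have "convex hull S \<subseteq> ?M" by (rule hull_minimal[rotated])
  then show ?thesis using x by force
qed

text \<open>Since \<open>S\<close> lies on one side of the line \<open>pe\<close>, the angular order
  around \<open>p\<close> is linear on it and has a first element.\<close>

lemma ori_extreme:
  assumes "finite S" "S \<noteq> {}" "\<And>r. r \<in> S \<Longrightarrow> ori s p e r > 0"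
    and "\<And>r r'. \<lbrakk>r \<in> S; r' \<in> S; r \<noteq> r'\<rbrakk> \<Longrightarrow> ori s p r r' \<noteq> 0"
  obtains m where "m \<in> S" "\<And>r. r \<in> S - {m} \<Longrightarrow> ori s p m r > 0"
proof -
  have "\<exists>m\<in>S. \<forall>r\<in>S - {m}. ori s p m r > 0"
    using assms
  proof (induction rule: finite_ne_induct)
    case (insert x F)
    have "\<exists>m\<in>F. \<forall>r\<in>F - {m}. ori s p m r > 0"
      by (rule insert.IH) (use insert.prems in auto)
    then obtain m where m: "m \<in> F" "\<And>r. r \<in> F - {m} \<Longrightarrow> ori s p m r > 0" by blast
    have "m \<noteq> x" using m insert.hyps by auto
    then consider "ori s p m x > 0" | "ori s p x m > 0"
      using insert.prems(2)[of m x] m(1) ori_swap(2)[of s p m x] by force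
    then show ?case
    proof cases
      case 1 then show ?thesis using m by (intro bexI[of _ m]) auto
    next
      case 2
      have "ori s p x r > 0" if r: "r \<in> F - {m}" for r
      proof -
        have "ori s p e x > 0" "ori s p e m > 0" "ori s p e r > 0" "ori s p m r > 0"
          using r m insert.prems(1) by auto
        then show ?thesis using ori_cone[of s p e x m r] 2 by simp
      qed
      then show ?thesis using 2 by (intro bexI[of _ x]) auto
    qed
  qed simp
  then show ?thesis using that by blast
qed

text \<open>If \<open>p\<close>, \<open>q\<close>, \<open>t\<close>, \<open>m\<close> have the orientations occurring in \<open>corner_strip\<close>, then the segments \<open>pt\<close> and
  \<open>qm\<close> cross; this evaluates an affine function at the crossing point.\<close>

lemma ori_crossing:
  "ori s q m t * ori s V W p + ori s p m q * ori s V W t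
    = ori s p m t * ori s V W q + ori s p t q * ori s V W m"
  unfolding ori_def by algebra

lemma ori_noncollinear: "ori s a b c \<noteq> 0 \<Longrightarrow> \<not> collinear {a, b, c}"
  by (auto simp: ori_def collinear_iff_det)

text \<open>The invariant of the peeling: \<open>R\<close> meets the hull only in \<open>pq\<close>,
  a side of the new triangle, so the whole overlap lies in that triangle. The line \<open>qm\<close>
  has the remaining points on one side and \<open>p\<close> strictly on the other, which confines
  the overlap to \<open>mq\<close>.\<close>

lemma glue_hull_step:
  assumes R: "R \<inter> convex hull S \<subseteq> closed_segment p q" and "S' \<subseteq> S"
    and S': "\<And>r. r \<in> S' \<Longrightarrow> r \<in> {m, q} \<or> ori s q m r > 0" and p: "ori s q m p < 0"
  shows "(R \<union> convex hull {p, m, q}) \<inter> convex hull S' \<subseteq> convex hull {m, q}"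
proof
  fix x assume x: "x \<in> (R \<union> convex hull {p, m, q}) \<inter> convex hull S'"
  have "x \<in> closed_segment p q" if "x \<in> R"
    using that x R hull_mono[OF \<open>S' \<subseteq> S\<close>, of convex] by blast
  moreover have "closed_segment p q \<subseteq> convex hull {p, m, q}"
    by (simp add: segment_convex_hull hull_mono)
  ultimately have "x \<in> convex hull {p, m, q}" using x by blast
  moreover have "ori s q m x \<ge> 0"
    using hull_ori_nonneg[of S' s q m x] S' x by force
  ultimately show "x \<in> convex hull {m, q}"
    by (intro hull_ori_face[of "{p, m, q}" "{m, q}" s q m]) (use p in auto)
qed

text \<open>\<open>pq\<close> is the edge of the hull across the line \<open>VW\<close> that is
  farthest from \<open>V\<close>, and the closing edge of the polygon already built. Removed points
  of \<open>P\<close> are appended behind \<open>p\<close>, those of \<open>Q\<close> are put in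
  front of \<open>q\<close>; the inner part \<open>vs\<close> is never touched, and the triangle
  \<open>pVq\<close> for the last remaining \<open>p\<close> and \<open>q\<close> adds
  \<open>V\<close>.\<close>

lemma corner_strip:
  fixes P Q :: "(real^2) set"
  assumes "finite P" "finite Q" "p \<in> P" "q \<in> Q"
    and "\<And>r. r \<in> P \<union> Q - {p, q} \<Longrightarrow> ori s p r q > 0"
    and "\<And>x y. \<lbrakk>x \<in> P; y \<in> Q\<rbrakk> \<Longrightarrow> ori s x V y > 0"
    and "\<And>x. x \<in> P \<Longrightarrow> ori s V W x > 0" and "\<And>y. y \<in> Q \<Longrightarrow> ori s V W y < 0"
    and "\<And>x y z. \<lbrakk>x \<in> P \<union> Q; y \<in> P \<union> Q; z \<in> P \<union> Q; x \<noteq> y; y \<noteq> z; x \<noteq> z\<rbrakk> \<Longrightarrow> ori s x y z \<noteq> 0"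
    and "\<And>x y. \<lbrakk>x \<in> P; y \<in> Q\<rbrakk> \<Longrightarrow> D x y \<and> D y x"
    and "glued D (q # vs @ [p]) R \<T>"
    and "R \<inter> convex hull (insert V (P \<union> Q)) \<subseteq> closed_segment p q"
  shows "\<exists>ps qs R' \<T>'. set ps = P - {p} \<and> set qs = Q - {q} \<and> distinct ps \<and> distinct qs \<and>
     glued D (qs @ [q] @ vs @ [p] @ ps @ [V]) R' \<T>' \<and> R' \<subseteq> R \<union> convex hull (insert V (P \<union> Q))"
  using assms
proof (induction "card P + card Q" arbitrary: P Q p q vs R \<T> rule: less_induct)
  case less
  note fin = less.prems(1,2) and pq = less.prems(3,4) and base = less.prems(5) and corner = less.prems(6)
    and sep = less.prems(7,8) and gp = less.prems(9) and D = less.prems(10) and G = less.prems(11)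
    and R = less.prems(12)
  let ?H = "convex hull (insert V (P \<union> Q))"
  let ?N = "P \<union> Q - {p, q}"
  have "p \<noteq> q" using sep pq by force
  show ?case
  proof (cases "?N = {}")
    case True
    then have PQ: "P = {p}" "Q = {q}" using pq sep by force+
    have nc: "\<not> collinear {p, V, q}" using corner[OF pq] ori_noncollinear[of s p V q] by auto
    have "R \<inter> convex hull {p, V, q} \<subseteq> closed_segment p q"
      using R by (simp add: PQ insert_commute)
    then have "glued D (q # vs @ [p, V]) (R \<union> convex hull {p, V, q}) (insert (convex hull {p, V, q}) \<T>)"
      using glued.glue[OF G nc] D pq by blast
    then show ?thesis
      by (intro exI[of _ "[]"] exI[of _ "R \<union> convex hull {p, V, q}"] exI[of _ "insert (convex hull {p, V, q}) \<T>"])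
        (auto simp: PQ insert_commute)
  next
    case False
    have finN: "finite ?N" using fin by auto
    have neg: "ori s q r p = ori s p q r" "ori s q p r = ori s p r q" for r
      by (rule ori_rot)+
    \<comment> \<open>\<open>mq\<close> is the edge of the hull of the points that replaces
      \<open>pq\<close> when \<open>p\<close> is removed, and likewise \<open>pt\<close> when
      \<open>q\<close> is removed. The new edge has to join \<open>P\<close> to \<open>Q\<close>
      again.\<close>
    obtain m where m: "m \<in> ?N" "\<And>r. r \<in> ?N - {m} \<Longrightarrow> ori s q m r > 0"
    proof (rule ori_extreme[OF finN False, of s q p])
      show "ori s q p r > 0" if "r \<in> ?N" for r using base[OF that] by (simp add: neg)
      show "ori s q r r' \<noteq> 0" if "r \<in> ?N" "r' \<in> ?N" "r \<noteq> r'" for r r'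
        using gp[of q r r'] that pq by auto
    qed blast
    obtain t where t: "t \<in> ?N" "\<And>r. r \<in> ?N - {t} \<Longrightarrow> ori (- s) p t r > 0"
    proof (rule ori_extreme[OF finN False, of "- s" p q])
      show "ori (- s) p q r > 0" if "r \<in> ?N" for r using base[OF that] by (simp add: ori_minus)
      show "ori (- s) p r r' \<noteq> 0" if "r \<in> ?N" "r' \<in> ?N" "r \<noteq> r'" for r r'
        using gp[of p r' r] that pq by (auto simp: ori_minus)
    qed blast
    \<comment> \<open>If both replacements fail, \<open>pt\<close> stays on the side of
      \<open>P\<close> and \<open>qm\<close> on the side of \<open>Q\<close>; but they cross, and
      the value at the crossing point would be both positive and negative.\<close>
    have "m \<in> P \<or> t \<in> Q"
    proof (rule ccontr)
      assume c: "\<not> (m \<in> P \<or> t \<in> Q)"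
      then have mt: "m \<in> Q" "t \<in> P" "m \<noteq> t" using m(1) t(1) sep by force+
      have "ori s q m t > 0" "ori s p m t > 0" "ori s p m q > 0" "ori s p t q > 0"
        using m t mt(3) base by (auto simp: ori_minus)
      then have "ori s q m t * ori s V W p + ori s p m q * ori s V W t > 0"
        "ori s p m t * ori s V W q + ori s p t q * ori s V W m < 0"
        using sep pq mt by (auto intro!: add_pos_pos add_neg_neg mult_pos_neg)
      then show False using ori_crossing[of s q m t V W p] by linarith
    qed
    then show ?thesis
    proof
      assume mP: "m \<in> P"
      let ?P = "P - {p}" and ?T = "convex hull {p, m, q}"
      have mpq: "ori s p m q > 0" using base m(1) by blast
      then have nc: "\<not> collinear {p, m, q}" using ori_noncollinear[of s p m q] by auto
      have "{p, m, q} \<subseteq> P \<union> Q" using mP pq by auto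
      then have TH: "?T \<subseteq> ?H" by (intro hull_mono) auto
      have "R \<inter> ?T \<subseteq> closed_segment p q" using R TH by blast
      then have G': "glued D (q # (vs @ [p]) @ [m]) (R \<union> ?T) (insert ?T \<T>)"
        using glued.glue[OF G nc] D pq by force
      have V: "ori s q m V > 0" using corner[OF mP pq(2)] ori_rot(1)[of s m V q] by simp
      have notpm: "p \<notin> {m, q}" "m \<noteq> q" using m(1) pq sep by force+
      have mP': "m \<in> ?P" using mP notpm by auto
      have "(R \<union> ?T) \<inter> convex hull (insert V (?P \<union> Q)) \<subseteq> convex hull {m, q}"
      proof (rule glue_hull_step[OF R])
        show "insert V (?P \<union> Q) \<subseteq> insert V (P \<union> Q)" by auto
        show "r \<in> {m, q} \<or> ori s q m r > 0" if "r \<in> insert V (?P \<union> Q)" for r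
          using that V m(2)[of r] \<open>p \<noteq> q\<close> sep pq by (cases "r = p") force+
        show "ori s q m p < 0" using mpq ori_swap(3)[of s q m p] by simp
      qed
      then have R': "(R \<union> ?T) \<inter> convex hull (insert V (?P \<union> Q)) \<subseteq> closed_segment m q"
        by (simp add: segment_convex_hull)
      have "\<exists>ps qs R' \<T>'. set ps = ?P - {m} \<and> set qs = Q - {q} \<and> distinct ps \<and> distinct qs \<and>
        glued D (qs @ [q] @ (vs @ [p]) @ [m] @ ps @ [V]) R' \<T>' \<and>
        R' \<subseteq> (R \<union> ?T) \<union> convex hull (insert V (?P \<union> Q))"
      proof (rule less.hyps)
        show "card ?P + card Q < card P + card Q" using card_Diff1_less[OF fin(1) pq(1)] by linarith
        show "m \<in> ?P" by (rule mP')
        show "ori s m r q > 0" if "r \<in> ?P \<union> Q - {m, q}" for r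
        proof -
          have "r \<in> ?N - {m}" using that sep pq by force
          then show ?thesis using m(2)[of r] ori_rot(1)[of s m r q] by simp
        qed
        show "ori s x y z \<noteq> 0"
          if "x \<in> ?P \<union> Q" "y \<in> ?P \<union> Q" "z \<in> ?P \<union> Q" "x \<noteq> y" "y \<noteq> z" "x \<noteq> z" for x y z
          using gp[of x y z] that by blast
      qed (use fin pq corner sep D G' R' in auto)
      then obtain ps qs R' \<T>' where I: "set ps = ?P - {m}" "set qs = Q - {q}" "distinct ps" "distinct qs"
        "glued D (qs @ [q] @ (vs @ [p]) @ [m] @ ps @ [V]) R' \<T>'"
        "R' \<subseteq> (R \<union> ?T) \<union> convex hull (insert V (?P \<union> Q))"
        by blast
      have "R' \<subseteq> R \<union> ?H"
        using I(6) TH hull_mono[of "insert V (?P \<union> Q)" "insert V (P \<union> Q)" convex] by blast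
      moreover have "set (m # ps) = P - {p}" "distinct (m # ps)" using I(1,3) mP' by auto
      moreover have "glued D (qs @ [q] @ vs @ [p] @ (m # ps) @ [V]) R' \<T>'" using I(5) by simp
      ultimately show ?thesis using I(2,4) by blast
    next
      assume tQ: "t \<in> Q"
      let ?Q = "Q - {q}" and ?T = "convex hull {p, t, q}"
      have tpq: "ori s p t q > 0" using base t(1) by blast
      then have nc: "\<not> collinear {p, t, q}" using ori_noncollinear[of s p t q] by auto
      have "{p, t, q} \<subseteq> P \<union> Q" using tQ pq by auto
      then have TH: "?T \<subseteq> ?H" by (intro hull_mono) auto
      have "R \<inter> ?T \<subseteq> closed_segment p q" using R TH by blast
      then have "glued D ((q # vs @ [p]) @ [t]) (R \<union> ?T) (insert ?T \<T>)"
        using glued.glue[OF G nc] D pq by force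
      \<comment> \<open>Gluing puts the new vertex at the end of the list; rotating it to the front
        makes \<open>pt\<close> the closing edge.\<close>
      then have "glued D ([t] @ (q # vs @ [p])) (R \<union> ?T) (insert ?T \<T>)" by (rule glued.rotate)
      then have G': "glued D (t # (q # vs) @ [p]) (R \<union> ?T) (insert ?T \<T>)" by simp
      have V: "ori (- s) p t V > 0" using corner[OF pq(1) tQ] by (simp add: ori_minus)
      have notpt: "q \<notin> {p, t}" "p \<noteq> t" using t(1) pq sep by force+
      have tQ': "t \<in> ?Q" using tQ notpt by auto
      have "(R \<union> convex hull {q, t, p}) \<inter> convex hull (insert V (P \<union> ?Q)) \<subseteq> convex hull {t, p}"
      proof (rule glue_hull_step)
        show "R \<inter> ?H \<subseteq> closed_segment q p" using R by (simp add: closed_segment_commute)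
        show "insert V (P \<union> ?Q) \<subseteq> insert V (P \<union> Q)" by auto
        show "r \<in> {t, p} \<or> ori (- s) p t r > 0" if "r \<in> insert V (P \<union> ?Q)" for r
          using that V t(2)[of r] \<open>p \<noteq> q\<close> sep pq by (cases "r = q") force+
        show "ori (- s) p t q < 0" using tpq ori_swap(2)[of s p q t] by (simp add: ori_minus)
      qed
      then have R': "(R \<union> ?T) \<inter> convex hull (insert V (P \<union> ?Q)) \<subseteq> closed_segment p t"
        by (simp add: segment_convex_hull insert_commute)
      have "\<exists>ps qs R' \<T>'. set ps = P - {p} \<and> set qs = ?Q - {t} \<and> distinct ps \<and> distinct qs \<and>
        glued D (qs @ [t] @ (q # vs) @ [p] @ ps @ [V]) R' \<T>' \<and>
        R' \<subseteq> (R \<union> ?T) \<union> convex hull (insert V (P \<union> ?Q))"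
      proof (rule less.hyps)
        show "card P + card ?Q < card P + card Q" using card_Diff1_less[OF fin(2) pq(2)] by linarith
        show "t \<in> ?Q" by (rule tQ')
        show "ori s p r t > 0" if "r \<in> P \<union> ?Q - {p, t}" for r
        proof -
          have "r \<in> ?N - {t}" using that sep pq by force
          then show ?thesis using t(2)[of r] by (simp add: ori_minus)
        qed
        show "ori s x y z \<noteq> 0"
          if "x \<in> P \<union> ?Q" "y \<in> P \<union> ?Q" "z \<in> P \<union> ?Q" "x \<noteq> y" "y \<noteq> z" "x \<noteq> z" for x y z
          using gp[of x y z] that by blast
      qed (use fin pq corner sep D G' R' in auto)
      then obtain ps qs R' \<T>' where I: "set ps = P - {p}" "set qs = ?Q - {t}" "distinct ps" "distinct qs"
        "glued D (qs @ [t] @ (q # vs) @ [p] @ ps @ [V]) R' \<T>'"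
        "R' \<subseteq> (R \<union> ?T) \<union> convex hull (insert V (P \<union> ?Q))"
        by blast
      have "R' \<subseteq> R \<union> ?H"
        using I(6) TH hull_mono[of "insert V (P \<union> ?Q)" "insert V (P \<union> Q)" convex] by blast
      moreover have "set (qs @ [t]) = Q - {q}" "distinct (qs @ [t])" using I(2,4) tQ' by auto
      moreover have "glued D ((qs @ [t]) @ [q] @ vs @ [p] @ ps @ [V]) R' \<T>'" using I(5) by simp
      ultimately show ?thesis using I(1,3) by blast
    qed
  qed
qed

section \<open>Good triples\<close>

lemma ori_cone':
  assumes "ori s p x y > 0" "ori s p z w > 0" "ori s p x w \<ge> 0" "ori s p y z > 0"
  shows "ori s p x z > 0 \<longleftrightarrow> ori s p y w > 0"
proof -
  have "ori s p x z * ori s p y w = ori s p x w * ori s p y z + ori s p x y * ori s p z w"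
    using ori_plucker[of s p x y z w] by simp
  also have "\<dots> > 0" using assms by (intro add_nonneg_pos mult_nonneg_nonneg mult_pos_pos) auto
  finally show ?thesis by (auto simp: zero_less_mult_iff)
qed

lemma ori_trans:
  assumes "ori s p e x > 0" "ori s p e y > 0" "ori s p e z > 0" "ori s p x y > 0" "ori s p y z > 0"
  shows "ori s p x z > 0"
  using ori_cone[of s p e x y z] assms by simp

text \<open>The factors are the barycentric coordinates of \<open>q\<close> in \<open>abc\<close>,
  scaled by \<open>ori s a b c\<close>; the affine function \<open>ori s f u\<close> is applied to
  this combination.\<close>

lemma ori_bary:
  "ori s a b c * ori s f u q = ori s b c q * ori s f u a + ori s c a q * ori s f u b + ori s a b q * ori s f u c"
  unfolding ori_def by algebra

lemma in_hull3:
  assumes "ori s a b c > 0" "ori s a b q \<ge> 0" "ori s b c q \<ge> 0" "ori s c a q \<ge> 0"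
  shows "q \<in> convex hull {a, b, c}"
proof -
  let ?d = "ori s a b c"
  have s: "?d = ori s b c q + ori s c a q + ori s a b q" unfolding ori_def by algebra
  have "?d * q$i = ori s b c q * a$i + ori s c a q * b$i + ori s a b q * c$i" for i :: 2
  proof -
    have "?d * q$1 = ori s b c q * a$1 + ori s c a q * b$1 + ori s a b q * c$1"
      unfolding ori_def by algebra
    moreover have "?d * q$2 = ori s b c q * a$2 + ori s c a q * b$2 + ori s a b q * c$2"
      unfolding ori_def by algebra
    ultimately show ?thesis using exhaust_2[of i] by blast
  qed
  then have q: "?d *\<^sub>R q = ori s b c q *\<^sub>R a + ori s c a q *\<^sub>R b + ori s a b q *\<^sub>R c"
    by (simp add: vec_eq_iff)
  have "q = (1 / ?d) *\<^sub>R (?d *\<^sub>R q)" using assms(1) by simp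
  also have "\<dots> = (ori s b c q / ?d) *\<^sub>R a + (ori s c a q / ?d) *\<^sub>R b + (ori s a b q / ?d) *\<^sub>R c"
    unfolding q by (simp add: scaleR_add_right)
  finally have "q = (ori s b c q / ?d) *\<^sub>R a + (ori s c a q / ?d) *\<^sub>R b + (ori s a b q / ?d) *\<^sub>R c" .
  moreover have "ori s b c q / ?d + ori s c a q / ?d + ori s a b q / ?d = 1"
    using s assms(1) by (metis add_divide_distrib divide_self less_irrefl)
  ultimately show ?thesis
    unfolding convex_hull_3 using assms
    by (metis (mono_tags, lifting) mem_Collect_eq divide_nonneg_pos)
qed

lemma hull3_ori:
  assumes "ori s a b c > 0" "q \<in> convex hull {a, b, c}"
  shows "ori s a b q \<ge> 0" "ori s b c q \<ge> 0" "ori s c a q \<ge> 0"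
proof -
  have c: "ori s b c a > 0" "ori s c a b > 0"
    using assms(1) ori_rot(1)[of s b c a] ori_rot(2)[of s c a b] by simp_all
  show "ori s a b q \<ge> 0" by (rule hull_ori_nonneg[OF _ assms(2)]) (use assms(1) in auto)
  show "ori s b c q \<ge> 0" by (rule hull_ori_nonneg[OF _ assms(2)]) (use c in auto)
  show "ori s c a q \<ge> 0" by (rule hull_ori_nonneg[OF _ assms(2)]) (use c in auto)
qed

text \<open>The hypothesis \<open>gap\<close> says that the counterclockwise angle from
  \<open>b\<close> through \<open>Z\<close> to \<open>c\<close> exceeds a half turn. So the
  remaining angle, from \<open>c\<close> through \<open>X\<close>, \<open>a\<close>,
  \<open>Y\<close> to \<open>b\<close>, is less than a half turn, and so are its parts.\<close>

lemma sector_gap: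
  assumes tri: "ori s F X Y > 0" "ori s F Y Z > 0" "ori s F Z X > 0"
    and a: "ori s F X a > 0" "ori s F a Y > 0" and b: "ori s F Y b > 0" "ori s F b Z > 0"
    and c: "ori s F Z c > 0" "ori s F c X > 0" and gap: "ori s F b c < 0"
  shows "ori s F X b > 0" "ori s F c Y > 0" "ori s F a b > 0" "ori s F c a > 0"
proof -
  show Xb: "ori s F X b > 0"
    using ori_cone'[of s F b Z c X] b c tri gap ori_swap(2)[of s F b X] by force
  show cY: "ori s F c Y > 0"
    using ori_cone'[of s F Y b Z c] b c tri gap ori_swap(2)[of s F c Y] by force
  show "ori s F a b > 0" using ori_cone[of s F X a Y b] a b tri Xb by simp
  show "ori s F c a > 0" using ori_cone[of s F c X a Y] a c tri cY by simp
qed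

text \<open>The angle from \<open>a\<close> to \<open>b\<close> is part of the one from
  \<open>X\<close> to \<open>b\<close> and of the one from \<open>a\<close> to \<open>Z\<close>; it
  suffices that one of these is less than a half turn.\<close>

lemma sector_ccw:
  assumes tri: "ori s F X Y > 0" "ori s F Y Z > 0" "ori s F Z X > 0"
    and a: "ori s F X a > 0" "ori s F a Y > 0" and b: "ori s F Y b > 0" "ori s F b Z > 0"
    and "ori s F X b > 0 \<or> ori s F a Z > 0"
  shows "ori s F a b > 0"
  using assms(8)
proof
  assume "ori s F X b > 0"
  then show ?thesis using ori_cone[of s F X a Y b] a b tri by simp
next
  assume "ori s F a Z > 0"
  then show ?thesis using ori_cone[of s F a Y b Z] a b tri by simp
qed

text \<open>Seen from \<open>V\<close>, the point \<open>p\<close> lies between the points of \<open>M\<close> and those of \<open>N\<close>.\<close>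

definition spoke :: "real \<Rightarrow> real^2 \<Rightarrow> (real^2) set \<Rightarrow> (real^2) set \<Rightarrow> (real^2) set \<Rightarrow> bool" where
  "spoke s V S N M \<longleftrightarrow> (\<exists>p\<in>S. (\<forall>b\<in>N. ori s V p b > 0) \<and> (\<forall>c\<in>M. ori s V c p > 0))"

text \<open>If the pair is not good, then the triangle formed by \<open>b\<close>, \<open>c\<close> and the corner between their sectors
  contains \<open>F\<close> and a point of \<open>S\<close>, so that \<open>bc\<close> cannot cut off this corner.\<close>

definition good_pair :: "real \<Rightarrow> real^2 \<Rightarrow> (real^2) set \<Rightarrow> real^2 \<Rightarrow> real^2 \<Rightarrow> bool" where
  "good_pair s F S b c \<longleftrightarrow> ori s F b c > 0 \<or> (\<forall>p\<in>S. ori s p b c > 0)"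

definition good_triple where
  "good_triple s F A B C a b c \<longleftrightarrow> a \<in> A \<and> b \<in> B \<and> c \<in> C \<and>
     good_pair s F A b c \<and> good_pair s F B c a \<and> good_pair s F C a b"

definition minimal_triple where
  "minimal_triple s F A B C a b c \<longleftrightarrow> good_triple s F A B C a b c \<and>
    (\<forall>a' b' c'. good_triple s F A B C a' b' c' \<and> {a', b', c'} \<subseteq> convex hull {a, b, c} \<longrightarrow>
      a' = a \<and> b' = b \<and> c' = c)"

lemma minimal_triple_rotate:
  assumes "minimal_triple s F A B C a b c" shows "minimal_triple s F B C A b c a"
proof -
  have "convex hull {b, c, a} = convex hull {a, b, c}" by (simp add: insert_commute)
  then show ?thesis using assms unfolding minimal_triple_def good_triple_def by auto
qed

lemma minimal_triple_mirror:
  assumes "minimal_triple s F A B C a b c" shows "minimal_triple (- s) F A C B a c b"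
proof -
  have "convex hull {a, c, b} = convex hull {a, b, c}" by (simp add: insert_commute)
  then show ?thesis using assms
    unfolding minimal_triple_def good_triple_def good_pair_def ori_minus by auto
qed

text \<open>The sets belong to the sectors \<open>XY\<close>, \<open>YZ\<close>, \<open>ZX\<close>
  around \<open>F\<close>. Membership is expressed by orientation signs, a form that survives cyclic
  renaming and, with \<open>- s\<close>, reflection.\<close>

locale sectors =
  fixes s :: real and X Y Z F :: "real^2" and A B C :: "(real^2) set"
  assumes finA: "finite A" and finB: "finite B" and finC: "finite C"
    and nonempty: "A \<noteq> {}" "B \<noteq> {}" "C \<noteq> {}"
    and tri: "ori s F X Y > 0" "ori s F Y Z > 0" "ori s F Z X > 0"
    and A: "\<And>a. a \<in> A \<Longrightarrow> ori s F X a > 0" "\<And>a. a \<in> A \<Longrightarrow> ori s F a Y > 0"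
    and B: "\<And>b. b \<in> B \<Longrightarrow> ori s F Y b > 0" "\<And>b. b \<in> B \<Longrightarrow> ori s F b Z > 0"
    and C: "\<And>c. c \<in> C \<Longrightarrow> ori s F Z c > 0" "\<And>c. c \<in> C \<Longrightarrow> ori s F c X > 0"
    and inner: "\<And>p. p \<in> A \<union> B \<union> C \<Longrightarrow> ori s X Y p > 0"
      "\<And>p. p \<in> A \<union> B \<union> C \<Longrightarrow> ori s Y Z p > 0"
      "\<And>p. p \<in> A \<union> B \<union> C \<Longrightarrow> ori s Z X p > 0"
    and gp: "\<And>x y z. \<lbrakk>{x, y, z} \<subseteq> {X, Y, Z, F} \<union> A \<union> B \<union> C; x \<noteq> y; y \<noteq> z; x \<noteq> z\<rbrakk> \<Longrightarrow> ori s x y z \<noteq> 0"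
begin

lemma rotate: "sectors s Y Z X F B C A"
proof
  show "ori s x y z \<noteq> 0" if "{x, y, z} \<subseteq> {Y, Z, X, F} \<union> B \<union> C \<union> A" "x \<noteq> y" "y \<noteq> z" "x \<noteq> z" for x y z
    by (rule gp) (use that in auto)
qed (use finA finB finC nonempty tri A B C inner in auto)

lemma mirror: "sectors (- s) Y X Z F A C B"
proof
  show "ori (- s) x y z \<noteq> 0" if "{x, y, z} \<subseteq> {Y, X, Z, F} \<union> A \<union> C \<union> B" "x \<noteq> y" "y \<noteq> z" "x \<noteq> z" for x y z
    unfolding ori_minus by (rule gp) (use that in auto)
  fix p assume p: "p \<in> A \<union> C \<union> B"
  then show "0 < ori (- s) Y X p" "0 < ori (- s) X Z p" "0 < ori (- s) Z Y p"
    unfolding ori_minus using inner[of p] ori_rot[of s X Y p] ori_rot[of s Y Z p] ori_rot[of s Z X p]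
      ori_rot[of s p X Y] ori_rot[of s p Y Z] ori_rot[of s p Z X]  by auto
qed (use finA finB finC nonempty tri A B C in \<open>auto simp: ori_minus\<close>)

lemma gap:
  assumes "b \<in> B" "c \<in> C" "ori s F b c < 0"
  shows "ori s F X b > 0" "ori s F c Y > 0"
    "\<And>a. a \<in> A \<Longrightarrow> ori s F a b > 0" "\<And>a. a \<in> A \<Longrightarrow> ori s F c a > 0"
proof -
  obtain a0 where "a0 \<in> A" using nonempty by blast
  note g = sector_gap[OF tri A(1) A(2) B(1)[OF assms(1)] B(2)[OF assms(1)] C(1)[OF assms(2)] C(2)[OF assms(2)] assms(3)]
  show "ori s F X b > 0" "ori s F c Y > 0" using g(1,2) \<open>a0 \<in> A\<close> by blast+
  show "\<And>a. a \<in> A \<Longrightarrow> ori s F a b > 0" "\<And>a. a \<in> A \<Longrightarrow> ori s F c a > 0" using g(3,4) by blast+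
qed

lemma gap_ab:
  assumes "a \<in> A" "b \<in> B" "ori s F a b < 0" "c \<in> C"
  shows "ori s F b c > 0" "ori s F c a > 0"
  using sector_gap(3,4)[OF tri(3,1,2) C(1)[OF assms(4)] C(2)[OF assms(4)] A(1)[OF assms(1)] A(2)[OF assms(1)]
     B(1)[OF assms(2)] B(2)[OF assms(2)] assms(3)] by simp_all

lemma gap_ca:
  assumes "c \<in> C" "a \<in> A" "ori s F c a < 0" "b \<in> B"
  shows "ori s F a b > 0" "ori s F b c > 0"
  using sector_gap(3,4)[OF tri(2,3,1) B(1)[OF assms(4)] B(2)[OF assms(4)] C(1)[OF assms(1)] C(2)[OF assms(1)]
     A(1)[OF assms(2)] A(2)[OF assms(2)] assms(3)] by simp_all

lemma ccw_ab:
  "\<lbrakk>a \<in> A; b \<in> B; ori s F X b > 0 \<or> ori s F a Z > 0\<rbrakk> \<Longrightarrow> ori s F a b > 0"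
  by (rule sector_ccw[OF tri A(1) A(2) B(1) B(2)])

lemma not_corner: "F \<notin> A \<union> B \<union> C" "X \<notin> A \<union> B \<union> C" "Y \<notin> A \<union> B \<union> C" "Z \<notin> A \<union> B \<union> C"
  using A(1)[of F] B(1)[of F] C(1)[of F] inner(1)[of X] inner(1)[of Y] inner(2)[of Z] by auto

lemma disjoint: "A \<inter> B = {}" "B \<inter> C = {}" "C \<inter> A = {}"
proof -
  have "False" if "x \<in> A" "x \<in> B" for x
    using A(2)[OF that(1)] B(1)[OF that(2)] ori_swap(2)[of s F x Y] by simp
  moreover have "False" if "x \<in> B" "x \<in> C" for x
    using B(2)[OF that(1)] C(1)[OF that(2)] ori_swap(2)[of s F x Z] by simp
  moreover have "False" if "x \<in> C" "x \<in> A" for x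
    using C(2)[OF that(1)] A(1)[OF that(2)] ori_swap(2)[of s F x X] by simp
  ultimately show "A \<inter> B = {}" "B \<inter> C = {}" "C \<inter> A = {}" by blast+
qed

lemma corners_distinct: "F \<noteq> X" "F \<noteq> Y" "F \<noteq> Z" "X \<noteq> Y" "Y \<noteq> Z" "Z \<noteq> X"
  using tri by auto

lemma gpF: "\<lbrakk>x \<in> {X, Y, Z} \<union> A \<union> B \<union> C; y \<in> {X, Y, Z} \<union> A \<union> B \<union> C; x \<noteq> y\<rbrakk> \<Longrightarrow> ori s F x y \<noteq> 0"
  using gp[of F x y] not_corner corners_distinct by auto

text \<open>If some pair turns clockwise around \<open>F\<close>, its second clause of goodness,
  applied to the third vertex, is the claim. Otherwise the area of \<open>abc\<close> is a sum of
  three positive areas at \<open>F\<close>.\<close>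

lemma good_triple_ccw:
  assumes "good_triple s F A B C a b c"
  shows "ori s a b c > 0"
proof -
  have m: "a \<in> A" "b \<in> B" "c \<in> C" using assms by (auto simp: good_triple_def)
  have n: "a \<noteq> b" "b \<noteq> c" "c \<noteq> a" using m disjoint by auto
  have nz: "ori s F a b \<noteq> 0" "ori s F b c \<noteq> 0" "ori s F c a \<noteq> 0"
    using gpF m n by auto
  consider "ori s F a b < 0" | "ori s F b c < 0" | "ori s F c a < 0" | "ori s F a b > 0" "ori s F b c > 0" "ori s F c a > 0"
    using nz by linarith
  then show ?thesis
  proof cases
    case 1
    then have "ori s c a b > 0" using assms by (auto simp: good_triple_def good_pair_def)
    then show ?thesis using ori_rot(2)[of s c a b] by simp
  next
    case 2
    then show ?thesis using assms by (auto simp: good_triple_def good_pair_def)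
  next
    case 3
    then have "ori s b c a > 0" using assms by (auto simp: good_triple_def good_pair_def)
    then show ?thesis using ori_rot(1)[of s b c a] by simp
  next
    case 4
    then show ?thesis using ori_triangle[of s a b c F] by linarith
  qed
qed

text \<open>By \<open>minus\<close>, seen from \<open>Z\<close> every point of \<open>A\<close>
  comes after every point of \<open>C\<close>, so without a spoke each fails against a point of
  \<open>B\<close>. By \<open>plus\<close>, at \<open>X\<close> every point of \<open>B\<close>
  likewise fails against a point of \<open>A\<close>. For extreme \<open>p\<close> and
  \<open>q\<close> both failures concern this same pair, which the Pluecker relation at
  \<open>F\<close> rules out.\<close>

lemma no_spoke_minus_plus:
  assumes no: "\<not> spoke s Z A B C" "\<not> spoke s X B C A"
    and minus: "\<And>a. a \<in> A \<Longrightarrow> ori s F a Z > 0" and plus: "\<And>b. b \<in> B \<Longrightarrow> ori s F X b > 0"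
  shows False
proof -
  \<comment> \<open>\<open>p\<close> is the last point of \<open>A\<close> as seen from
    \<open>X\<close>, and \<open>q\<close> below the first point of \<open>B\<close> as seen from
    \<open>Z\<close>: the strongest obstructions to spokes.\<close>
  obtain p where p: "p \<in> A" "\<And>r. r \<in> A - {p} \<Longrightarrow> ori (- s) X p r > 0"
  proof (rule ori_extreme[OF finA nonempty(1), of "- s" X F])
    show "ori (- s) X F r > 0" if "r \<in> A" for r
      using A(1)[OF that] ori_rot(1)[of s X r F] by (simp add: ori_minus)
    show "ori (- s) X r r' \<noteq> 0" if "r \<in> A" "r' \<in> A" "r \<noteq> r'" for r r'
      using gp[of X r' r] that not_corner by (auto simp: ori_minus)
  qed blast
  obtain q where q: "q \<in> B" "\<And>r. r \<in> B - {q} \<Longrightarrow> ori s Z q r > 0"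
  proof (rule ori_extreme[OF finB nonempty(2), of s Z F])
    show "ori s Z F r > 0" if "r \<in> B" for r
      using B(2)[OF that] ori_rot(2)[of s Z F r] by simp
    show "ori s Z r r' \<noteq> 0" if "r \<in> B" "r' \<in> B" "r \<noteq> r'" for r r'
      using gp[of Z r r'] that not_corner by auto
  qed blast
  have ZF: "ori s Z F r > 0" if "r \<in> A \<union> B" for r
    using that minus[of r] B(2)[of r] ori_rot(2)[of s Z F r] by auto
  have XY: "ori s X Y r > 0" if "r \<in> A \<union> B \<union> C" for r using that inner by blast
  have XYF: "ori s X Y F > 0" using tri(1) ori_rot(1)[of s X Y F] by simp
  have ZX: "ori s Z X r > 0" if "r \<in> A \<union> B \<union> C" for r using that inner by blast
  have ZXF: "ori s Z X F > 0" using tri(3) ori_rot(1)[of s Z X F] by simp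
  have Zc: "ori s Z c p > 0" if "c \<in> C" for c
  proof (rule ori_trans[of s Z X c F p])
    show "ori s Z X c > 0" "ori s Z X p > 0" using that p(1) ZX by auto
    show "ori s Z c F > 0" using C(1)[OF that] ori_rot(1)[of s Z c F] by simp
    show "ori s Z F p > 0" using ZF p(1) by blast
  qed (rule ZXF)
  then obtain b where b: "b \<in> B" "\<not> ori s Z p b > 0" using no(1) p(1) unfolding spoke_def by blast
  have "ori s Z p b \<noteq> 0" using gp[of Z p b] p(1) b(1) not_corner disjoint by auto
  then have bp: "ori s Z b p > 0" using b(2) ori_swap(2)[of s Z b p] by linarith
  have Zqp: "ori s Z q p > 0"
  proof (cases "b = q")
    case False
    then have "ori s Z q b > 0" using q(2) b(1) by blast
    then show ?thesis using ori_trans[of s Z F q b p] ZF q(1) b(1) p(1) bp by blast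
  qed (use bp in auto)
  have Xc: "ori s X q c > 0" if "c \<in> C" for c
  proof (rule ori_trans[of s X Y q F c])
    show "ori s X Y q > 0" "ori s X Y c > 0" using that q(1) XY by auto
    show "ori s X q F > 0" using plus[OF q(1)] ori_rot(1)[of s X q F] by simp
    show "ori s X F c > 0" using C(2)[OF that] ori_rot(2)[of s X F c] by simp
  qed (rule XYF)
  then obtain a where a: "a \<in> A" "\<not> ori s X a q > 0" using no(2) q(1) unfolding spoke_def by blast
  have "ori s X a q \<noteq> 0" using gp[of X a q] q(1) a(1) not_corner disjoint by auto
  then have qa: "ori s X q a > 0" using a(2) ori_swap(2)[of s X q a] by linarith
  have Xqp: "ori s X q p > 0"
  proof (cases "a = p")
    case False
    then have "ori s X a p > 0" using p(2)[of a] a(1) by (simp add: ori_minus)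
    then show ?thesis using ori_trans[of s X Y q a p] XY q(1) a(1) p(1) qa by blast
  qed (use qa in auto)
  \<comment> \<open>Signed areas at \<open>F\<close> up to a common factor. The failures at
    \<open>Z\<close> and \<open>X\<close> bound \<open>de\<close> and \<open>ep\<close> from below,
    so that \<open>ep * de\<close> exceeds \<open>al * be\<close>; but the Pluecker relation with
    \<open>ze < 0 < ga\<close> makes it smaller.\<close>
  define al be ga de ep ze where "al = ori s F X p" "be = ori s F q Z" "ga = ori s F p q"
    "de = ori s F p Z" "ep = ori s F X q" "ze = ori s F X Z"
  note defs = this
  have pos: "al > 0" "be > 0" "ga > 0" "ze < 0"
    using A(1)[OF p(1)] B(2)[OF q(1)] ccw_ab[OF p(1) q(1)] plus[OF q(1)] tri(3) ori_swap(2)[of s F X Z]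
    by (auto simp: defs)
  have pl: "al * be - ep * de + ze * ga = 0" using ori_plucker[of s F X p q Z] by (simp add: defs)
  have "de > ga + be" using Zqp ori_triangle[of s Z q p F] ori_swap(2)[of s F Z q] ori_swap(2)[of s F q p]
    by (simp add: defs)
  moreover have "ep > ga + al" using Xqp ori_triangle[of s X q p F] ori_swap(2)[of s F p X] ori_swap(2)[of s F q p]
    by (simp add: defs)
  ultimately have "(ga + al) * (ga + be) < ep * de"
    using pos by (intro mult_strict_mono) auto
  moreover have "al * be < (ga + al) * (ga + be)" using pos by (intro mult_strict_mono) auto
  moreover have "ze * ga < 0" using pos by (simp add: mult_neg_pos)
  ultimately show False using pl by linarith
qed

text \<open>Take \<open>a\<close> first in \<open>A\<close> and \<open>b\<close> last in
  \<open>B\<close> as seen from \<open>Y\<close>, and any \<open>c\<close>; the sign hypotheses make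
  \<open>bc\<close> and \<open>ca\<close> counterclockwise. A point of \<open>C\<close> showing that
  \<open>(a, b)\<close> is not good would lie between \<open>b\<close> and \<open>a\<close> as seen
  from \<open>Y\<close>, hence be a spoke.\<close>

lemma no_spoke_plus_minus:
  assumes no: "\<not> spoke s Y C A B"
    and plus: "\<And>a. a \<in> A \<Longrightarrow> ori s F Z a > 0" and minus: "\<And>b. b \<in> B \<Longrightarrow> ori s F b X > 0"
  shows "\<exists>a b c. good_triple s F A B C a b c"
proof -
  obtain a where a: "a \<in> A" "\<And>r. r \<in> A - {a} \<Longrightarrow> ori s Y a r > 0"
  proof (rule ori_extreme[OF finA nonempty(1), of s Y F])
    show "ori s Y F r > 0" if "r \<in> A" for r
      using A(2)[OF that] ori_rot(2)[of s Y F r] by simp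
    show "ori s Y r r' \<noteq> 0" if "r \<in> A" "r' \<in> A" "r \<noteq> r'" for r r'
      using gp[of Y r r'] that not_corner by auto
  qed blast
  obtain b where b: "b \<in> B" "\<And>r. r \<in> B - {b} \<Longrightarrow> ori (- s) Y b r > 0"
  proof (rule ori_extreme[OF finB nonempty(2), of "- s" Y F])
    show "ori (- s) Y F r > 0" if "r \<in> B" for r
      using B(1)[OF that] ori_rot(1)[of s Y r F] by (simp add: ori_minus)
    show "ori (- s) Y r r' \<noteq> 0" if "r \<in> B" "r' \<in> B" "r \<noteq> r'" for r r'
      using gp[of Y r' r] that not_corner by (auto simp: ori_minus)
  qed blast
  obtain c where c: "c \<in> C" using nonempty(3) by blast
  have bc: "ori s F b c > 0"
    using sector_ccw[OF tri(2,3,1) B(1)[OF b(1)] B(2)[OF b(1)] C(1)[OF c] C(2)[OF c]] minus[OF b(1)] by blast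
  have ca: "ori s F c a > 0"
    using sector_ccw[OF tri(3,1,2) C(1)[OF c] C(2)[OF c] A(1)[OF a(1)] A(2)[OF a(1)]] plus[OF a(1)] by blast
  have YZ: "ori s Y Z r > 0" if "r \<in> A \<union> B \<union> C" for r using that inner by blast
  have "good_pair s F C a b"
  proof (rule ccontr)
    assume ng: "\<not> good_pair s F C a b"
    then obtain p where p: "p \<in> C" "\<not> ori s p a b > 0" "\<not> ori s F a b > 0" by (auto simp: good_pair_def)
    have n: "p \<noteq> a" "p \<noteq> b" "a \<noteq> b" using p(1) a(1) b(1) disjoint by auto
    have "ori s F a b < 0" using p(3) gpF[of a b] a(1) b(1) n by auto
    note g = gap_ab[OF a(1) b(1) this p(1)]
    have pab: "ori s p a b < 0" using p(1,2) gp[of p a b] a(1) b(1) n by auto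
    define u v w aY Yb pY where "u = ori s F b a" "v = ori s F b p" "w = ori s F p a"
      "aY = ori s F a Y" "Yb = ori s F Y b" "pY = ori s F p Y"
    note defs = this
    have pos: "u > 0" "v > 0" "w > 0" "aY > 0" "Yb > 0"
      using \<open>ori s F a b < 0\<close> g A(2)[OF a(1)] B(1)[OF b(1)] ori_swap(2)[of s F b a] by (auto simp: defs)
    have uvw: "u > v + w"
      using pab ori_triangle[of s p a b F] ori_swap(2)[of s F b a] ori_swap(2)[of s F b p] ori_swap(2)[of s F p a]
      by (simp add: defs)
    have pl: "u * pY = v * aY - w * Yb"
      using ori_plucker[of s F b p a Y] ori_swap(2)[of s F b Y] by (simp add: defs algebra_simps)
    \<comment> \<open>After multiplication by \<open>u\<close>, the relation \<open>pl\<close>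
      eliminates \<open>pY\<close>; as \<open>u\<close> exceeds both \<open>v\<close> and
      \<open>w\<close>, a sum of positive products is left.\<close>
    have "u * (w + aY - pY) = u * w + (u - v) * aY + w * Yb" using pl by (simp add: algebra_simps)
    also have "\<dots> > 0" using pos uvw by (intro add_pos_pos mult_pos_pos) auto
    finally have 1: "w + aY - pY > 0" using pos by (simp add: zero_less_mult_iff)
    have "u * (Yb + v + pY) = (u - w) * Yb + u * v + v * aY" using pl by (simp add: algebra_simps)
    also have "\<dots> > 0" using pos uvw by (intro add_pos_pos mult_pos_pos) auto
    finally have 2: "Yb + v + pY > 0" using pos by (simp add: zero_less_mult_iff)
    have Ypa: "ori s Y p a > 0"
      using 1 ori_triangle[of s Y p a F] ori_swap(2)[of s F Y p] by (simp add: defs)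
    have Ybp: "ori s Y b p > 0"
      using 2 ori_triangle[of s Y b p F] by (simp add: defs)
    have "ori s Y p a' > 0" if "a' \<in> A" for a'
    proof (cases "a' = a")
      case False
      then have "ori s Y a a' > 0" using a(2) that by blast
      then show ?thesis using ori_trans[of s Y Z p a a'] YZ p(1) a(1) that Ypa by blast
    qed (use Ypa in simp)
    moreover have "ori s Y b' p > 0" if "b' \<in> B" for b'
    proof (cases "b' = b")
      case False
      then have "ori s Y b' b > 0" using b(2)[of b'] that by (simp add: ori_minus)
      then show ?thesis using ori_trans[of s Y Z b' b p] YZ p(1) b(1) that Ybp by blast
    qed (use Ybp in simp)
    ultimately show False using no p(1) unfolding spoke_def by blast
  qed
  then show ?thesis using a(1) b(1) c bc ca by (auto simp: good_triple_def good_pair_def)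
qed

lemma good_triple_if_ccw:
  "\<lbrakk>a \<in> A; b \<in> B; c \<in> C; ori s F a b > 0; ori s F b c > 0; ori s F c a > 0\<rbrakk> \<Longrightarrow> good_triple s F A B C a b c"
  by (simp add: good_triple_def good_pair_def)

end

lemma good_triple_rotate: "good_triple s F B C A b c a \<longleftrightarrow> good_triple s F A B C a b c"
  by (auto simp: good_triple_def)

text \<open>The line through \<open>F\<close> and the opposite corner splits each sector into a plus
  and a minus part. Three points of equal sign turn counterclockwise around \<open>F\<close>; two
  neighbouring sectors, each of one sign and opposite to each other, are covered by the two
  preceding lemmas and their rotations.\<close>

lemma (in sectors) good_triple_exists:
  assumes no: "\<not> spoke s Z A B C" "\<not> spoke s X B C A" "\<not> spoke s Y C A B"
  shows "\<exists>a b c. good_triple s F A B C a b c"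
proof -
  interpret r: sectors s Y Z X F B C A by (rule rotate)
  interpret l: sectors s Z X Y F C A B by (rule r.rotate)
  have nA: "ori s F a Z > 0 \<longleftrightarrow> \<not> ori s F Z a > 0" if "a \<in> A" for a
    using gpF[of a Z] that not_corner ori_swap(2)[of s F a Z] by force
  have nB: "ori s F b X > 0 \<longleftrightarrow> \<not> ori s F X b > 0" if "b \<in> B" for b
    using gpF[of b X] that not_corner ori_swap(2)[of s F b X] by force
  have nC: "ori s F c Y > 0 \<longleftrightarrow> \<not> ori s F Y c > 0" if "c \<in> C" for c
    using gpF[of c Y] that not_corner ori_swap(2)[of s F c Y] by force
  have AB: False if "\<forall>a\<in>A. \<not> ori s F Z a > 0" "\<forall>b\<in>B. ori s F X b > 0"
    using no_spoke_minus_plus[OF no(1,2)] that nA by blast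
  have BC: False if "\<forall>b\<in>B. \<not> ori s F X b > 0" "\<forall>c\<in>C. ori s F Y c > 0"
    using r.no_spoke_minus_plus[OF no(2,3)] that nB by blast
  have CA: False if "\<forall>c\<in>C. \<not> ori s F Y c > 0" "\<forall>a\<in>A. ori s F Z a > 0"
    using l.no_spoke_minus_plus[OF no(3,1)] that nC by blast
  have AB': ?thesis if "\<forall>a\<in>A. ori s F Z a > 0" "\<forall>b\<in>B. \<not> ori s F X b > 0"
    using no_spoke_plus_minus[OF no(3)] that nB by blast
  have BC': ?thesis if "\<forall>b\<in>B. ori s F X b > 0" "\<forall>c\<in>C. \<not> ori s F Y c > 0"
    using r.no_spoke_plus_minus[OF no(1)] that nC good_triple_rotate by blast
  have CA': ?thesis if "\<forall>c\<in>C. ori s F Y c > 0" "\<forall>a\<in>A. \<not> ori s F Z a > 0"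
    using l.no_spoke_plus_minus[OF no(2)] that nA good_triple_rotate by blast
  have pos: ?thesis if "a \<in> A" "b \<in> B" "c \<in> C" "ori s F Z a > 0" "ori s F X b > 0" "ori s F Y c > 0" for a b c
    using good_triple_if_ccw[of a b c] ccw_ab[of a b] r.ccw_ab[of b c] l.ccw_ab[of c a] that by blast
  have neg: ?thesis if "a \<in> A" "b \<in> B" "c \<in> C" "\<not> ori s F Z a > 0" "\<not> ori s F X b > 0" "\<not> ori s F Y c > 0" for a b c
    using good_triple_if_ccw[of a b c] ccw_ab[of a b] r.ccw_ab[of b c] l.ccw_ab[of c a] that nA nB nC by blast
  show ?thesis
  proof (rule ccontr)
    assume none: "\<not> ?thesis"
    define pA mA pB mB pC mC where
      "pA = (\<exists>a\<in>A. ori s F Z a > 0)" and "mA = (\<exists>a\<in>A. \<not> ori s F Z a > 0)" and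
      "pB = (\<exists>b\<in>B. ori s F X b > 0)" and "mB = (\<exists>b\<in>B. \<not> ori s F X b > 0)" and
      "pC = (\<exists>c\<in>C. ori s F Y c > 0)" and "mC = (\<exists>c\<in>C. \<not> ori s F Y c > 0)"
    note defs = this
    have "\<not> (pA \<and> pB \<and> pC)" "\<not> (mA \<and> mB \<and> mC)"
      using pos neg none unfolding defs by blast+
    moreover have "pA \<or> mB" "pB \<or> mC" "pC \<or> mA"
      using AB BC CA unfolding defs by blast+
    moreover have "mA \<or> pB" "mB \<or> pC" "mC \<or> pA"
      using AB' BC' CA' none unfolding defs by blast+
    moreover have "pA \<or> mA" "pB \<or> mB" "pC \<or> mC"
      using nonempty unfolding defs by blast+
    \<comment> \<open>A sector without minus points would force a plus point in every sector. So
      each sector has a minus point, which is excluded too.\<close>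
    ultimately show False by argo
  qed
qed

section \<open>Minimal good triples\<close>

context sectors begin

text \<open>A good triple with the fewest points in its hull works: a different one within that hull
  misses some vertex, and this extreme point is then outside the smaller hull.\<close>

lemma minimal_triple_exists:
  assumes "good_triple s F A B C a0 b0 c0"
  shows "\<exists>a b c. minimal_triple s F A B C a b c"
proof -
  let ?U = "A \<union> B \<union> C"
  define m where "m = (\<lambda>(a, b, c). card (?U \<inter> convex hull {a, b, c}))"
  define G where "G = {(a, b, c). good_triple s F A B C a b c}"
  have "(a0, b0, c0) \<in> G" using assms by (simp add: G_def)
  then obtain t where t: "t \<in> G" "\<And>t'. t' \<in> G \<Longrightarrow> m t \<le> m t'"
    using ex_has_least_nat[of "\<lambda>t. t \<in> G" _ m] by blast
  obtain a b c where abc: "t = (a, b, c)" by (metis prod_cases3)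
  have good: "good_triple s F A B C a b c" using t(1) by (simp add: G_def abc)
  then have pos: "ori s a b c > 0" by (rule good_triple_ccw)
  have ABC: "a \<in> A" "b \<in> B" "c \<in> C" using good by (auto simp: good_triple_def)
  have nc: "\<not> collinear {a, b, c}" using ori_noncollinear pos by (metis less_irrefl)
  have "a' = a \<and> b' = b \<and> c' = c"
    if g: "good_triple s F A B C a' b' c'" and sub: "{a', b', c'} \<subseteq> convex hull {a, b, c}" for a' b' c'
  proof (rule ccontr)
    assume ne: "\<not> ?thesis"
    have ABC': "a' \<in> A" "b' \<in> B" "c' \<in> C" using g by (auto simp: good_triple_def)
    let ?H = "convex hull {a, b, c}" and ?H' = "convex hull {a', b', c'}"
    have HH: "?H' \<subseteq> ?H" using sub by (simp add: hull_minimal)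
    obtain v where v: "v \<in> {a, b, c}" "v \<notin> {a', b', c'}"
      using ne ABC ABC' disjoint by blast
    have ex: "v extreme_point_of ?H" using triangle_faces(3)[OF nc, of v] v(1) by auto
    have "v \<notin> ?H'"
    proof
      assume "v \<in> ?H'"
      then have "v extreme_point_of ?H'"
        using ex HH by (auto simp: extreme_point_of_def)
      then show False using extreme_point_of_convex_hull v(2) by blast
    qed
    moreover have "v \<in> ?U \<inter> ?H" using v(1) ABC by (auto intro: hull_inc)
    ultimately have "?U \<inter> ?H' \<subset> ?U \<inter> ?H" using HH by blast
    then have "card (?U \<inter> ?H') < card (?U \<inter> ?H)"
      using finA finB finC by (intro psubset_card_mono) auto
    moreover have "m t \<le> m (a', b', c')" using t(2) g by (simp add: G_def)
    ultimately show False by (simp add: m_def abc)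
  qed
  then show ?thesis using good unfolding minimal_triple_def by blast
qed

section \<open>A minimal triangle contains no further point\<close>

context
  fixes a b c
  assumes min: "minimal_triple s F A B C a b c"
begin

lemma min_mem: "a \<in> A" "b \<in> B" "c \<in> C"
  and min_good: "good_pair s F A b c" "good_pair s F B c a" "good_pair s F C a b"
  using min by (auto simp: minimal_triple_def good_triple_def)

lemma min_ccw: "ori s a b c > 0"
  using min good_triple_ccw by (auto simp: minimal_triple_def)

lemma min_unique:
  "\<lbrakk>good_triple s F A B C a' b' c'; {a', b', c'} \<subseteq> convex hull {a, b, c}\<rbrakk> \<Longrightarrow> a' = a \<and> b' = b \<and> c' = c"
  using min by (auto simp: minimal_triple_def)

lemma min_distinct: "a \<noteq> b" "b \<noteq> c" "c \<noteq> a"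
  using min_mem disjoint by auto

lemma min_hull_mem: "a \<in> convex hull {a, b, c}" "b \<in> convex hull {a, b, c}" "c \<in> convex hull {a, b, c}"
  by (auto intro: hull_inc)

text \<open>Minimality is used repeatedly. As \<open>(p, b, c)\<close> is not good, some
  \<open>c'\<close> lies in the triangle \<open>Fbp\<close>; as \<open>(a, b, c')\<close> is not
  good, some \<open>b'\<close> lies in \<open>Fac'\<close>; as \<open>(a, b', c)\<close> is not
  good, \<open>b'\<close> and \<open>c\<close> turn clockwise around \<open>F\<close>. But then
  \<open>p\<close>, \<open>b'\<close>, \<open>c'\<close> turn counterclockwise around
  \<open>F\<close> and form a forbidden good triple.\<close>

lemma empty_A_inside:
  assumes F: "ori s F a b > 0" "ori s F b c > 0" "ori s F c a > 0"
    and p: "p \<in> A" "p \<in> convex hull {a, b, c}" "ori s F p b < 0"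
  shows False
proof -
  let ?H = "convex hull {a, b, c}"
  have abc: "a \<in> A" "b \<in> B" "c \<in> C" by (rule min_mem)+
  note hm = min_hull_mem
  have FH: "F \<in> ?H"
    using in_hull3[OF min_ccw, of F] F ori_rot(1)[of s a b F] ori_rot(1)[of s b c F] ori_rot(1)[of s c a F]
    by simp
  note hp = hull3_ori[OF min_ccw p(2)]
  have pa: "p \<noteq> a" using p(3) F(1) by auto
  note g1 = gap_ab[OF p(1) abc(2) p(3)]
  have "\<not> good_pair s F C p b"
  proof
    assume "good_pair s F C p b"
    then have "good_triple s F A B C p b c"
      using p(1) abc F(2) g1(2)[OF abc(3)] by (simp add: good_triple_def good_pair_def)
    then show False using min_unique[of p b c] p(2) hm pa by simp
  qed
  then obtain c' where c': "c' \<in> C" "\<not> ori s c' p b > 0" by (auto simp: good_pair_def)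
  have "c' \<noteq> p" "c' \<noteq> b" "p \<noteq> b" using c'(1) p(1) abc disjoint by auto
  then have c'pb: "ori s c' p b < 0" using c' p(1) abc gp[of c' p b] by fastforce
  note g1' = g1[OF c'(1)]
  have c'H: "c' \<in> ?H"
  proof -
    have "c' \<in> convex hull {F, b, p}"
    proof (rule in_hull3[of s])
      show "ori s F b p > 0" using p(3) ori_swap(2)[of s F b p] by simp
      show "ori s F b c' \<ge> 0" using g1'(1) by simp
      show "ori s b p c' \<ge> 0" using c'pb ori_swap(3)[of s b p c'] by simp
      show "ori s p F c' \<ge> 0" using g1'(2) ori_rot(2)[of s p F c'] by simp
    qed
    moreover have "convex hull {F, b, p} \<subseteq> ?H" using FH hm p(2) by (simp add: hull_minimal)
    ultimately show ?thesis by blast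
  qed
  have c'c: "c' \<noteq> c" using c'pb hp(2) ori_rot(2)[of s b c p] by auto
  have "\<not> good_pair s F B c' a"
  proof
    assume "good_pair s F B c' a"
    then have "good_triple s F A B C a b c'"
      using abc c'(1) F(1) g1'(1) by (simp add: good_triple_def good_pair_def)
    then show False using min_unique[of a b c'] c'H hm c'c by simp
  qed
  then obtain b' where b': "b' \<in> B" "\<not> ori s b' c' a > 0" "\<not> ori s F c' a > 0" by (auto simp: good_pair_def)
  have n: "b' \<noteq> c'" "b' \<noteq> a" "c' \<noteq> a" using b' c'(1) abc disjoint by auto
  have b'ca: "ori s b' c' a < 0" using b' c'(1) abc gp[of b' c' a] n by fastforce
  have c'a: "ori s F c' a < 0" using b'(3) gpF[of c' a] n abc c'(1) by fastforce
  note g2 = gap_ca[OF c'(1) abc(1) c'a b'(1)]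
  have b'H: "b' \<in> ?H"
  proof -
    have "b' \<in> convex hull {F, a, c'}"
    proof (rule in_hull3[of s])
      show "ori s F a c' > 0" using c'a ori_swap(2)[of s F a c'] by simp
      show "ori s F a b' \<ge> 0" using g2(1) by simp
      show "ori s a c' b' \<ge> 0" using b'ca ori_swap(3)[of s a c' b'] by simp
      show "ori s c' F b' \<ge> 0" using g2(2) ori_rot(2)[of s c' F b'] by simp
    qed
    moreover have "convex hull {F, a, c'} \<subseteq> ?H" using FH hm c'H by (simp add: hull_minimal)
    ultimately show ?thesis by blast
  qed
  note hc' = hull3_ori[OF min_ccw c'H]
  have b'b: "b' \<noteq> b" using b'ca hc'(1) ori_rot(1)[of s b c' a] by auto
  have "\<not> good_pair s F A b' c"
  proof
    assume "good_pair s F A b' c"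
    then have "good_triple s F A B C a b' c"
      using abc b'(1) F(3) g2(1) by (simp add: good_triple_def good_pair_def)
    then show False using min_unique[of a b' c] b'H hm b'b by simp
  qed
  then have "\<not> ori s F b' c > 0" by (auto simp: good_pair_def)
  moreover have "b' \<noteq> c" using b'(1) abc disjoint by auto
  ultimately have "ori s F b' c < 0" using gpF[of b' c] abc b'(1) by fastforce
  then have "ori s F p b' > 0" using gap(3)[OF b'(1) abc(3) _ p(1)] by blast
  then have "good_triple s F A B C p b' c'"
    using good_triple_if_ccw p(1) b'(1) c'(1) g2(2) g1'(2) by blast
  then show False using min_unique[of p b' c'] p(2) b'H c'H pa by simp
qed

text \<open>With \<open>F\<close> beyond \<open>bc\<close>, every point of \<open>A\<close> turns
  counterclockwise with \<open>b\<close> and \<open>c\<close> by \<open>gap\<close>, and goodness of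
  \<open>(b, c)\<close> does not involve \<open>a\<close>. So any point of \<open>A\<close>
  completes \<open>b\<close>, \<open>c\<close> to a good triple.\<close>

lemma empty_A_far:
  assumes F: "ori s F b c < 0" and p: "p \<in> A" "p \<in> convex hull {a, b, c}"
  shows "p = a"
proof -
  have abc: "a \<in> A" "b \<in> B" "c \<in> C" by (rule min_mem)+
  have "good_triple s F A B C p b c"
    using p(1) abc min_good(1) gap(3,4)[OF abc(2,3) F p(1)] by (simp add: good_triple_def good_pair_def)
  then show ?thesis using min_unique[of p b c] p(2) min_hull_mem by simp
qed

text \<open>The position of \<open>q\<close> makes \<open>a\<close>, \<open>q\<close>
  counterclockwise, so by minimality \<open>(q, c)\<close> is the pair that is not good. The witness
  in \<open>A\<close> lies in the triangle \<open>Fcq\<close> and in \<open>abc\<close>, hence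
  equals \<open>a\<close>; but \<open>a\<close> is on the wrong side of \<open>qc\<close>.\<close>

lemma empty_B_far:
  assumes F: "ori s F b c < 0" and q: "q \<in> B" "q \<in> convex hull {a, b, c}"
  shows "q = b"
proof (rule ccontr)
  assume qb: "q \<noteq> b"
  have abc: "a \<in> A" "b \<in> B" "c \<in> C" by (rule min_mem)+
  note g = gap[OF abc(2,3) F] and hq = hull3_ori[OF min_ccw q(2)]
  have ga: "ori s F a b > 0" "ori s F c a > 0" using g(3,4)[OF abc(1)] .
  have cb: "ori s F c b > 0" using F ori_swap(2)[of s F c b] by simp
  have qac: "q \<noteq> a" "q \<noteq> c" using q(1) abc disjoint by auto
  have bcq: "ori s b c q > 0" using hq(2) gp[of b c q] abc q(1) qb qac min_distinct by fastforce
  have "ori s a b c * ori s F b q = ori s b c q * ori s F b a + ori s a b q * ori s F b c"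
    using ori_bary[of s a b c F b q] by simp
  also have "\<dots> < 0"
  proof -
    have "ori s b c q * ori s F b a < 0" using bcq ga(1) ori_swap(2)[of s F b a] by (simp add: mult_pos_neg)
    moreover have "ori s a b q * ori s F b c \<le> 0" using hq(1) F by (simp add: mult_nonneg_nonpos)
    ultimately show ?thesis by linarith
  qed
  finally have "ori s F q b > 0" using min_ccw ori_swap(2)[of s F q b] by (simp add: mult_less_0_iff)
  then have aq: "ori s F a q > 0"
    using ori_cone[of s F a Y q b] A(2)[OF abc(1)] B(1)[OF q(1)] B(1)[OF abc(2)] ga(1) by simp
  have "\<not> good_pair s F A q c"
  proof
    assume "good_pair s F A q c"
    then have "good_triple s F A B C a q c"
      using abc q(1) ga aq by (simp add: good_triple_def good_pair_def)
    then show False using min_unique[of a q c] q(2) min_hull_mem qb by simp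
  qed
  then obtain p where p: "p \<in> A" "\<not> ori s p q c > 0" "\<not> ori s F q c > 0" by (auto simp: good_pair_def)
  have n: "p \<noteq> q" "p \<noteq> c" using p(1) q(1) abc disjoint by auto
  have pqc: "ori s p q c < 0" using p gp[of p q c] n qac q(1) abc by fastforce
  have qc: "ori s F q c < 0" using p(3) gpF[of q c] q(1) abc qac by fastforce
  note g2 = gap[OF q(1) abc(3) qc]
  have "p \<in> convex hull {F, c, q}"
  proof (rule in_hull3[of s])
    show "ori s F c q > 0" using qc ori_swap(2)[of s F c q] by simp
    show "ori s F c p \<ge> 0" using g2(4)[OF p(1)] by simp
    show "ori s c q p \<ge> 0" using pqc ori_swap(3)[of s c q p] by simp
    show "ori s q F p \<ge> 0" using g2(3)[OF p(1)] ori_rot(2)[of s q F p] by simp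
  qed
  note pF = this
  have "p \<in> convex hull {a, b, c}"
  proof (rule in_hull3[OF min_ccw])
    have abF: "ori s a b F \<ge> 0" using ga(1) ori_rot(1)[of s a b F] by simp
    have caF: "ori s c a F \<ge> 0" using ga(2) ori_rot(1)[of s c a F] by simp
    show "ori s a b p \<ge> 0"
      by (rule hull_ori_nonneg[OF _ pF]) (use abF hq min_ccw in auto)
    show "ori s c a p \<ge> 0"
      by (rule hull_ori_nonneg[OF _ pF]) (use caF hq in auto)
    have "ori s p b c > 0" using min_good(1) F p(1) by (auto simp: good_pair_def)
    then show "ori s b c p \<ge> 0" using ori_rot(1)[of s b c p] by simp
  qed
  then have "p = a" using empty_A_far[OF F p(1)] by blast
  then show False using pqc hq(3) ori_rot(2)[of s c a q] by simp
qed

end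

lemma empty_C_far:
  assumes min: "minimal_triple s F A B C a b c" and F: "ori s F b c < 0" and r: "r \<in> C" "r \<in> convex hull {a, b, c}"
  shows "r = c"
proof -
  interpret m: sectors "-s" Y X Z F A C B by (rule mirror)
  have "convex hull {a, c, b} = convex hull {a, b, c}" by (simp add: insert_commute)
  then show ?thesis
    using m.empty_B_far[OF minimal_triple_mirror[OF min], of r] F r by (simp add: ori_minus)
qed

text \<open>If \<open>F\<close> lies beyond a side, a rotation leads to one of the far cases. If
  \<open>F\<close> is inside, either \<open>p\<close> forms a good triple with \<open>b\<close> and
  \<open>c\<close>, or one of \<open>pb\<close>, \<open>cp\<close> turns clockwise; reflection
  exchanges these two cases.\<close>

lemma minimal_triple_empty:
  assumes min: "minimal_triple s F A B C a b c" and p: "p \<in> A" "p \<in> convex hull {a, b, c}"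
  shows "p = a"
proof (rule ccontr)
  assume pa: "p \<noteq> a"
  interpret r: sectors s Y Z X F B C A by (rule rotate)
  interpret l: sectors s Z X Y F C A B by (rule r.rotate)
  interpret m: sectors "-s" Y X Z F A C B by (rule mirror)
  have minr: "minimal_triple s F B C A b c a" using min by (rule minimal_triple_rotate)
  have minl: "minimal_triple s F C A B c a b" using minr by (rule minimal_triple_rotate)
  have hulls: "convex hull {b, c, a} = convex hull {a, b, c}" "convex hull {c, a, b} = convex hull {a, b, c}"
    "convex hull {a, c, b} = convex hull {a, b, c}"
    by (simp_all add: insert_commute)
  have abc: "a \<in> A" "b \<in> B" "c \<in> C" by (rule min_mem[OF min])+
  have n: "a \<noteq> b" "b \<noteq> c" "c \<noteq> a" "p \<noteq> b" "p \<noteq> c" using abc p(1) disjoint by auto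
  have nz: "ori s F a b \<noteq> 0" "ori s F b c \<noteq> 0" "ori s F c a \<noteq> 0" "ori s F p b \<noteq> 0" "ori s F c p \<noteq> 0"
    using gpF abc n p(1) by auto
  consider "ori s F b c < 0" | "ori s F a b < 0" | "ori s F c a < 0"
    | "ori s F a b > 0" "ori s F b c > 0" "ori s F c a > 0" using nz by linarith
  then show False
  proof cases
    case 1 then show ?thesis using empty_A_far[OF min _ p] pa by blast
  next
    case 2 then show ?thesis using l.empty_B_far[OF minl _ p(1)] p(2) pa hulls by simp
  next
    case 3 then show ?thesis using r.empty_C_far[OF minr _ p(1)] p(2) pa hulls by simp
  next
    case 4
    consider "ori s F p b < 0" | "ori s F c p < 0" | "ori s F p b > 0" "ori s F c p > 0" using nz by linarith
    then show ?thesis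
    proof cases
      case 1 then show ?thesis using empty_A_inside[OF min 4 p] by blast
    next
      case 2
      then show ?thesis
        using m.empty_A_inside[OF minimal_triple_mirror[OF min], of p] 4 p hulls(3) by (simp add: ori_minus)
    next
      case 3
      then have "good_triple s F A B C p b c" using good_triple_if_ccw p(1) abc 4(2) by blast
      then show ?thesis using min_unique[OF min, of p b c] p(2) pa min_hull_mem[OF min] by simp
    qed
  qed
qed

text \<open>By emptiness such a \<open>p\<close> lies beyond \<open>bc\<close>, so goodness forces
  \<open>b\<close>, \<open>c\<close> to be counterclockwise around \<open>F\<close>. Then
  \<open>ap\<close> crosses \<open>bc\<close> in a point of the sector of \<open>A\<close>, whereas
  from \<open>F\<close> the segment \<open>bc\<close> is seen within the angle from \<open>b\<close>
  through \<open>Z\<close> to \<open>c\<close>.\<close>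

lemma minimal_triple_cone:
  assumes min: "minimal_triple s F A B C a b c" and p: "p \<in> A" "p \<noteq> a"
  shows "\<not> (ori s a b p > 0 \<and> ori s a p c > 0)"
proof
  assume "ori s a b p > 0 \<and> ori s a p c > 0"
  then have ab: "ori s a b p > 0" and ca: "ori s c a p > 0" using ori_rot(2)[of s c a p] by auto
  have abc: "a \<in> A" "b \<in> B" "c \<in> C" by (rule min_mem[OF min])+
  have pos: "ori s a b c > 0" by (rule min_ccw[OF min])
  have "\<not> ori s b c p \<ge> 0"
    using in_hull3[OF pos, of p] ab ca minimal_triple_empty[OF min p(1)] p(2) by fastforce
  then have bcp: "ori s b c p < 0" by simp
  then have "ori s p b c < 0" using ori_rot(1)[of s b c p] by simp
  then have bc: "ori s F b c > 0" using min_good(1)[OF min] p(1) unfolding good_pair_def by fastforce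
  \<comment> \<open>Solves \<open>ori s b c m = 0\<close>, so that \<open>m\<close> is the point
    where \<open>ap\<close> meets \<open>bc\<close>.\<close>
  define t where "t = ori s a b c / (ori s a b c - ori s b c p)"
  have t: "0 < t" "t < 1" using pos bcp by (auto simp: t_def)
  define m where "m = (1 - t) *\<^sub>R a + t *\<^sub>R p"
  have aff: "ori s x y m = (1 - t) * ori s x y a + t * ori s x y p" for x y
    unfolding m_def by (rule ori_affine)
  have "ori s b c m = (1 - t) * ori s a b c + t * ori s b c p"
    using aff[of b c] ori_rot(1)[of s b c a] by simp
  also have "\<dots> = ori s a b c - t * (ori s a b c - ori s b c p)" by (simp add: algebra_simps)
  also have "\<dots> = 0" using pos bcp by (simp add: t_def)
  finally have bcm: "ori s b c m = 0" .
  have abm: "ori s a b m > 0" using aff[of a b] ab t by simp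
  have cam: "ori s c a m > 0" using aff[of c a] ca t by simp
  have mX: "ori s F X m > 0" using aff[of F X] A(1)[OF abc(1)] A(1)[OF p(1)] t by (simp add: add_pos_pos)
  have "ori s Y F a > 0" "ori s Y F p > 0"
    using A(2)[OF abc(1)] A(2)[OF p(1)] ori_rot(2)[of s Y F a] ori_rot(2)[of s Y F p] by simp_all
  then have "ori s Y F m > 0" using aff[of Y F] t by (simp add: add_pos_pos)
  then have mY: "ori s F m Y > 0" using ori_rot(2)[of s Y F m] by simp
  have "ori s a b c * ori s F b m = ori s a b m * ori s F b c"
    using ori_bary[of s a b c F b m] bcm cam by simp
  then have "ori s a b c * ori s F b m > 0" using abm bc by simp
  then have "ori s F m b < 0" using pos ori_swap(2)[of s F m b] by (simp add: zero_less_mult_iff)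
  then have "ori s F c m > 0"
    using sector_gap(4)[OF tri(3,1,2) C(1)[OF abc(3)] C(2)[OF abc(3)] mX mY B(1)[OF abc(2)] B(2)[OF abc(2)]]
      sector_gap(3)[OF tri(3,1,2) C(1)[OF abc(3)] C(2)[OF abc(3)] mX mY B(1)[OF abc(2)] B(2)[OF abc(2)]] by blast
  moreover have "ori s a b c * ori s F c m = ori s c a m * ori s F c b"
    using ori_bary[of s a b c F c m] bcm by simp
  ultimately have "ori s c a m * ori s F c b > 0" using pos by (metis mult_pos_pos)
  then show False using mult_pos_pos[OF cam bc] unfolding ori_swap(2)[of s F c b] mult_minus_right by linarith
qed

end

section \<open>Assembling the polygon\<close>

lemma hulls_meet_at_point:
  assumes "\<And>r. r \<in> S \<Longrightarrow> r = a \<or> ori s x y r < 0" "\<And>r. r \<in> S' \<Longrightarrow> ori s x y r \<ge> 0"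
    and "ori s x y a = 0"
  shows "convex hull S \<inter> convex hull S' \<subseteq> {a}"
proof
  fix z assume z: "z \<in> convex hull S \<inter> convex hull S'"
  then have "ori s x y z \<ge> 0" using hull_ori_nonneg[of S' s x y z] assms(2) by blast
  then have "z \<in> convex hull {a}"
    using hull_ori_face[of S "{a}" s x y z] assms(1,3) z by auto
  then show "z \<in> {a}" by simp
qed

lemma base_face:
  assumes "\<And>r. r \<in> S \<Longrightarrow> r \<in> {p, q} \<or> ori s p r q > 0" "z \<in> convex hull S" "ori s p q z \<ge> 0"
  shows "z \<in> closed_segment p q"
proof -
  have "z \<in> convex hull {p, q}"
  proof (rule hull_ori_face[of S "{p, q}" s p q])
    show "r \<in> {p, q} \<or> ori s p q r < 0" if "r \<in> S" for r
      using assms(1)[OF that] ori_swap(2)[of s p r q] by auto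
  qed (use assms in auto)
  then show ?thesis by (simp add: segment_convex_hull)
qed

text \<open>Region and triangulation are left unspecified, since \<open>glued\<close> already
  determines what is needed about them.\<close>

definition layout where
  "layout D X Y Z A B C \<longleftrightarrow> (\<exists>l1 l2 l3 R \<T>. distinct l1 \<and> distinct l2 \<and> distinct l3 \<and>
     set l1 = A \<and> set l2 = B \<and> set l3 = C \<and> glued D (X # l1 @ Y # l2 @ Z # l3) R \<T>)"

lemma layout_rotate:
  assumes "layout D Y Z X B C A" shows "layout D X Y Z A B C"
proof -
  obtain l1 l2 l3 R \<T> where l: "distinct l1" "distinct l2" "distinct l3" "set l1 = B" "set l2 = C" "set l3 = A"
    "glued D ((Y # l1 @ Z # l2) @ (X # l3)) R \<T>"
    using assms by (auto simp: layout_def)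
  have "glued D (X # l3 @ Y # l1 @ Z # l2) R \<T>"
    using glued.rotate[OF l(7)] by simp
  then show ?thesis using l unfolding layout_def by blast
qed

text \<open>\<open>D\<close> stays abstract: points of different sectors may be joined, and a point
  may be joined to the corner opposite to its sector, as a spoke is.\<close>

locale layout_sectors = sectors +
  fixes D :: "real^2 \<Rightarrow> real^2 \<Rightarrow> bool"
  assumes Dsym: "\<And>x y. D x y \<Longrightarrow> D y x"
    and DAB: "\<And>a b. \<lbrakk>a \<in> A; b \<in> B\<rbrakk> \<Longrightarrow> D a b" and DBC: "\<And>b c. \<lbrakk>b \<in> B; c \<in> C\<rbrakk> \<Longrightarrow> D b c"
    and DCA: "\<And>c a. \<lbrakk>c \<in> C; a \<in> A\<rbrakk> \<Longrightarrow> D c a"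
    and DAZ: "\<And>a. a \<in> A \<Longrightarrow> D a Z" and DBX: "\<And>b. b \<in> B \<Longrightarrow> D b X" and DCY: "\<And>c. c \<in> C \<Longrightarrow> D c Y"
begin

lemma layout_rotated: "layout_sectors s Y Z X F B C A D"
proof -
  interpret r: sectors s Y Z X F B C A by (rule rotate)
  show ?thesis by unfold_locales (use Dsym DAB DBC DCA DAZ DBX DCY in blast)+
qed

lemma ori_XYZ: "ori s X Y Z > 0"
  using ori_triangle[of s X Y Z F] tri by simp

lemma corner:
  assumes "a \<in> insert X A" "b \<in> insert Z B"
  shows "ori s a Y b > 0"
proof -
  have YZa: "ori s Y Z a > 0"
    using assms(1) inner(2)[of a] ori_XYZ ori_rot(1)[of s Y Z X] by auto
  have "ori s Y b a > 0"
  proof (cases "b = Z")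
    case False
    then have b: "b \<in> B" using assms(2) by blast
    show ?thesis
    proof (rule ori_trans[of s Y Z b F a])
      show "ori s Y Z b > 0" using inner(2) b by blast
      show "ori s Y Z F > 0" using tri(2) ori_rot(1)[of s Y Z F] by simp
      show "ori s Y b F > 0" using B(1)[OF b] ori_rot(1)[of s Y b F] by simp
      show "ori s Y F a > 0" using assms(1) A(2)[of a] tri(1) ori_rot(2)[of s Y F a] by auto
    qed (rule YZa)
  qed (use YZa in simp)
  then show ?thesis using ori_rot(2)[of s a Y b] ori_rot(1)[of s a Y b] ori_rot(2)[of s Y b a] by simp
qed

lemma ray_sides:
  assumes "a \<in> insert X A" "b \<in> insert Z B"
  shows "ori s Y F a > 0" "ori s Y F b < 0"
proof -
  show "ori s Y F a > 0" using assms(1) A(2)[of a] tri(1) ori_rot(2)[of s Y F a] by auto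
  show "ori s Y F b < 0" using assms(2) B(1)[of b] tri(2) ori_swap(1)[of s Y F b] by auto
qed

lemma strip_at_Y:
  assumes PQ: "P \<subseteq> insert X A" "Q \<subseteq> insert Z B" "p \<in> P" "q \<in> Q" and D: "\<And>x y. \<lbrakk>x \<in> P; y \<in> Q\<rbrakk> \<Longrightarrow> D x y"
    and base: "\<And>r. r \<in> P \<union> Q - {p, q} \<Longrightarrow> ori s p r q > 0"
    and G: "glued D (q # vs @ [p]) R \<T>"
    and R: "R \<inter> convex hull (insert Y (P \<union> Q)) \<subseteq> closed_segment p q"
  shows "\<exists>ps qs R' \<T>'. set ps = P - {p} \<and> set qs = Q - {q} \<and> distinct ps \<and> distinct qs \<and>
     glued D (qs @ [q] @ vs @ [p] @ ps @ [Y]) R' \<T>' \<and> R' \<subseteq> R \<union> convex hull (insert Y (P \<union> Q))"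
proof (rule corner_strip[where s = s and W = F])
  show "finite P" "finite Q" using PQ finA finB by (auto intro: finite_subset[of P "insert X A"] finite_subset[of Q "insert Z B"])
  show "ori s x Y y > 0" if "x \<in> P" "y \<in> Q" for x y using corner that PQ by blast
  show "ori s Y F x > 0" if "x \<in> P" for x using ray_sides(1) that PQ by blast
  show "ori s Y F y < 0" if "y \<in> Q" for y using ray_sides(2) that PQ by blast
  show "ori s x y z \<noteq> 0" if "x \<in> P \<union> Q" "y \<in> P \<union> Q" "z \<in> P \<union> Q" "x \<noteq> y" "y \<noteq> z" "x \<noteq> z" for x y z
    by (rule gp) (use that PQ in auto)
  show "D x y \<and> D y x" if "x \<in> P" "y \<in> Q" for x y using D Dsym that by blast
qed (use PQ base G R in auto)

lemma spoke_layout: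
  assumes "spoke s Z A B C"
  shows "layout D X Y Z A B C"
proof -
  interpret r: layout_sectors s Y Z X F B C A D by (rule layout_rotated)
  interpret l: layout_sectors s Z X Y F C A B D by (rule r.layout_rotated)
  obtain p where p: "p \<in> A" "\<And>b. b \<in> B \<Longrightarrow> ori s Z p b > 0" "\<And>c. c \<in> C \<Longrightarrow> ori s Z c p > 0"
    using assms unfolding spoke_def by blast
  define P1 where "P1 = insert p {a \<in> A. ori s Z p a > 0}"
  define Q2 where "Q2 = insert p {a \<in> A. ori s Z p a < 0}"
  let ?Q1 = "insert Z B" and ?P2 = "insert Z C"
  have pZ: "p \<noteq> Z" using p(1) not_corner by auto
  let ?H1 = "convex hull (insert Y (P1 \<union> ?Q1))" and ?H2 = "convex hull (insert X (?P2 \<union> Q2))"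
  have "\<exists>ps qs R' \<T>'. set ps = P1 - {p} \<and> set qs = ?Q1 - {Z} \<and> distinct ps \<and> distinct qs \<and>
     glued D (qs @ [Z] @ [] @ [p] @ ps @ [Y]) R' \<T>' \<and> R' \<subseteq> closed_segment Z p \<union> ?H1"
  proof (rule strip_at_Y)
    \<comment> \<open>The diagonal as a polygon without interior: this strip is glued to one side of
      it, the strip at \<open>X\<close> later to the other.\<close>
    show "glued D (Z # [] @ [p]) (closed_segment Z p) {}" using glued.edge[of Z p D] pZ by simp
    show "closed_segment Z p \<inter> ?H1 \<subseteq> closed_segment p Z" by (simp add: closed_segment_commute)
    show "D x y" if "x \<in> P1" "y \<in> ?Q1" for x y using that DAB DAZ p(1) by (auto simp: P1_def)
    show "ori s p r Z > 0" if "r \<in> P1 \<union> ?Q1 - {p, Z}" for r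
      using that p(2)[of r] ori_rot(1)[of s p r Z] by (auto simp: P1_def)
  qed (use p(1) in \<open>auto simp: P1_def\<close>)
  then obtain ps qs R \<T> where G1: "set ps = P1 - {p}" "set qs = B" "distinct ps" "distinct qs"
    "glued D ((qs @ [Z]) @ (p # ps @ [Y])) R \<T>" "R \<subseteq> closed_segment Z p \<union> ?H1"
    using not_corner(4) by auto
  have G1': "glued D (p # (ps @ [Y] @ qs) @ [Z]) R \<T>"
    using glued.rotate[OF G1(5)] by simp
  have "\<exists>ps' qs' R' \<T>'. set ps' = ?P2 - {Z} \<and> set qs' = Q2 - {p} \<and> distinct ps' \<and> distinct qs' \<and>
     glued D (qs' @ [p] @ (ps @ [Y] @ qs) @ [Z] @ ps' @ [X]) R' \<T>' \<and> R' \<subseteq> R \<union> ?H2"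
  proof (rule l.strip_at_Y[OF _ _ _ _ _ _ G1'])
    show "D x y" if "x \<in> ?P2" "y \<in> Q2" for x y using that DCA DAZ Dsym p(1) by (auto simp: Q2_def)
    show base: "ori s Z r p > 0" if "r \<in> ?P2 \<union> Q2 - {Z, p}" for r
      using that p(3)[of r] ori_swap(2)[of s Z r p] by (auto simp: Q2_def)
    \<comment> \<open>The line \<open>Zp\<close> separates the strips: what is built has nonnegative
      orientation, and every point spanning \<open>?H2\<close> other than \<open>Z\<close> and
      \<open>p\<close> has negative orientation.\<close>
    show "R \<inter> ?H2 \<subseteq> closed_segment Z p"
    proof
      fix x assume x: "x \<in> R \<inter> ?H2"
      have "x \<in> convex hull (insert Y (P1 \<union> ?Q1))"
      proof (cases "x \<in> ?H1")
        case False
        then have "x \<in> convex hull {Z, p}" using x G1(6) by (auto simp: segment_convex_hull)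
        then show ?thesis using hull_mono[of "{Z, p}" "insert Y (P1 \<union> ?Q1)" convex] by (auto simp: P1_def)
      qed
      then have "ori s Z p x \<ge> 0"
      proof (rule hull_ori_nonneg[rotated])
        fix r assume "r \<in> insert Y (P1 \<union> ?Q1)"
        then show "ori s Z p r \<ge> 0"
          using corner[of p Z] p(1,2) ori_rot(2)[of s Z p Y] by (auto simp: P1_def less_imp_le)
      qed
      then show "x \<in> closed_segment Z p"
      proof (rule base_face[rotated 2])
        show "x \<in> ?H2" using x by simp
        show "r \<in> {Z, p} \<or> ori s Z r p > 0" if "r \<in> insert X (?P2 \<union> Q2)" for r
          using that base[of r] l.corner[of Z p] p(1) by (cases "r = X") auto
      qed
    qed
  qed (use p(1) in \<open>auto simp: Q2_def\<close>)
  then obtain ps' qs' R' \<T>' where G2: "set ps' = C" "set qs' = Q2 - {p}" "distinct ps'" "distinct qs'"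
    "glued D ((qs' @ [p] @ (ps @ [Y] @ qs) @ [Z] @ ps') @ [X]) R' \<T>'"
    using not_corner(4) by auto
  have "glued D (X # (qs' @ [p] @ ps) @ Y # qs @ Z # ps') R' \<T>'"
    using glued.rotate[OF G2(5)] by simp
  moreover have "ori s Z p a \<noteq> 0" if "a \<in> A" "a \<noteq> p" for a
    using gp[of Z p a] that p(1) not_corner by auto
  then have "A \<subseteq> P1 \<union> Q2" by (auto simp: P1_def Q2_def neq_iff)
  then have "set (qs' @ [p] @ ps) = A" using G1(1) G2(2) p(1) by (auto simp: P1_def Q2_def)
  moreover have "distinct (qs' @ [p] @ ps)" using G1(1,3) G2(2,4) by (auto simp: P1_def Q2_def)
  ultimately show ?thesis using G1(2,4) G2(1,3) unfolding layout_def by blast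
qed

text \<open>Index 1 marks the part of a sector assigned to the strip at its first corner, index 2
  that at its second. Two strips share at most a vertex of the central triangle, which lies on both
  their bases, so each new hull meets what is built only in its base.\<close>

lemma triple_layout:
  assumes abc: "a \<in> A" "b \<in> B" "c \<in> C" "ori s a b c > 0"
    and A12: "A = insert a (A1 \<union> A2)" "a \<notin> A1" "a \<notin> A2" "A1 \<inter> A2 = {}"
    and B12: "B = insert b (B1 \<union> B2)" "b \<notin> B1" "b \<notin> B2" "B1 \<inter> B2 = {}"
    and C12: "C = insert c (C1 \<union> C2)" "c \<notin> C1" "c \<notin> C2" "C1 \<inter> C2 = {}"
    and baseY: "\<And>r. r \<in> A2 \<union> B1 \<Longrightarrow> ori s a r b > 0"
    and baseZ: "\<And>r. r \<in> B2 \<union> C1 \<Longrightarrow> ori s b r c > 0"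
    and baseX: "\<And>r. r \<in> C2 \<union> A1 \<Longrightarrow> ori s c r a > 0"
    and XY: "convex hull (insert X (insert c C2 \<union> insert a A1)) \<inter> convex hull (insert Y (insert a A2 \<union> insert b B1)) \<subseteq> {a}"
    and YZ: "convex hull (insert Y (insert a A2 \<union> insert b B1)) \<inter> convex hull (insert Z (insert b B2 \<union> insert c C1)) \<subseteq> {b}"
    and ZX: "convex hull (insert Z (insert b B2 \<union> insert c C1)) \<inter> convex hull (insert X (insert c C2 \<union> insert a A1)) \<subseteq> {c}"
  shows "layout D X Y Z A B C"
proof -
  interpret r: layout_sectors s Y Z X F B C A D by (rule layout_rotated)
  interpret l: layout_sectors s Z X Y F C A B D by (rule r.layout_rotated)
  let ?SX = "insert X (insert c C2 \<union> insert a A1)" and ?SY = "insert Y (insert a A2 \<union> insert b B1)"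
    and ?SZ = "insert Z (insert b B2 \<union> insert c C1)"
  let ?T = "convex hull {b, c, a}"
  have n: "a \<noteq> b" "b \<noteq> c" "c \<noteq> a" using abc disjoint by auto
  have bca: "ori s b c a > 0" and cab: "ori s c a b > 0"
    using abc(4) ori_rot(1)[of s b c a] ori_rot(2)[of s c a b] by simp_all
  have T: "ori s a b x \<ge> 0" "ori s b c x \<ge> 0" "ori s c a x \<ge> 0" if "x \<in> ?T" for x
    using hull3_ori[OF bca that] by simp_all
  have faceX: "x \<in> closed_segment c a" if "x \<in> ?T" "x \<in> convex hull ?SX" for x
  proof (rule base_face[OF _ that(2) T(3)[OF that(1)]])
    show "r \<in> {c, a} \<or> ori s c r a > 0" if "r \<in> ?SX" for r
      using that baseX[of r] l.corner[of c a] abc by auto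
  qed
  have faceY: "x \<in> closed_segment a b" if "x \<in> ?T" "x \<in> convex hull ?SY" for x
  proof (rule base_face[OF _ that(2) T(1)[OF that(1)]])
    show "r \<in> {a, b} \<or> ori s a r b > 0" if "r \<in> ?SY" for r
      using that baseY[of r] corner[of a b] abc by auto
  qed
  have faceZ: "x \<in> closed_segment b c" if "x \<in> ?T" "x \<in> convex hull ?SZ" for x
  proof (rule base_face[OF _ that(2) T(2)[OF that(1)]])
    show "r \<in> {b, c} \<or> ori s b r c > 0" if "r \<in> ?SZ" for r
      using that baseZ[of r] r.corner[of b c] abc by auto
  qed
  \<comment> \<open>The central triangle is glued to the bare edge \<open>ab\<close>, which it
    contains.\<close>
  have "glued D (a # [] @ [b, c]) (closed_segment a b \<union> ?T) (insert ?T {})"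
  proof (rule glued.glue)
    show "glued D (a # [] @ [b]) (closed_segment a b) {}" using glued.edge[OF n(1), of D] by simp
    show "\<not> collinear {b, c, a}" using ori_noncollinear bca by (metis less_irrefl)
    show "closed_segment a b \<inter> ?T \<subseteq> closed_segment b a" by (simp add: closed_segment_commute)
    show "D a b" "D b a" using DAB Dsym abc by auto
  qed
  moreover have "closed_segment a b \<subseteq> ?T" by (simp add: segment_convex_hull hull_mono)
  ultimately have G0: "glued D (a # [b] @ [c]) ?T {?T}" by (simp add: sup_absorb2)
  have "\<exists>ps qs R' \<T>'. set ps = insert c C2 - {c} \<and> set qs = insert a A1 - {a} \<and> distinct ps \<and> distinct qs \<and>
     glued D (qs @ [a] @ [b] @ [c] @ ps @ [X]) R' \<T>' \<and> R' \<subseteq> ?T \<union> convex hull ?SX"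
  proof (rule l.strip_at_Y[OF _ _ _ _ _ _ G0])
    show "?T \<inter> convex hull ?SX \<subseteq> closed_segment c a" using faceX by blast
    show "D x y" if "x \<in> insert c C2" "y \<in> insert a A1" for x y
      using that DCA A12(1) C12(1) by blast
    show "ori s c r a > 0" if "r \<in> insert c C2 \<union> insert a A1 - {c, a}" for r using that baseX by blast
  qed (use A12 C12 in auto)
  then obtain pX qX R1 \<T>1 where G1: "set pX = C2" "set qX = A1" "distinct pX" "distinct qX"
    "glued D ((qX @ [a]) @ (b # [c] @ pX @ [X])) R1 \<T>1" "R1 \<subseteq> ?T \<union> convex hull ?SX"
    using A12(2) C12(3) by auto
  have G1': "glued D (b # ([c] @ pX @ [X] @ qX) @ [a]) R1 \<T>1"
    using glued.rotate[OF G1(5)] by simp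
  have "\<exists>ps qs R' \<T>'. set ps = insert a A2 - {a} \<and> set qs = insert b B1 - {b} \<and> distinct ps \<and> distinct qs \<and>
     glued D (qs @ [b] @ ([c] @ pX @ [X] @ qX) @ [a] @ ps @ [Y]) R' \<T>' \<and> R' \<subseteq> R1 \<union> convex hull ?SY"
  proof (rule strip_at_Y[OF _ _ _ _ _ _ G1'])
    show "R1 \<inter> convex hull ?SY \<subseteq> closed_segment a b" using G1(6) faceY XY by auto
    show "D x y" if "x \<in> insert a A2" "y \<in> insert b B1" for x y
      using that DAB A12(1) B12(1) by blast
    show "ori s a r b > 0" if "r \<in> insert a A2 \<union> insert b B1 - {a, b}" for r using that baseY by blast
  qed (use A12 B12 in auto)
  then obtain pY qY R2 \<T>2 where G2: "set pY = A2" "set qY = B1" "distinct pY" "distinct qY"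
    "glued D ((qY @ [b]) @ (c # pX @ [X] @ qX @ [a] @ pY @ [Y])) R2 \<T>2" "R2 \<subseteq> R1 \<union> convex hull ?SY"
    using A12(3) B12(2) by auto
  have G2': "glued D (c # (pX @ [X] @ qX @ [a] @ pY @ [Y] @ qY) @ [b]) R2 \<T>2"
    using glued.rotate[OF G2(5)] by simp
  have "\<exists>ps qs R' \<T>'. set ps = insert b B2 - {b} \<and> set qs = insert c C1 - {c} \<and> distinct ps \<and> distinct qs \<and>
     glued D (qs @ [c] @ (pX @ [X] @ qX @ [a] @ pY @ [Y] @ qY) @ [b] @ ps @ [Z]) R' \<T>' \<and> R' \<subseteq> R2 \<union> convex hull ?SZ"
  proof (rule r.strip_at_Y[OF _ _ _ _ _ _ G2'])
    show "R2 \<inter> convex hull ?SZ \<subseteq> closed_segment b c" 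
    proof
      fix x assume x: "x \<in> R2 \<inter> convex hull ?SZ"
      then consider "x \<in> ?T" | "x \<in> convex hull ?SX" | "x \<in> convex hull ?SY"
        using G2(6) G1(6) by blast
      then show "x \<in> closed_segment b c"
      proof cases
        case 1 then show ?thesis using x faceZ by blast
      next
        case 2 then have "x = c" using x ZX by blast
        then show ?thesis by simp
      next
        case 3 then have "x = b" using x YZ by blast
        then show ?thesis by simp
      qed
    qed
    show "D x y" if "x \<in> insert b B2" "y \<in> insert c C1" for x y
      using that DBC B12(1) C12(1) by blast
    show "ori s b r c > 0" if "r \<in> insert b B2 \<union> insert c C1 - {b, c}" for r using that baseZ by blast
  qed (use C12 B12 in auto)
  then obtain pZ qZ R3 \<T>3 where G3: "set pZ = B2" "set qZ = C1" "distinct pZ" "distinct qZ"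
    "glued D ((qZ @ [c] @ pX) @ (X # qX @ [a] @ pY @ [Y] @ qY @ [b] @ pZ @ [Z])) R3 \<T>3"
    using C12(2) B12(3) by auto
  have "glued D (X # (qX @ [a] @ pY) @ Y # (qY @ [b] @ pZ) @ Z # (qZ @ [c] @ pX)) R3 \<T>3"
    using glued.rotate[OF G3(5)] by simp
  moreover have "distinct (qX @ [a] @ pY)" "set (qX @ [a] @ pY) = A"
    using G1 G2 A12 by auto
  moreover have "distinct (qY @ [b] @ pZ)" "set (qY @ [b] @ pZ) = B"
    using G3 G2 B12 by auto
  moreover have "distinct (qZ @ [c] @ pX)" "set (qZ @ [c] @ pX) = C"
    using G1 G3 C12 by auto
  ultimately show ?thesis unfolding layout_def by blast
qed

end

section \<open>Triangles surrounding \<open>F\<close>: strips separated by lines through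
  \<open>F\<close>\<close>

context layout_sectors
begin

text \<open>Seen from \<open>a\<close>, the directions to \<open>b\<close>, \<open>F\<close>,
  \<open>c\<close> follow each other counterclockwise. A point \<open>r\<close> on the wrong side of
  \<open>ca\<close> would thus fall into the cone at \<open>a\<close>, contrary to
  minimality.\<close>

lemma side_before:
  assumes min: "minimal_triple s F A B C a b c" and F: "ori s F a b > 0" "ori s F c a > 0"
    and r: "r \<in> A" "ori s F r a > 0"
  shows "ori s c r a > 0"
proof (rule ccontr)
  assume "\<not> ori s c r a > 0"
  have abc: "a \<in> A" "b \<in> B" "c \<in> C" by (rule min_mem[OF min])+
  have ra: "r \<noteq> a" "r \<noteq> c" "c \<noteq> a" using r abc disjoint by auto
  have "ori s c r a < 0"
    using \<open>\<not> ori s c r a > 0\<close> gp[of c r a] ra r(1) abc by fastforce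
  then have arc: "ori s a r c > 0" using ori_swap(3)[of s c r a] by simp
  have "ori s a b F > 0" "ori s a F c > 0" "ori s a F r > 0"
    using F r(2) ori_rot(1)[of s a b F] ori_rot(2)[of s a F c] ori_rot(2)[of s a F r] by simp_all
  then have "ori s a b r > 0" using ori_cone[of s a b F r c] arc min_ccw[OF min] by simp
  then show False using minimal_triple_cone[OF min r(1) ra(1)] arc by blast
qed

lemma rays_separate:
  assumes abc: "a \<in> A" "b \<in> B" "c \<in> C" and F: "ori s F a b > 0" "ori s F c a > 0"
    and C2: "\<And>r. r \<in> C2 \<Longrightarrow> ori s F r a > 0" and B1: "\<And>r. r \<in> B1 \<Longrightarrow> ori s F a r > 0"
  shows "convex hull (insert X (insert c C2 \<union> insert a {r \<in> A. ori s F r a > 0})) \<inter>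
     convex hull (insert Y (insert a {r \<in> A. ori s F a r > 0} \<union> insert b B1)) \<subseteq> {a}"
proof (rule hulls_meet_at_point[where s = s and x = F and y = a])
  fix r assume "r \<in> insert X (insert c C2 \<union> insert a {r \<in> A. ori s F r a > 0})"
  then have "r = a \<or> ori s F r a > 0" using A(1)[OF abc(1)] F(2) C2 by auto
  then show "r = a \<or> ori s F a r < 0" using ori_swap(2)[of s F a r] by auto
next
  fix r assume "r \<in> insert Y (insert a {r \<in> A. ori s F a r > 0} \<union> insert b B1)"
  then show "ori s F a r \<ge> 0" using A(2)[OF abc(1)] F(1) B1 by (auto simp: less_imp_le)
qed simp

lemma split_by_ray:
  assumes "a \<in> A"
  shows "A = insert a ({r \<in> A. ori s F r a > 0} \<union> {r \<in> A. ori s F a r > 0})"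
    "{r \<in> A. ori s F r a > 0} \<inter> {r \<in> A. ori s F a r > 0} = {}"
proof -
  have "ori s F r a > 0 \<or> ori s F a r > 0" if "r \<in> A" "r \<noteq> a" for r
    using gpF[of r a] that assms ori_swap(2)[of s F r a] by fastforce
  then show "A = insert a ({r \<in> A. ori s F r a > 0} \<union> {r \<in> A. ori s F a r > 0})"
    using assms by blast
  show "{r \<in> A. ori s F r a > 0} \<inter> {r \<in> A. ori s F a r > 0} = {}"
  proof -
    have "False" if "ori s F r a > 0" "ori s F a r > 0" for r
      using that ori_swap(2)[of s F r a] by simp
    then show ?thesis by blast
  qed
qed

lemma ray_in_sector:
  assumes "a \<in> A" "b \<in> B" "ori s F a b > 0" "r \<in> B" "ori s F r b > 0"
  shows "ori s F a r > 0"
  using ori_cone[of s F a Y r b] A(2)[OF assms(1)] B(1)[OF assms(4)] B(1)[OF assms(2)] assms by simp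

lemma ray_in_sector':
  assumes "a \<in> A" "b \<in> B" "ori s F a b > 0" "r \<in> A" "ori s F a r > 0"
  shows "ori s F r b > 0"
  using ori_cone[of s F a r Y b] A(2)[OF assms(4)] B(1)[OF assms(2)] A(2)[OF assms(1)] assms by simp

end

lemma (in layout_sectors) layout_mirrored: "layout_sectors (- s) Y X Z F A C B D"
proof -
  interpret m: sectors "-s" Y X Z F A C B by (rule mirror)
  show ?thesis by unfold_locales (use Dsym DAB DBC DCA DAZ DBX DCY in blast)+
qed

lemma (in layout_sectors) side_after:
  assumes min: "minimal_triple s F A B C a b c" and F: "ori s F a b > 0" "ori s F c a > 0"
    and r: "r \<in> A" "ori s F a r > 0"
  shows "ori s a r b > 0"
proof -
  interpret m: layout_sectors "-s" Y X Z F A C B D by (rule layout_mirrored)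
  show ?thesis
    using m.side_before[OF minimal_triple_mirror[OF min], of r] F r ori_rot(2)[of s b a r]
    by (simp add: ori_minus)
qed

text \<open>The rays from \<open>F\<close> to \<open>a\<close>, \<open>b\<close>, \<open>c\<close>
  split the three sectors, and their lines separate the strips; minimality places each part beyond
  the proper side of the triangle.\<close>

lemma (in layout_sectors) inside_layout:
  assumes min: "minimal_triple s F A B C a b c"
    and F: "ori s F a b > 0" "ori s F b c > 0" "ori s F c a > 0"
  shows "layout D X Y Z A B C"
proof -
  interpret r: layout_sectors s Y Z X F B C A D by (rule layout_rotated)
  interpret l: layout_sectors s Z X Y F C A B D by (rule r.layout_rotated)
  have minr: "minimal_triple s F B C A b c a" using min by (rule minimal_triple_rotate)
  have minl: "minimal_triple s F C A B c a b" using minr by (rule minimal_triple_rotate)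
  have abc: "a \<in> A" "b \<in> B" "c \<in> C" by (rule min_mem[OF min])+
  show ?thesis
  proof (rule triple_layout[OF abc min_ccw[OF min] split_by_ray(1)[OF abc(1)] _ _ split_by_ray(2)[OF abc(1)]
        r.split_by_ray(1)[OF abc(2)] _ _ r.split_by_ray(2)[OF abc(2)]
        l.split_by_ray(1)[OF abc(3)] _ _ l.split_by_ray(2)[OF abc(3)]])
    show "ori s a r b > 0" if "r \<in> {r \<in> A. ori s F a r > 0} \<union> {r \<in> B. ori s F r b > 0}" for r
      using that side_after[OF min F(1,3)] r.side_before[OF minr F(2,1)] by blast
    show "ori s b r c > 0" if "r \<in> {r \<in> B. ori s F b r > 0} \<union> {r \<in> C. ori s F r c > 0}" for r
      using that r.side_after[OF minr F(2,1)] l.side_before[OF minl F(3,2)] by blast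
    show "ori s c r a > 0" if "r \<in> {r \<in> C. ori s F c r > 0} \<union> {r \<in> A. ori s F r a > 0}" for r
      using that l.side_after[OF minl F(3,2)] side_before[OF min F(1,3)] by blast
    show "convex hull (insert X (insert c {r \<in> C. ori s F c r > 0} \<union> insert a {r \<in> A. ori s F r a > 0})) \<inter>
      convex hull (insert Y (insert a {r \<in> A. ori s F a r > 0} \<union> insert b {r \<in> B. ori s F r b > 0})) \<subseteq> {a}"
      by (rule rays_separate[OF abc F(1,3)])
        (use l.ray_in_sector'[OF abc(3,1) F(3)] ray_in_sector[OF abc(1,2) F(1)] in auto)
    show "convex hull (insert Y (insert a {r \<in> A. ori s F a r > 0} \<union> insert b {r \<in> B. ori s F r b > 0})) \<inter>
      convex hull (insert Z (insert b {r \<in> B. ori s F b r > 0} \<union> insert c {r \<in> C. ori s F r c > 0})) \<subseteq> {b}"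
      by (rule r.rays_separate[OF abc(2,3,1) F(2,1)])
        (use ray_in_sector'[OF abc(1,2) F(1)] r.ray_in_sector[OF abc(2,3) F(2)] in auto)
    show "convex hull (insert Z (insert b {r \<in> B. ori s F b r > 0} \<union> insert c {r \<in> C. ori s F r c > 0})) \<inter>
      convex hull (insert X (insert c {r \<in> C. ori s F c r > 0} \<union> insert a {r \<in> A. ori s F r a > 0})) \<subseteq> {c}"
      by (rule l.rays_separate[OF abc(3,1,2) F(3,2)])
        (use r.ray_in_sector'[OF abc(2,3) F(2)] l.ray_in_sector[OF abc(3,1) F(3)] in auto)
  qed auto
qed

section \<open>Triangles with \<open>F\<close> beyond one side\<close>

context layout_sectors begin

text \<open>If \<open>a\<close>, \<open>r\<close> were clockwise around \<open>F\<close>, then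
  \<open>rc\<close> would be counterclockwise, and so would \<open>rb\<close>, since
  \<open>r\<close> and \<open>F\<close> are on different sides of \<open>bc\<close>. But then
  \<open>r\<close> lies before \<open>b\<close> in the sector, within less than a half turn from
  \<open>a\<close>.\<close>

lemma far_ray:
  assumes abc: "a \<in> A" "b \<in> B" "c \<in> C" and F: "ori s F b c < 0" and r: "r \<in> B" "ori s r b c > 0"
  shows "ori s F a r > 0"
proof (rule ccontr)
  assume "\<not> ori s F a r > 0"
  moreover have "r \<noteq> a" using r(1) abc disjoint by auto
  ultimately have ar: "ori s F a r < 0" using gpF[of a r] r(1) abc by fastforce
  have "ori s F r c > 0" using gap_ab(1)[OF abc(1) r(1) ar abc(3)] .
  then have "ori s F r b > 0"
    using r(2) F ori_triangle[of s r b c F] ori_swap(2)[of s F r c] by simp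
  then have "ori s F a r > 0"
    using ray_in_sector[OF abc(1,2) _ r(1)] gap(3)[OF abc(2,3) F abc(1)] by blast
  then show False using ar by simp
qed

text \<open>\<open>b\<close> is a combination of \<open>F\<close>, \<open>Y\<close>,
  \<open>Z\<close> with positive weights. The affine function \<open>ori s b c\<close> vanishes at
  \<open>b\<close> and is negative at \<open>F\<close> and \<open>Z\<close>, hence positive at
  \<open>Y\<close>; the same argument with \<open>c\<close> gives \<open>X\<close>.\<close>

lemma far_corner:
  assumes bc: "b \<in> B" "c \<in> C" and F: "ori s F b c < 0"
  shows "ori s b c Z < 0" "ori s b c Y > 0" "ori s b c X > 0"
proof -
  interpret r: layout_sectors s Y Z X F B C A D by (rule layout_rotated)
  have bZc: "ori s b Z c > 0" using r.corner[of b c] bc by simp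
  then show Z: "ori s b c Z < 0" using ori_swap(2)[of s b Z c] by simp
  have bcF: "ori s b c F < 0" using F ori_rot(1)[of s b c F] by simp
  have "ori s Y Z b * ori s b c F + ori s Z F b * ori s b c Y + ori s F Y b * ori s b c Z = 0"
    using ori_bary[of s F Y Z b c b] by simp
  moreover have "ori s Y Z b * ori s b c F < 0" using inner(2)[of b] bc bcF by (simp add: mult_pos_neg)
  moreover have "ori s F Y b * ori s b c Z < 0" using B(1)[OF bc(1)] Z by (simp add: mult_pos_neg)
  moreover have "ori s Z F b > 0" using B(2)[OF bc(1)] ori_rot(2)[of s Z F b] by simp
  ultimately show "ori s b c Y > 0" by (smt (verit) mult_nonneg_nonpos)
  have "ori s Z X c * ori s b c F + ori s X F c * ori s b c Z + ori s F Z c * ori s b c X = 0"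
    using ori_bary[of s F Z X b c c] by simp
  moreover have "ori s Z X c * ori s b c F < 0" using inner(3)[of c] bc bcF by (simp add: mult_pos_neg)
  moreover have "ori s X F c > 0" using C(2)[OF bc(2)] ori_rot(2)[of s X F c] by simp
  then have "ori s X F c * ori s b c Z < 0" using Z by (simp add: mult_pos_neg)
  moreover have "ori s F Z c > 0" using C(1)[OF bc(2)] by simp
  ultimately show "ori s b c X > 0" by (smt (verit) mult_nonneg_nonpos)
qed

text \<open>The line \<open>bc\<close> takes over the role of the rays through \<open>b\<close> and
  \<open>c\<close>: it splits \<open>B\<close> and \<open>C\<close>, with the strip at
  \<open>Z\<close> on the side of \<open>F\<close> and the other strips, including all of
  \<open>A\<close>, on the other. Only \<open>A\<close> is still split by a ray from
  \<open>F\<close>.\<close>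

lemma far_layout:
  assumes min: "minimal_triple s F A B C a b c" and F: "ori s F b c < 0"
  shows "layout D X Y Z A B C"
proof -
  interpret r: layout_sectors s Y Z X F B C A D by (rule layout_rotated)
  interpret l: layout_sectors s Z X Y F C A B D by (rule r.layout_rotated)
  interpret m: layout_sectors "-s" Y X Z F A C B D by (rule layout_mirrored)
  have minr: "minimal_triple s F B C A b c a" using min by (rule minimal_triple_rotate)
  have minl: "minimal_triple s F C A B c a b" using minr by (rule minimal_triple_rotate)
  have abc: "a \<in> A" "b \<in> B" "c \<in> C" by (rule min_mem[OF min])+
  have n: "a \<noteq> b" "b \<noteq> c" "c \<noteq> a" using abc disjoint by auto
  note ga = gap(3)[OF abc(2,3) F abc(1)] gap(4)[OF abc(2,3) F abc(1)]
  have A_near: "ori s r b c > 0" if "r \<in> A" for r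
    using min_good(1)[OF min] F that by (auto simp: good_pair_def)
  have rot: "ori s b c r = ori s r b c" for r using ori_rot(1)[of s b c r] by simp
  define B1 B2 C1 C2 where "B1 = {r \<in> B. ori s r b c > 0}" and "B2 = {r \<in> B. ori s r b c < 0}"
    and "C1 = {r \<in> C. ori s r b c < 0}" and "C2 = {r \<in> C. ori s r b c > 0}"
  note defs = this
  have nzB: "ori s r b c \<noteq> 0" if "r \<in> B" "r \<noteq> b" for r
    using gp[of r b c] that abc disjoint n by auto
  have nzC: "ori s r b c \<noteq> 0" if "r \<in> C" "r \<noteq> c" for r
    using gp[of r b c] that abc disjoint n by auto
  have B12: "B = insert b (B1 \<union> B2)" "b \<notin> B1" "b \<notin> B2" "B1 \<inter> B2 = {}"
    using abc(2) nzB by (auto simp: defs neq_iff)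
  have C12: "C = insert c (C1 \<union> C2)" "c \<notin> C1" "c \<notin> C2" "C1 \<inter> C2 = {}"
    using abc(3) nzC by (auto simp: defs neq_iff)
  \<comment> \<open>Such an \<open>r\<close> lies on the same side of \<open>bc\<close> as
    \<open>a\<close>; not being beyond \<open>ab\<close>, it would lie in the cone at
    \<open>b\<close>.\<close>
  have rB: "ori s a r b > 0" if r: "r \<in> B1" for r
  proof -
    have "r \<noteq> b" using r B12(2) by blast
    then have "\<not> ori s b r a > 0"
      using r.minimal_triple_cone[OF minr, of r] r rot[of r] by (auto simp: defs)
    moreover have "ori s b r a \<noteq> 0" using gp[of b r a] r \<open>r \<noteq> b\<close> abc disjoint n by (auto simp: defs)
    ultimately show ?thesis using ori_swap(3)[of s b r a] by linarith
  qed
  have rC: "ori s c r a > 0" if r: "r \<in> C2" for r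
  proof -
    have "ori s c r b > 0" using r ori_rot(2)[of s c r b] by (simp add: defs)
    moreover have rc: "r \<noteq> c" using r C12(3) by blast
    ultimately have "\<not> ori s c a r > 0"
      using l.minimal_triple_cone[OF minl, of r] r by (auto simp: defs)
    moreover have "ori s c a r \<noteq> 0" using gp[of c a r] r rc abc disjoint n by (auto simp: defs)
    ultimately show ?thesis using ori_swap(2)[of s c a r] by linarith
  qed
  have farB: "ori s F a r > 0" if "r \<in> B1" for r
    using far_ray[OF abc F, of r] that by (auto simp: defs)
  have farC: "ori s F r a > 0" if "r \<in> C2" for r
    using m.far_ray[OF abc(1,3,2), of r] F that by (auto simp: defs ori_minus)
  note corners = far_corner[OF abc(2,3) F]
  have bca: "ori s b c a > 0" using min_ccw[OF min] ori_rot(1)[of s b c a] by simp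
  have SZ: "ori s c b r \<ge> 0" if "r \<in> insert Z (insert b B2 \<union> insert c C1)" for r
  proof -
    have "ori s b c r \<le> 0" using that corners(1) rot[of r] by (auto simp: defs)
    then show ?thesis using ori_swap(1)[of s c b r] by simp
  qed
  show ?thesis
  proof (rule triple_layout[OF abc min_ccw[OF min] split_by_ray(1)[OF abc(1)] _ _ split_by_ray(2)[OF abc(1)] B12 C12])
    show "ori s a r b > 0" if "r \<in> {r \<in> A. ori s F a r > 0} \<union> B1" for r
      using that side_after[OF min ga] rB by blast
    show "ori s b r c > 0" if "r \<in> B2 \<union> C1" for r
      using that rot[of r] ori_swap(2)[of s b r c] by (auto simp: defs)
    show "ori s c r a > 0" if "r \<in> C2 \<union> {r \<in> A. ori s F r a > 0}" for r
      using that rC side_before[OF min ga] by blast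
    show "convex hull (insert X (insert c C2 \<union> insert a {r \<in> A. ori s F r a > 0})) \<inter>
      convex hull (insert Y (insert a {r \<in> A. ori s F a r > 0} \<union> insert b B1)) \<subseteq> {a}"
      by (rule rays_separate[OF abc ga]) (use farB farC in auto)
    show "convex hull (insert Y (insert a {r \<in> A. ori s F a r > 0} \<union> insert b B1)) \<inter>
      convex hull (insert Z (insert b B2 \<union> insert c C1)) \<subseteq> {b}"
    proof (rule hulls_meet_at_point[where s = s and x = c and y = b])
      fix r assume "r \<in> insert Y (insert a {r \<in> A. ori s F a r > 0} \<union> insert b B1)"
      then have "r = b \<or> ori s b c r > 0" using corners(2) bca A_near[of r] rot[of r] by (auto simp: defs)
      then show "r = b \<or> ori s c b r < 0" using ori_swap(1)[of s c b r] by auto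
    qed (use SZ in auto)
    have "convex hull (insert X (insert c C2 \<union> insert a {r \<in> A. ori s F r a > 0})) \<inter>
      convex hull (insert Z (insert b B2 \<union> insert c C1)) \<subseteq> {c}"
    proof (rule hulls_meet_at_point[where s = s and x = c and y = b])
      fix r assume "r \<in> insert X (insert c C2 \<union> insert a {r \<in> A. ori s F r a > 0})"
      then have "r = c \<or> ori s b c r > 0" using corners(3) bca A_near[of r] rot[of r] by (auto simp: defs)
      then show "r = c \<or> ori s c b r < 0" using ori_swap(1)[of s c b r] by auto
    qed (use SZ in auto)
    then show "convex hull (insert Z (insert b B2 \<union> insert c C1)) \<inter>
      convex hull (insert X (insert c C2 \<union> insert a {r \<in> A. ori s F r a > 0})) \<subseteq> {c}" by blast
  qed auto
qed

lemma layout_exists: "layout D X Y Z A B C"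
proof -
  interpret r: layout_sectors s Y Z X F B C A D by (rule layout_rotated)
  interpret l: layout_sectors s Z X Y F C A B D by (rule r.layout_rotated)
  consider "spoke s Z A B C" | "spoke s X B C A" | "spoke s Y C A B"
    | "\<not> spoke s Z A B C" "\<not> spoke s X B C A" "\<not> spoke s Y C A B" by blast
  then show ?thesis
  proof cases
    case 1 then show ?thesis by (rule spoke_layout)
  next
    case 2 then show ?thesis by (rule layout_rotate[OF r.spoke_layout])
  next
    case 3 then show ?thesis by (rule layout_rotate[OF layout_rotate[OF l.spoke_layout]])
  next
    case 4
    then obtain a b c where min: "minimal_triple s F A B C a b c"
      using good_triple_exists minimal_triple_exists by blast
    have minr: "minimal_triple s F B C A b c a" using min by (rule minimal_triple_rotate)
    have minl: "minimal_triple s F C A B c a b" using minr by (rule minimal_triple_rotate)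
    have abc: "a \<in> A" "b \<in> B" "c \<in> C" by (rule min_mem[OF min])+
    have n: "a \<noteq> b" "b \<noteq> c" "c \<noteq> a" using abc disjoint by auto
    have nz: "ori s F a b \<noteq> 0" "ori s F b c \<noteq> 0" "ori s F c a \<noteq> 0" using gpF abc n by auto
    consider "ori s F b c < 0" | "ori s F a b < 0" | "ori s F c a < 0"
      | "ori s F a b > 0" "ori s F b c > 0" "ori s F c a > 0" using nz by linarith
    then show ?thesis
    proof cases
      case 1 then show ?thesis by (rule far_layout[OF min])
    next
      case 2 then show ?thesis by (rule layout_rotate[OF layout_rotate[OF l.far_layout[OF minl]]])
    next
      case 3 then show ?thesis by (rule layout_rotate[OF r.far_layout[OF minr]])
    next
      case 4 then show ?thesis by (rule inside_layout[OF min])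
    qed
  qed
qed

end

section \<open>From the given triangle to oriented sectors, with indices modulo 3\<close>

lemma four_eq_one: "(4::3) = 1"
  by simp

lemma sector_triangle:
  assumes tri: "ori s F X Y > 0" "ori s F Y Z > 0" "ori s F Z X > 0"
  shows "a \<in> convex hull {F, X, Y} \<Longrightarrow> ori s F X a \<ge> 0 \<and> ori s F a Y \<ge> 0"
    and "\<lbrakk>ori s F X a \<ge> 0; ori s F a Y \<ge> 0; ori s X Y a \<ge> 0\<rbrakk> \<Longrightarrow> a \<in> convex hull {F, X, Y}"
    and "Z \<notin> convex hull {F, X, Y}"
proof -
  have rot: "ori s Y F a = ori s F a Y" for a by (rule ori_rot(2))
  show *: "ori s F X a \<ge> 0 \<and> ori s F a Y \<ge> 0" if "a \<in> convex hull {F, X, Y}" for a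
    using hull3_ori[OF tri(1) that] rot[of a] by simp
  show "a \<in> convex hull {F, X, Y}" if "ori s F X a \<ge> 0" "ori s F a Y \<ge> 0" "ori s X Y a \<ge> 0"
    using in_hull3[OF tri(1), of a] that rot[of a] by simp
  show "Z \<notin> convex hull {F, X, Y}"
    using *[of Z] tri(2) ori_swap(2)[of s F Z Y] by auto
qed

theorem theorem10:
  fixes X Y Z F :: "real^2"
    and A :: "(real^2) set"
    and P :: "3 \<Rightarrow> real^2"
    and c :: "3 \<Rightarrow> nat"
  assumes triangle: "\<not> collinear {X, Y, Z}"
    and F: "F \<in> convex hull {X, Y, Z}" "F \<notin> A"
    and A: "finite A" "A \<subseteq> interior (convex hull {X, Y, Z})"
    and gp: "general_position ({X, Y, Z, F} \<union> A)"
    and P: "P 1 = X" "P 2 = Y" "P 3 = Z"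
    and c: "\<And>i. c i = card (A \<inter> convex hull {F, P i, P (i + 1)})"
    and c_pos: "\<And>i. c i > 0"
  shows "\<exists>(as :: 3 \<Rightarrow> (real^2) list) (L :: 3 \<Rightarrow> (real^2) list) (W :: (real^2) list).
           (\<forall>i. length (as i) = c i) \<and>
           distinct (as 1 @ as 2 @ as 3) \<and>
           set (as 1 @ as 2 @ as 3) = A \<and>
           (\<forall>i. L i = P i # as i @ [P (i + 1)]) \<and>
           (\<forall>i. path_image (polyline (L i)) \<subseteq> convex hull {F, P i, P (i + 1)}) \<and>
           W = L 1 @ tl (L 2) @ tl (L 3) \<and>
           simple_polygon W \<and>
           (\<exists>\<T>. polygon_triangulation W \<T> \<and>
             (\<forall>u v. triangulation_edge \<T> u v \<and> closed_segment u v \<notin> polyline_edges W \<longrightarrow>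
               \<not> (\<exists>i. u \<in> path_image (polyline (L i)) \<and> v \<in> path_image (polyline (L i)))))"
proof -
  define s where "s = sgn (ori 1 X Y Z)"
  have nz: "ori 1 X Y Z \<noteq> 0" using triangle ori_eq_0_iff[of 1 X Y Z] by simp
  then have s: "s \<noteq> 0" by (simp add: s_def sgn_zero_iff)
  have "ori s X Y Z = \<bar>ori 1 X Y Z\<bar>" by (simp add: s_def ori_def abs_sgn mult.commute)
  then have XYZ: "ori s X Y Z > 0" using nz by simp
  have gp': "ori s x y z \<noteq> 0"
    if "{x, y, z} \<subseteq> {X, Y, Z, F} \<union> A" "x \<noteq> y" "y \<noteq> z" "x \<noteq> z" for x y z
    using gp that ori_eq_0_iff[OF s] unfolding general_position_def by blast
  have nXYZ: "X \<noteq> Y" "Y \<noteq> Z" "X \<noteq> Z" using XYZ by auto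
  have notcorner: "a \<notin> {X, Y, Z}" if "a \<in> A" for a
  proof
    assume "a \<in> {X, Y, Z}"
    then have "a extreme_point_of (convex hull {X, Y, Z})" using triangle_faces(3)[OF triangle] by simp
    then show False using extreme_point_not_in_interior A(2) that by blast
  qed
  have inner: "ori s X Y a > 0 \<and> ori s Y Z a > 0 \<and> ori s Z X a > 0"
    if "a \<in> convex hull {X, Y, Z}" "a \<in> insert F A" "a \<notin> {X, Y, Z}" for a
  proof -
    have "ori s X Y a \<noteq> 0" "ori s Y Z a \<noteq> 0" "ori s Z X a \<noteq> 0"
      using gp'[of X Y a] gp'[of Y Z a] gp'[of Z X a] that nXYZ by auto
    then show ?thesis using hull3_ori[OF XYZ that(1)] by simp
  qed
  have innerA: "ori s X Y a > 0 \<and> ori s Y Z a > 0 \<and> ori s Z X a > 0" if "a \<in> A" for a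
    using inner[of a] that notcorner[of a] A(2) interior_subset[of "convex hull {X, Y, Z}"] by blast
  define T where "T i = convex hull {F, P i, P (i + 1)}" for i
  have T: "T 1 = convex hull {F, X, Y}" "T 2 = convex hull {F, Y, Z}" "T 3 = convex hull {F, Z, X}"
    using P by (simp_all add: T_def four_eq_one)
  have ne: "A \<inter> T i \<noteq> {}" for i using c_pos[of i] c[of i] by (auto simp: T_def)
  \<comment> \<open>At a corner \<open>F\<close>, one of the three triangles would collapse to a
    side; it contains a point of \<open>A\<close>, while all of \<open>A\<close> is
    interior.\<close>
  have F_corner: "F \<notin> {X, Y, Z}"
  proof
    assume "F \<in> {X, Y, Z}"
    then consider "F \<in> {X, Y}" | "F \<in> {Y, Z}" by auto
    then show False
    proof cases
      case 1
      then have "T 1 = closed_segment X Y" by (auto simp: T segment_convex_hull insert_commute)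
      then obtain a where a: "a \<in> A" "a \<in> convex hull {X, Y}" using ne[of 1] by (auto simp: segment_convex_hull)
      have "ori s Y X a \<ge> 0" by (rule hull_ori_nonneg[OF _ a(2)]) auto
      then show False using innerA[OF a(1)] ori_swap(1)[of s Y X a] by simp
    next
      case 2
      then have "T 2 = closed_segment Y Z" by (auto simp: T segment_convex_hull insert_commute)
      then obtain a where a: "a \<in> A" "a \<in> convex hull {Y, Z}" using ne[of 2] by (auto simp: segment_convex_hull)
      have "ori s Z Y a \<ge> 0" by (rule hull_ori_nonneg[OF _ a(2)]) auto
      then show False using innerA[OF a(1)] ori_swap(1)[of s Z Y a] by simp
    qed
  qed
  have innerF: "ori s X Y F > 0" "ori s Y Z F > 0" "ori s Z X F > 0"
    using inner[OF F(1) _ F_corner] by simp_all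
  then have tri: "ori s F X Y > 0" "ori s F Y Z > 0" "ori s F Z X > 0"
    using ori_rot(1)[of s X Y F] ori_rot(1)[of s Y Z F] ori_rot(1)[of s Z X F] by simp_all
  have gpF: "ori s F x y \<noteq> 0" if "x \<in> {X, Y, Z}" "y \<in> A" for x y
    using gp'[of F x y] that F(2) F_corner notcorner[of y] by auto
  have gpF': "ori s F y x \<noteq> 0" if "x \<in> {X, Y, Z}" "y \<in> A" for x y
    using gpF[OF that] ori_swap(2)[of s F y x] by simp
  have S1: "ori s F X a > 0" "ori s F a Y > 0" if "a \<in> A \<inter> T 1" for a
    using sector_triangle(1)[OF tri, of a] that gpF[of X a] gpF'[of Y a] by (auto simp: T)
  have S2: "ori s F Y a > 0" "ori s F a Z > 0" if "a \<in> A \<inter> T 2" for a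
    using sector_triangle(1)[OF tri(2,3,1), of a] that gpF[of Y a] gpF'[of Z a] by (auto simp: T)
  have S3: "ori s F Z a > 0" "ori s F a X > 0" if "a \<in> A \<inter> T 3" for a
    using sector_triangle(1)[OF tri(3,1,2), of a] that gpF[of Z a] gpF'[of X a] by (auto simp: T)
  have cover: "A \<subseteq> T 1 \<union> T 2 \<union> T 3"
  proof
    fix a assume a: "a \<in> A"
    note i = innerA[OF a]
    have z: "ori s F X a \<noteq> 0" "ori s F Y a \<noteq> 0" "ori s F Z a \<noteq> 0" using gpF a by auto
    have sw: "ori s F a x = - ori s F x a" for x by (rule ori_swap(2))
    \<comment> \<open>\<open>F\<close> is a positive combination of the corners, and
      \<open>ori s F a\<close> vanishes at \<open>F\<close>. So the signs at the corners are not all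
      equal; the place where they change from plus to minus in cyclic order names the sector of
      \<open>a\<close>.\<close>
    have "ori s Y Z F * ori s F a X + ori s Z X F * ori s F a Y + ori s X Y F * ori s F a Z = 0"
      using ori_bary[of s X Y Z F a F] by simp
    then have sum: "ori s Y Z F * ori s F X a + ori s Z X F * ori s F Y a + ori s X Y F * ori s F Z a = 0"
      by (simp add: sw)
    have "\<not> (ori s F X a > 0 \<and> ori s F Y a > 0 \<and> ori s F Z a > 0)"
    proof
      assume "ori s F X a > 0 \<and> ori s F Y a > 0 \<and> ori s F Z a > 0"
      then have "ori s Y Z F * ori s F X a > 0" "ori s Z X F * ori s F Y a > 0" "ori s X Y F * ori s F Z a > 0"
        using innerF by simp_all
      then show False using sum by linarith
    qed
    moreover have "\<not> (ori s F X a < 0 \<and> ori s F Y a < 0 \<and> ori s F Z a < 0)"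
    proof
      assume "ori s F X a < 0 \<and> ori s F Y a < 0 \<and> ori s F Z a < 0"
      then have "ori s Y Z F * ori s F X a < 0" "ori s Z X F * ori s F Y a < 0" "ori s X Y F * ori s F Z a < 0"
        using innerF by (simp_all add: mult_pos_neg)
      then show False using sum by linarith
    qed
    ultimately consider "ori s F X a > 0" "ori s F Y a < 0" | "ori s F Y a > 0" "ori s F Z a < 0"
      | "ori s F Z a > 0" "ori s F X a < 0" using z by linarith
    then show "a \<in> T 1 \<union> T 2 \<union> T 3"
    proof cases
      case 1 then show ?thesis using sector_triangle(2)[OF tri, of a] i sw[of Y] by (simp add: T)
    next
      case 2 then show ?thesis using sector_triangle(2)[OF tri(2,3,1), of a] i sw[of Z] by (simp add: T)
    next
      case 3 then show ?thesis using sector_triangle(2)[OF tri(3,1,2), of a] i sw[of X] by (simp add: T)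
    qed
  qed
  \<comment> \<open>Since \<open>L i\<close> stays in \<open>T i\<close>, forbidding a common
    triangle also forbids a common polyline, and it can be checked before the order is
    known.\<close>
  define D where "D = (\<lambda>u v. \<not> (\<exists>i. u \<in> T i \<and> v \<in> T i))"
  have D: "D u v \<longleftrightarrow> \<not> (u \<in> T 1 \<and> v \<in> T 1) \<and> \<not> (u \<in> T 2 \<and> v \<in> T 2) \<and> \<not> (u \<in> T 3 \<and> v \<in> T 3)" for u v
  proof -
    have "(\<exists>i. u \<in> T i \<and> v \<in> T i) \<longleftrightarrow> (u \<in> T 1 \<and> v \<in> T 1) \<or> (u \<in> T 2 \<and> v \<in> T 2) \<or> (u \<in> T 3 \<and> v \<in> T 3)"
      using forall_3[of "\<lambda>i. \<not> (u \<in> T i \<and> v \<in> T i)"] by blast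
    then show ?thesis unfolding D_def by blast
  qed
  have corners: "Z \<notin> T 1" "X \<notin> T 2" "Y \<notin> T 3"
    using sector_triangle(3)[OF tri] sector_triangle(3)[OF tri(2,3,1)] sector_triangle(3)[OF tri(3,1,2)]
    by (simp_all add: T)
  have disj: "A \<inter> T 1 \<inter> T 2 = {}" "A \<inter> T 2 \<inter> T 3 = {}" "A \<inter> T 3 \<inter> T 1 = {}"
  proof -
    have "False" if "a \<in> A \<inter> T 1" "a \<in> T 2" for a
      using S1(2)[OF that(1)] S2(1)[of a] that ori_swap(2)[of s F a Y] by simp
    moreover have "False" if "a \<in> A \<inter> T 2" "a \<in> T 3" for a
      using S2(2)[OF that(1)] S3(1)[of a] that ori_swap(2)[of s F a Z] by simp
    moreover have "False" if "a \<in> A \<inter> T 3" "a \<in> T 1" for a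
      using S3(2)[OF that(1)] S1(1)[of a] that ori_swap(2)[of s F a X] by simp
    ultimately show "A \<inter> T 1 \<inter> T 2 = {}" "A \<inter> T 2 \<inter> T 3 = {}" "A \<inter> T 3 \<inter> T 1 = {}" by blast+
  qed
  interpret layout_sectors s X Y Z F "A \<inter> T 1" "A \<inter> T 2" "A \<inter> T 3" D
  proof
    show "ori s x y z \<noteq> 0"
      if "{x, y, z} \<subseteq> {X, Y, Z, F} \<union> (A \<inter> T 1) \<union> (A \<inter> T 2) \<union> (A \<inter> T 3)" "x \<noteq> y" "y \<noteq> z" "x \<noteq> z" for x y z
      by (rule gp') (use that in auto)
    show "D y x" if "D x y" for x y using that by (auto simp: D)
    show "D a b" if "a \<in> A \<inter> T 1" "b \<in> A \<inter> T 2" for a b using that disj by (auto simp: D)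
    show "D a b" if "a \<in> A \<inter> T 2" "b \<in> A \<inter> T 3" for a b using that disj by (auto simp: D)
    show "D a b" if "a \<in> A \<inter> T 3" "b \<in> A \<inter> T 1" for a b using that disj by (auto simp: D)
    show "D a Z" if "a \<in> A \<inter> T 1" for a using that disj corners by (auto simp: D)
    show "D a X" if "a \<in> A \<inter> T 2" for a using that disj corners by (auto simp: D)
    show "D a Y" if "a \<in> A \<inter> T 3" for a using that disj corners by (auto simp: D)
  qed (use A(1) ne tri S1 S2 S3 innerA in auto)
  obtain l1 l2 l3 R \<T> where l: "distinct l1" "distinct l2" "distinct l3"
    "set l1 = A \<inter> T 1" "set l2 = A \<inter> T 2" "set l3 = A \<inter> T 3"
    and G: "glued D (X # l1 @ Y # l2 @ Z # l3) R \<T>"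
    using layout_exists unfolding layout_def by blast
  define as where "as = (\<lambda>i :: 3. if i = 1 then l1 else if i = 2 then l2 else l3)"
  have as: "as 1 = l1" "as 2 = l2" "as 3 = l3" by (simp_all add: as_def)
  define L where "L = (\<lambda>i. P i # as i @ [P (i + 1)])"
  have L: "L 1 = X # l1 @ [Y]" "L 2 = Y # l2 @ [Z]" "L 3 = Z # l3 @ [X]"
    using P as by (simp_all add: L_def four_eq_one)
  define W where "W = L 1 @ tl (L 2) @ tl (L 3)"
  have W: "W = close (X # l1 @ Y # l2 @ Z # l3)" by (simp add: W_def L close_def)
  have setas: "set (as i) = A \<inter> T i" for i using exhaust_3[of i] as l by auto
  have dist: "distinct (as i)" for i using exhaust_3[of i] as l by auto
  have len: "length (as i) = c i" for i
    using distinct_card[OF dist[of i]] c[of i] setas[of i] by (simp add: T_def)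
  have LT: "path_image (polyline (L i)) \<subseteq> T i" for i
  proof -
    have "path_image (polyline (L i)) \<subseteq> convex hull (set (L i))"
      by (rule path_image_polyline_subset_hull) (simp add: L_def)
    also have "convex hull (set (L i)) \<subseteq> T i"
    proof (rule hull_minimal)
      show "set (L i) \<subseteq> T i" using setas[of i] by (auto simp: L_def T_def intro: hull_inc)
    qed (simp add: T_def)
    finally show ?thesis .
  qed
  have "triangulated_polygon D (X # l1 @ Y # l2 @ Z # l3) R \<T>"
    using glued_triangulated_polygon[OF G] by (auto simp: append_eq_Cons_conv Cons_eq_append_conv)
  then have tp: "simple_path (polyline W)" "polygon_triangulation W \<T>"
    "\<And>u v. triangulation_edge \<T> u v \<Longrightarrow> closed_segment u v \<in> polyline_edges W \<or> D u v"
    by (auto simp: triangulated_polygon_def W)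
  have "simple_polygon W"
    unfolding simple_polygon_def using tp(1) close_polygon_ends[of "X # l1 @ Y # l2 @ Z # l3"] by (simp add: W)
  moreover have "\<not> (\<exists>i. u \<in> path_image (polyline (L i)) \<and> v \<in> path_image (polyline (L i)))"
    if "triangulation_edge \<T> u v" "closed_segment u v \<notin> polyline_edges W" for u v
    using tp(3)[OF that(1)] that(2) LT unfolding D_def by blast
  moreover have "distinct (as 1 @ as 2 @ as 3)"
    using dist setas disj by auto
  moreover have "set (as 1 @ as 2 @ as 3) = A" using setas cover by auto
  ultimately show ?thesis
    using len LT tp(2) W_def unfolding L_def T_def
    by (intro exI[of _ as] exI[of _ L] exI[of _ W]) (auto simp: L_def T_def)
qed

end
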